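(* Let $n\ge 1$ and let $\mathcal{C}_1,\dots,\mathcal{C}_n$ be strict 2-categories. Define $\bigotimes_{i=1}^{1}\mathcal{C}_i := \mathcal{C}_1$ and $\bigotimes_{i=1}^{k+1}\mathcal{C}_i := \left(\bigotimes_{i=1}^{k}\mathcal{C}_i\right)\otimes_l \mathcal{C}_{k+1}$, where $\otimes_l$ is the lax Gray tensor product. Then $\bigotimes_{i=1}^n\mathcal{C}_i$ is the strict 2-category described as follows. 1. Its 0-cells are $n$-tuples $(a_1,\dots,a_n)$ with $a_i$ a 0-cell of $\mathcal{C}_i$. 2. Its 1-cells are generated under composition by $\{f\}_i : (a_1,\dots,a_i,\dots,a_n)\to(a_1,\dots,a_i',\dots,a_n)$ for $f:a_i\to a_i'$ in $\mathcal{C}_i$, subject to the relations $\{f\}_i\cdot\{g\}_i = \{f\cdot g\}_i$ for all composable $f,g$ and all $i$ (with $\{\mathbf{Id}\}_i$ the identity 1-cell). 3. Its 2-cells are generated under horizontal and vertical composition by - $\{\phi\}_i : \{f\}_i\to\{g\}_i$ for each 2-cell $\phi:f\to g$ in $\mathcal{C}_i$, - $\gamma^{i,j}_{f,g} : \{f\}_i\cdot\{g\}_j \to \{g\}_j\cdot\{f\}_i$ for each $i<j$, each 1-cell $f$ of $\mathcal{C}_i$ and each 1-cell $g$ of $\mathcal{C}_j$, subject to the following relations, whenever well-typed: (a) for each $i$: $\{\phi\}_i\circ\{\psi\}_i = \{\phi\circ\psi\}_i$ and $\{\phi\}_i\cdot\{\psi\}_i=\{\phi\cdot\psi\}_i$;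 (b) for each $i<j$: $\gamma^{i,j}_{f,\mathbf{Id}} = \{f\}_i$ and $\gamma^{i,j}_{\mathbf{Id},f}=\{f\}_j$ (where a 1-cell denotes its identity 2-cell); (c) for each $i<j$: $$\gamma^{i,j}_{(f_1\cdot f_2),g} = (\gamma^{i,j}_{f_1,g}\cdot\{f_2\}_i)\circ(\{f_1\}_i\cdot\gamma^{i,j}_{f_2,g}),$$ $$\gamma^{i,j}_{f,(g_1\cdot g_2)} = (\{g_1\}_j\cdot\gamma^{i,j}_{f,g_2})\circ(\gamma^{i,j}_{f,g_1}\cdot\{g_2\}_j);$$ (d) for each $i<j$, each $\phi : f_1\to f_2$ in $\mathcal{C}_i$ and each $\psi:g_1\to g_2$ in $\mathcal{C}_j$: $$(\{\psi\}_j\cdot\{\phi\}_i)\circ\gamma^{i,j}_{f_1,g_1} = \gamma^{i,j}_{f_2,g_2}\circ(\{\phi\}_i\cdot\{\psi\}_j);$$ (e) (Yang-Baxter) for each $i<j<k$: $$(\{h\}_k\cdot\gamma^{i,j}_{f,g})\circ(\gamma^{i,k}_{f,h}\cdot\{g\}_j)\circ(\{f\}_i\cdot\gamma^{j,k}_{g,h}) = (\gamma^{j,k}_{g,h}\cdot\{f\}_i)\circ(\{g\}_j\cdot\gamma^{i,k}_{f,h})\circ(\gamma^{i,j}_{f,g}\cdot\{h\}_k).$$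
   Context: Vertical composition of 2-cells is written $\circ$; horizontal composition (and composition of 1-cells) is written $\cdot$, in right-to-left order. When a 1-cell appears in a horizontal composite of 2-cells, it stands for its identity 2-cell. The lax Gray tensor product $\mathcal{B}\otimes_l\mathcal{C}$ of strict 2-categories is the strict 2-category with the following description. - Objects are pairs $(b,c)$. - 1-cells are composable sequences of pairs $(f,\mathbf{Id}_c):(b,c)\to(b',c)$ and $(\mathbf{Id}_b,g):(b,c)\to(b,c')$, with $f$ a 1-cell of $\mathcal{B}$ and $g$ a 1-cell of $\mathcal{C}$, subject to $(f_1,\mathbf{Id})\cdot(f_2,\mathbf{Id})=(f_1\cdot f_2,\mathbf{Id})$ and $(\mathbf{Id},g_1)\cdot(\mathbf{Id},g_2)=(\mathbf{Id},g_1\cdot g_2)$, with $(\mathbf{Id},\mathbf{Id})$ the identity. - 2-cells are generated under horizontal and vertical composition by $(\phi,\mathbf{Id}):(f_1,\mathbf{Id})\to(f_2,\mathbf{Id})$ for $\phi:f_1\to f_2$ in $\mathcal{B}$, by $(\mathbf{Id},\psi):(\mathbf{Id},g_1)\to(\mathbf{Id},g_2)$ for $\psi:g_1\to g_2$ in $\mathcal{C}$, and by $\gamma_{f,g}:(f,\mathbf{Id})\cdot(\mathbf{Id},g)\to(\mathbf{Id},g)\cdot(f,\mathbf{Id})$. The 2-cells are subject to these relations: - $(\phi_1,\mathbf{Id})\circ(\phi_2,\mathbf{Id})=(\phi_1\circ\phi_2,\mathbf{Id})$ and $(\phi_1,\mathbf{Id})\cdot(\phi_2,\mathbf{Id})=(\phi_1\cdot\phi_2,\mathbf{Id})$,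 and likewise for $(\mathbf{Id},\psi_1)$, $(\mathbf{Id},\psi_2)$; - $\gamma_{f,\mathbf{Id}}$ is the identity of $(f,\mathbf{Id})$ and $\gamma_{\mathbf{Id},g}$ is the identity of $(\mathbf{Id},g)$; - $\gamma_{(f_1\cdot f_2),g}=(\gamma_{f_1,g}\cdot(f_2,\mathbf{Id}))\circ((f_1,\mathbf{Id})\cdot\gamma_{f_2,g})$; - $\gamma_{f,(g_1\cdot g_2)}=((\mathbf{Id},g_1)\cdot\gamma_{f,g_2})\circ(\gamma_{f,g_1}\cdot(\mathbf{Id},g_2))$; - $\gamma_{f_2,g_2}\circ((\phi,\mathbf{Id})\cdot(\mathbf{Id},\psi))=((\mathbf{Id},\psi)\cdot(\phi,\mathbf{Id}))\circ\gamma_{f_1,g_1}$ for $\phi:f_1\to f_2$, $\psi:g_1\to g_2$. Under the identification in the claim, for $n=2$ one writes $\{f\}_1=(f,\mathbf{Id})$, $\{g\}_2=(\mathbf{Id},g)$ and $\gamma^{1,2}_{f,g}=\gamma_{f,g}$. For general $n$ one writes inductively $\{f\}_i=(\{f\}_i,\mathbf{Id})$ for $i\le n$, $\{f\}_{n+1}=(\mathbf{Id},f)$, $\gamma^{i,j}_{f,g}=(\gamma^{i,j}_{f,g},\mathbf{Id})$ for $i<j\le n$, and $\gamma^{i,n+1}_{f,g}=\gamma_{\{f\}_i,g}$. *)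

theory Defs
  imports Main
begin

section \<open>Strict 2-categories\<close>

text \<open>
  All compositions are written in right-to-left order: \<open>comp1 X g f\<close> is $g \cdot f$
  (first \<open>f\<close>, then \<open>g\<close>), \<open>vcomp X \<beta> \<alpha>\<close> is $\beta \circ \alpha$ and
  \<open>hcomp X \<beta> \<alpha>\<close> is $\beta \cdot \alpha$.
\<close>

record ('o, 'a, 't) two_cat =
  Obj :: "'o set"
  Arr :: "'a set"
  Cell :: "'t set"
  src :: "'a \<Rightarrow> 'o"
  tgt :: "'a \<Rightarrow> 'o"
  id1 :: "'o \<Rightarrow> 'a"
  comp1 :: "'a \<Rightarrow> 'a \<Rightarrow> 'a"
  dom2 :: "'t \<Rightarrow> 'a"
  cod2 :: "'t \<Rightarrow> 'a"
  id2 :: "'a \<Rightarrow> 't"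
  vcomp :: "'t \<Rightarrow> 't \<Rightarrow> 't"
  hcomp :: "'t \<Rightarrow> 't \<Rightarrow> 't"

definition src0 :: "('o, 'a, 't) two_cat \<Rightarrow> 't \<Rightarrow> 'o" where
  "src0 X \<alpha> = src X (dom2 X \<alpha>)"

definition tgt0 :: "('o, 'a, 't) two_cat \<Rightarrow> 't \<Rightarrow> 'o" where
  "tgt0 X \<alpha> = tgt X (dom2 X \<alpha>)"

locale strict_2category =
  fixes X :: "('o, 'a, 't) two_cat"
  assumes src_obj: "f \<in> Arr X \<Longrightarrow> src X f \<in> Obj X"
    and tgt_obj: "f \<in> Arr X \<Longrightarrow> tgt X f \<in> Obj X"
    and id1_arr: "a \<in> Obj X \<Longrightarrow> id1 X a \<in> Arr X"
    and src_id1: "a \<in> Obj X \<Longrightarrow> src X (id1 X a) = a"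
    and tgt_id1: "a \<in> Obj X \<Longrightarrow> tgt X (id1 X a) = a"
    and comp1_arr:
      "\<lbrakk>f \<in> Arr X; g \<in> Arr X; src X g = tgt X f\<rbrakk> \<Longrightarrow> comp1 X g f \<in> Arr X"
    and src_comp1:
      "\<lbrakk>f \<in> Arr X; g \<in> Arr X; src X g = tgt X f\<rbrakk> \<Longrightarrow> src X (comp1 X g f) = src X f"
    and tgt_comp1:
      "\<lbrakk>f \<in> Arr X; g \<in> Arr X; src X g = tgt X f\<rbrakk> \<Longrightarrow> tgt X (comp1 X g f) = tgt X g"
    and comp1_assoc:
      "\<lbrakk>f \<in> Arr X; g \<in> Arr X; h \<in> Arr X; src X g = tgt X f; src X h = tgt X g\<rbrakk>
        \<Longrightarrow> comp1 X (comp1 X h g) f = comp1 X h (comp1 X g f)"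
    and comp1_id_left: "f \<in> Arr X \<Longrightarrow> comp1 X (id1 X (tgt X f)) f = f"
    and comp1_id_right: "f \<in> Arr X \<Longrightarrow> comp1 X f (id1 X (src X f)) = f"
    and dom2_arr: "\<alpha> \<in> Cell X \<Longrightarrow> dom2 X \<alpha> \<in> Arr X"
    and cod2_arr: "\<alpha> \<in> Cell X \<Longrightarrow> cod2 X \<alpha> \<in> Arr X"
    and src_parallel: "\<alpha> \<in> Cell X \<Longrightarrow> src X (cod2 X \<alpha>) = src X (dom2 X \<alpha>)"
    and tgt_parallel: "\<alpha> \<in> Cell X \<Longrightarrow> tgt X (cod2 X \<alpha>) = tgt X (dom2 X \<alpha>)"
    and id2_cell: "f \<in> Arr X \<Longrightarrow> id2 X f \<in> Cell X"
    and dom2_id2: "f \<in> Arr X \<Longrightarrow> dom2 X (id2 X f) = f"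
    and cod2_id2: "f \<in> Arr X \<Longrightarrow> cod2 X (id2 X f) = f"
    and vcomp_cell:
      "\<lbrakk>\<alpha> \<in> Cell X; \<beta> \<in> Cell X; dom2 X \<beta> = cod2 X \<alpha>\<rbrakk> \<Longrightarrow> vcomp X \<beta> \<alpha> \<in> Cell X"
    and dom2_vcomp:
      "\<lbrakk>\<alpha> \<in> Cell X; \<beta> \<in> Cell X; dom2 X \<beta> = cod2 X \<alpha>\<rbrakk> \<Longrightarrow> dom2 X (vcomp X \<beta> \<alpha>) = dom2 X \<alpha>"
    and cod2_vcomp:
      "\<lbrakk>\<alpha> \<in> Cell X; \<beta> \<in> Cell X; dom2 X \<beta> = cod2 X \<alpha>\<rbrakk> \<Longrightarrow> cod2 X (vcomp X \<beta> \<alpha>) = cod2 X \<beta>"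
    and vcomp_assoc:
      "\<lbrakk>\<alpha> \<in> Cell X; \<beta> \<in> Cell X; \<delta> \<in> Cell X; dom2 X \<beta> = cod2 X \<alpha>; dom2 X \<delta> = cod2 X \<beta>\<rbrakk>
        \<Longrightarrow> vcomp X (vcomp X \<delta> \<beta>) \<alpha> = vcomp X \<delta> (vcomp X \<beta> \<alpha>)"
    and vcomp_id_left: "\<alpha> \<in> Cell X \<Longrightarrow> vcomp X (id2 X (cod2 X \<alpha>)) \<alpha> = \<alpha>"
    and vcomp_id_right: "\<alpha> \<in> Cell X \<Longrightarrow> vcomp X \<alpha> (id2 X (dom2 X \<alpha>)) = \<alpha>"
    and hcomp_cell:
      "\<lbrakk>\<alpha> \<in> Cell X; \<beta> \<in> Cell X; src0 X \<beta> = tgt0 X \<alpha>\<rbrakk> \<Longrightarrow> hcomp X \<beta> \<alpha> \<in> Cell X"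
    and dom2_hcomp:
      "\<lbrakk>\<alpha> \<in> Cell X; \<beta> \<in> Cell X; src0 X \<beta> = tgt0 X \<alpha>\<rbrakk>
        \<Longrightarrow> dom2 X (hcomp X \<beta> \<alpha>) = comp1 X (dom2 X \<beta>) (dom2 X \<alpha>)"
    and cod2_hcomp:
      "\<lbrakk>\<alpha> \<in> Cell X; \<beta> \<in> Cell X; src0 X \<beta> = tgt0 X \<alpha>\<rbrakk>
        \<Longrightarrow> cod2 X (hcomp X \<beta> \<alpha>) = comp1 X (cod2 X \<beta>) (cod2 X \<alpha>)"
    and hcomp_assoc:
      "\<lbrakk>\<alpha> \<in> Cell X; \<beta> \<in> Cell X; \<delta> \<in> Cell X; src0 X \<beta> = tgt0 X \<alpha>; src0 X \<delta> = tgt0 X \<beta>\<rbrakk>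
        \<Longrightarrow> hcomp X (hcomp X \<delta> \<beta>) \<alpha> = hcomp X \<delta> (hcomp X \<beta> \<alpha>)"
    and hcomp_id_left: "\<alpha> \<in> Cell X \<Longrightarrow> hcomp X (id2 X (id1 X (tgt0 X \<alpha>))) \<alpha> = \<alpha>"
    and hcomp_id_right: "\<alpha> \<in> Cell X \<Longrightarrow> hcomp X \<alpha> (id2 X (id1 X (src0 X \<alpha>))) = \<alpha>"
    and hcomp_id2:
      "\<lbrakk>f \<in> Arr X; g \<in> Arr X; src X g = tgt X f\<rbrakk>
        \<Longrightarrow> hcomp X (id2 X g) (id2 X f) = id2 X (comp1 X g f)"
    and interchange:
      "\<lbrakk>\<alpha> \<in> Cell X; \<alpha>' \<in> Cell X; \<beta> \<in> Cell X; \<beta>' \<in> Cell X;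
        dom2 X \<alpha>' = cod2 X \<alpha>; dom2 X \<beta>' = cod2 X \<beta>; src0 X \<beta> = tgt0 X \<alpha>\<rbrakk>
        \<Longrightarrow> hcomp X (vcomp X \<beta>' \<beta>) (vcomp X \<alpha>' \<alpha>)
            = vcomp X (hcomp X \<beta>' \<alpha>') (hcomp X \<beta> \<alpha>)"

locale strict_2functor =
  S: strict_2category X + T: strict_2category Y
  for X :: "('o, 'a, 't) two_cat" and Y :: "('p, 'b, 'u) two_cat" +
  fixes F0 :: "'o \<Rightarrow> 'p" and F1 :: "'a \<Rightarrow> 'b" and F2 :: "'t \<Rightarrow> 'u"
  assumes F0_obj: "a \<in> Obj X \<Longrightarrow> F0 a \<in> Obj Y"
    and F1_arr: "f \<in> Arr X \<Longrightarrow> F1 f \<in> Arr Y"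
    and F2_cell: "\<alpha> \<in> Cell X \<Longrightarrow> F2 \<alpha> \<in> Cell Y"
    and F1_src: "f \<in> Arr X \<Longrightarrow> src Y (F1 f) = F0 (src X f)"
    and F1_tgt: "f \<in> Arr X \<Longrightarrow> tgt Y (F1 f) = F0 (tgt X f)"
    and F1_id: "a \<in> Obj X \<Longrightarrow> F1 (id1 X a) = id1 Y (F0 a)"
    and F1_comp:
      "\<lbrakk>f \<in> Arr X; g \<in> Arr X; src X g = tgt X f\<rbrakk>
        \<Longrightarrow> F1 (comp1 X g f) = comp1 Y (F1 g) (F1 f)"
    and F2_dom: "\<alpha> \<in> Cell X \<Longrightarrow> dom2 Y (F2 \<alpha>) = F1 (dom2 X \<alpha>)"
    and F2_cod: "\<alpha> \<in> Cell X \<Longrightarrow> cod2 Y (F2 \<alpha>) = F1 (cod2 X \<alpha>)"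
    and F2_id: "f \<in> Arr X \<Longrightarrow> F2 (id2 X f) = id2 Y (F1 f)"
    and F2_vcomp:
      "\<lbrakk>\<alpha> \<in> Cell X; \<beta> \<in> Cell X; dom2 X \<beta> = cod2 X \<alpha>\<rbrakk>
        \<Longrightarrow> F2 (vcomp X \<beta> \<alpha>) = vcomp Y (F2 \<beta>) (F2 \<alpha>)"
    and F2_hcomp:
      "\<lbrakk>\<alpha> \<in> Cell X; \<beta> \<in> Cell X; src0 X \<beta> = tgt0 X \<alpha>\<rbrakk>
        \<Longrightarrow> F2 (hcomp X \<beta> \<alpha>) = hcomp Y (F2 \<beta>) (F2 \<alpha>)"

locale strict_2isomorphism = strict_2functor +
  assumes F0_bij: "bij_betw F0 (Obj X) (Obj Y)"
    and F1_bij: "bij_betw F1 (Arr X) (Arr Y)"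
    and F2_bij: "bij_betw F2 (Cell X) (Cell Y)"

text \<open>Transport of structure along maps that are injective on the cells of \<open>X\<close>.\<close>

definition relabel ::
  "('o \<Rightarrow> 'p) \<Rightarrow> ('a \<Rightarrow> 'b) \<Rightarrow> ('t \<Rightarrow> 'u) \<Rightarrow> ('o, 'a, 't) two_cat \<Rightarrow> ('p, 'b, 'u) two_cat"
where
  "relabel h0 h1 h2 X =
    (let k0 = inv_into (Obj X) h0; k1 = inv_into (Arr X) h1; k2 = inv_into (Cell X) h2 in
     \<lparr>Obj = h0 ` Obj X, Arr = h1 ` Arr X, Cell = h2 ` Cell X,
      src = (\<lambda>f. h0 (src X (k1 f))),
      tgt = (\<lambda>f. h0 (tgt X (k1 f))),
      id1 = (\<lambda>a. h1 (id1 X (k0 a))),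
      comp1 = (\<lambda>g f. h1 (comp1 X (k1 g) (k1 f))),
      dom2 = (\<lambda>\<alpha>. h1 (dom2 X (k2 \<alpha>))),
      cod2 = (\<lambda>\<alpha>. h1 (cod2 X (k2 \<alpha>))),
      id2 = (\<lambda>f. h2 (id2 X (k1 f))),
      vcomp = (\<lambda>\<beta> \<alpha>. h2 (vcomp X (k2 \<beta>) (k2 \<alpha>))),
      hcomp = (\<lambda>\<beta> \<alpha>. h2 (hcomp X (k2 \<beta>) (k2 \<alpha>)))\<rparr>)"


section \<open>Strict 2-categories given by generators and relations\<close>

text \<open>
  A path \<open>([e\<^sub>1, \<dots>, e\<^sub>m], a)\<close> stands for $e_1 \cdots e_m$ with source object \<open>a\<close>, so that
  \<open>e\<^sub>m\<close> comes first; \<open>([], a)\<close> is the identity of \<open>a\<close>.  The formal 2-cells are built from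
  generators and identities of paths by vertical (\<open>VC\<close>) and horizontal (\<open>HC\<close>) composition.
\<close>

type_synonym ('o, 'e) path = "'e list \<times> 'o"

datatype ('o, 'e, 'g) tm =
    Gen 'g
  | Idt "('o, 'e) path"
  | VC "('o, 'e, 'g) tm" "('o, 'e, 'g) tm"
  | HC "('o, 'e, 'g) tm" "('o, 'e, 'g) tm"

record ('o, 'e, 'g) presentation =
  P0 :: "'o set"
  P1 :: "'e set"
  esrc :: "'e \<Rightarrow> 'o"
  etgt :: "'e \<Rightarrow> 'o"
  rel1 :: "('o, 'e) path \<Rightarrow> ('o, 'e) path \<Rightarrow> bool"
  P2 :: "'g set"
  gdom :: "'g \<Rightarrow> ('o, 'e) path"
  gcod :: "'g \<Rightarrow> ('o, 'e) path"
  rel2 :: "('o, 'e, 'g) tm \<Rightarrow> ('o, 'e, 'g) tm \<Rightarrow> bool"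

definition pcat :: "('o, 'e) path \<Rightarrow> ('o, 'e) path \<Rightarrow> ('o, 'e) path" (infixr "\<cdot>\<^sub>p" 75) where
  "p \<cdot>\<^sub>p q = (fst p @ fst q, snd q)"

definition psrc :: "('o, 'e) path \<Rightarrow> 'o" where
  "psrc p = snd p"

definition ptgt :: "('o, 'e, 'g) presentation \<Rightarrow> ('o, 'e) path \<Rightarrow> 'o" where
  "ptgt P p = (case fst p of [] \<Rightarrow> snd p | e # es \<Rightarrow> etgt P e)"

fun is_edges :: "('o, 'e, 'g) presentation \<Rightarrow> 'e list \<Rightarrow> 'o \<Rightarrow> bool" where
  "is_edges P [] a \<longleftrightarrow> a \<in> P0 P"
| "is_edges P (e # es) a \<longleftrightarrow> e \<in> P1 P \<and> is_edges P es a \<and> esrc P e = ptgt P (es, a)"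

definition is_path :: "('o, 'e, 'g) presentation \<Rightarrow> ('o, 'e) path \<Rightarrow> bool" where
  "is_path P p = is_edges P (fst p) (snd p)"

inductive cong1 :: "('o, 'e, 'g) presentation \<Rightarrow> ('o, 'e) path \<Rightarrow> ('o, 'e) path \<Rightarrow> bool"
  for P where
  rel: "rel1 P p q \<Longrightarrow> cong1 P p q"
| refl: "is_path P p \<Longrightarrow> cong1 P p p"
| sym: "cong1 P p q \<Longrightarrow> cong1 P q p"
| trans: "\<lbrakk>cong1 P p q; cong1 P q r\<rbrakk> \<Longrightarrow> cong1 P p r"
| comp: "\<lbrakk>cong1 P p p'; cong1 P q q'; psrc p = ptgt P q\<rbrakk> \<Longrightarrow> cong1 P (p \<cdot>\<^sub>p q) (p' \<cdot>\<^sub>p q')"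

fun tdom :: "('o, 'e, 'g) presentation \<Rightarrow> ('o, 'e, 'g) tm \<Rightarrow> ('o, 'e) path" where
  "tdom P (Gen g) = gdom P g"
| "tdom P (Idt p) = p"
| "tdom P (VC s t) = tdom P t"
| "tdom P (HC s t) = tdom P s \<cdot>\<^sub>p tdom P t"

fun tcod :: "('o, 'e, 'g) presentation \<Rightarrow> ('o, 'e, 'g) tm \<Rightarrow> ('o, 'e) path" where
  "tcod P (Gen g) = gcod P g"
| "tcod P (Idt p) = p"
| "tcod P (VC s t) = tcod P s"
| "tcod P (HC s t) = tcod P s \<cdot>\<^sub>p tcod P t"

fun wf_tm :: "('o, 'e, 'g) presentation \<Rightarrow> ('o, 'e, 'g) tm \<Rightarrow> bool" where
  "wf_tm P (Gen g) \<longleftrightarrow> g \<in> P2 P"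
| "wf_tm P (Idt p) \<longleftrightarrow> is_path P p"
| "wf_tm P (VC s t) \<longleftrightarrow> wf_tm P s \<and> wf_tm P t \<and> cong1 P (tdom P s) (tcod P t)"
| "wf_tm P (HC s t) \<longleftrightarrow> wf_tm P s \<and> wf_tm P t \<and> psrc (tdom P s) = ptgt P (tdom P t)"

text \<open>
  The smallest congruence on well-formed formal 2-cells that contains the given relations and
  the axioms of strict 2-categories.
\<close>

inductive cong2 :: "('o, 'e, 'g) presentation \<Rightarrow> ('o, 'e, 'g) tm \<Rightarrow> ('o, 'e, 'g) tm \<Rightarrow> bool"
  for P where
  rel: "rel2 P s t \<Longrightarrow> cong2 P s t"
| refl: "wf_tm P t \<Longrightarrow> cong2 P t t"
| sym: "cong2 P s t \<Longrightarrow> cong2 P t s"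
| trans: "\<lbrakk>cong2 P s t; cong2 P t u\<rbrakk> \<Longrightarrow> cong2 P s u"
| Idt: "cong1 P p q \<Longrightarrow> cong2 P (Idt p) (Idt q)"
| VC: "\<lbrakk>cong2 P s s'; cong2 P t t'; wf_tm P (VC s t)\<rbrakk> \<Longrightarrow> cong2 P (VC s t) (VC s' t')"
| HC: "\<lbrakk>cong2 P s s'; cong2 P t t'; wf_tm P (HC s t)\<rbrakk> \<Longrightarrow> cong2 P (HC s t) (HC s' t')"
| VC_assoc: "wf_tm P (VC s (VC t u)) \<Longrightarrow> cong2 P (VC (VC s t) u) (VC s (VC t u))"
| VC_id_left: "wf_tm P t \<Longrightarrow> cong2 P (VC (Idt (tcod P t)) t) t"
| VC_id_right: "wf_tm P t \<Longrightarrow> cong2 P (VC t (Idt (tdom P t))) t"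
| HC_assoc: "wf_tm P (HC s (HC t u)) \<Longrightarrow> cong2 P (HC (HC s t) u) (HC s (HC t u))"
| HC_id_left: "wf_tm P t \<Longrightarrow> cong2 P (HC (Idt ([], ptgt P (tdom P t))) t) t"
| HC_id_right: "wf_tm P t \<Longrightarrow> cong2 P (HC t (Idt ([], psrc (tdom P t)))) t"
| HC_Idt: "wf_tm P (HC (Idt p) (Idt q)) \<Longrightarrow> cong2 P (HC (Idt p) (Idt q)) (Idt (p \<cdot>\<^sub>p q))"
| interchange: "\<lbrakk>wf_tm P (VC s' s); wf_tm P (VC t' t); wf_tm P (HC s t)\<rbrakk>
    \<Longrightarrow> cong2 P (HC (VC s' s) (VC t' t)) (VC (HC s' t') (HC s t))"

definition cls1 :: "('o, 'e, 'g) presentation \<Rightarrow> ('o, 'e) path \<Rightarrow> ('o, 'e) path set" where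
  "cls1 P p = {q. cong1 P p q}"

definition cls2 :: "('o, 'e, 'g) presentation \<Rightarrow> ('o, 'e, 'g) tm \<Rightarrow> ('o, 'e, 'g) tm set" where
  "cls2 P t = {s. cong2 P t s}"

definition presented ::
  "('o, 'e, 'g) presentation \<Rightarrow> ('o, ('o, 'e) path set, ('o, 'e, 'g) tm set) two_cat"
where
  "presented P =
    \<lparr>Obj = P0 P,
     Arr = {cls1 P p |p. is_path P p},
     Cell = {cls2 P t |t. wf_tm P t},
     src = (\<lambda>A. the_elem (psrc ` A)),
     tgt = (\<lambda>A. the_elem (ptgt P ` A)),
     id1 = (\<lambda>a. cls1 P ([], a)),
     comp1 = (\<lambda>A B. \<Union>p\<in>A. \<Union>q\<in>B. cls1 P (p \<cdot>\<^sub>p q)),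
     dom2 = (\<lambda>S. \<Union>s\<in>S. cls1 P (tdom P s)),
     cod2 = (\<lambda>S. \<Union>s\<in>S. cls1 P (tcod P s)),
     id2 = (\<lambda>A. \<Union>p\<in>A. cls2 P (Idt p)),
     vcomp = (\<lambda>S T. \<Union>s\<in>S. \<Union>t\<in>T. cls2 P (VC s t)),
     hcomp = (\<lambda>S T. \<Union>s\<in>S. \<Union>t\<in>T. cls2 P (HC s t))\<rparr>"


section \<open>The lax Gray tensor product\<close>

text \<open>
  \<open>LArr f c\<close> is $(f, \mathbf{Id}_c)$, \<open>RArr b g\<close> is $(\mathbf{Id}_b, g)$, and similarly for 2-cells;
  \<open>Gam f g\<close> is $\gamma_{f,g}$.
\<close>

datatype ('o1, 'a1, 'o2, 'a2) gray_edge =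
    LArr 'a1 'o2
  | RArr 'o1 'a2

datatype ('o1, 'a1, 't1, 'o2, 'a2, 't2) gray_gen =
    LCell 't1 'o2
  | RCell 'o1 't2
  | Gam 'a1 'a2

type_synonym ('o1, 'a1, 'o2, 'a2) gray_path =
  "('o1 \<times> 'o2, ('o1, 'a1, 'o2, 'a2) gray_edge) path"

type_synonym ('o1, 'a1, 't1, 'o2, 'a2, 't2) gray_tm =
  "('o1 \<times> 'o2, ('o1, 'a1, 'o2, 'a2) gray_edge, ('o1, 'a1, 't1, 'o2, 'a2, 't2) gray_gen) tm"

definition lpath ::
  "('o1, 'a1, 't1) two_cat \<Rightarrow> 'a1 \<Rightarrow> 'o2 \<Rightarrow> ('o1, 'a1, 'o2, 'a2) gray_path"
where
  "lpath B f c = ([LArr f c], (src B f, c))"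

definition rpath ::
  "('o2, 'a2, 't2) two_cat \<Rightarrow> 'o1 \<Rightarrow> 'a2 \<Rightarrow> ('o1, 'a1, 'o2, 'a2) gray_path"
where
  "rpath C b g = ([RArr b g], (b, src C g))"

inductive gray_rel1 ::
  "('o1, 'a1, 't1) two_cat \<Rightarrow> ('o2, 'a2, 't2) two_cat
    \<Rightarrow> ('o1, 'a1, 'o2, 'a2) gray_path \<Rightarrow> ('o1, 'a1, 'o2, 'a2) gray_path \<Rightarrow> bool"
  for B C where
  left_comp: "\<lbrakk>f1 \<in> Arr B; f2 \<in> Arr B; src B f1 = tgt B f2; c \<in> Obj C\<rbrakk>
    \<Longrightarrow> gray_rel1 B C (lpath B f1 c \<cdot>\<^sub>p lpath B f2 c) (lpath B (comp1 B f1 f2) c)"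
| right_comp: "\<lbrakk>g1 \<in> Arr C; g2 \<in> Arr C; src C g1 = tgt C g2; b \<in> Obj B\<rbrakk>
    \<Longrightarrow> gray_rel1 B C (rpath C b g1 \<cdot>\<^sub>p rpath C b g2) (rpath C b (comp1 C g1 g2))"
| left_id: "\<lbrakk>b \<in> Obj B; c \<in> Obj C\<rbrakk> \<Longrightarrow> gray_rel1 B C (lpath B (id1 B b) c) ([], (b, c))"
| right_id: "\<lbrakk>b \<in> Obj B; c \<in> Obj C\<rbrakk> \<Longrightarrow> gray_rel1 B C (rpath C b (id1 C c)) ([], (b, c))"

text \<open>
  Compatibility with composition includes the nullary case: \<open>left_id2\<close> and \<open>right_id2\<close> say that
  $(\mathbf{Id}_f, \mathbf{Id})$ and $(\mathbf{Id}, \mathbf{Id}_g)$ are the identity 2-cells of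
  $(f, \mathbf{Id})$ and $(\mathbf{Id}, g)$.
\<close>

inductive gray_rel2 ::
  "('o1, 'a1, 't1) two_cat \<Rightarrow> ('o2, 'a2, 't2) two_cat
    \<Rightarrow> ('o1, 'a1, 't1, 'o2, 'a2, 't2) gray_tm \<Rightarrow> ('o1, 'a1, 't1, 'o2, 'a2, 't2) gray_tm \<Rightarrow> bool"
  for B C where
  left_vcomp: "\<lbrakk>\<phi>1 \<in> Cell B; \<phi>2 \<in> Cell B; dom2 B \<phi>1 = cod2 B \<phi>2; c \<in> Obj C\<rbrakk>
    \<Longrightarrow> gray_rel2 B C (VC (Gen (LCell \<phi>1 c)) (Gen (LCell \<phi>2 c))) (Gen (LCell (vcomp B \<phi>1 \<phi>2) c))"
| left_hcomp: "\<lbrakk>\<phi>1 \<in> Cell B; \<phi>2 \<in> Cell B; src0 B \<phi>1 = tgt0 B \<phi>2; c \<in> Obj C\<rbrakk>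
    \<Longrightarrow> gray_rel2 B C (HC (Gen (LCell \<phi>1 c)) (Gen (LCell \<phi>2 c))) (Gen (LCell (hcomp B \<phi>1 \<phi>2) c))"
| left_id2: "\<lbrakk>f \<in> Arr B; c \<in> Obj C\<rbrakk>
    \<Longrightarrow> gray_rel2 B C (Gen (LCell (id2 B f) c)) (Idt (lpath B f c))"
| right_vcomp: "\<lbrakk>\<psi>1 \<in> Cell C; \<psi>2 \<in> Cell C; dom2 C \<psi>1 = cod2 C \<psi>2; b \<in> Obj B\<rbrakk>
    \<Longrightarrow> gray_rel2 B C (VC (Gen (RCell b \<psi>1)) (Gen (RCell b \<psi>2))) (Gen (RCell b (vcomp C \<psi>1 \<psi>2)))"
| right_hcomp: "\<lbrakk>\<psi>1 \<in> Cell C; \<psi>2 \<in> Cell C; src0 C \<psi>1 = tgt0 C \<psi>2; b \<in> Obj B\<rbrakk>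
    \<Longrightarrow> gray_rel2 B C (HC (Gen (RCell b \<psi>1)) (Gen (RCell b \<psi>2))) (Gen (RCell b (hcomp C \<psi>1 \<psi>2)))"
| right_id2: "\<lbrakk>g \<in> Arr C; b \<in> Obj B\<rbrakk>
    \<Longrightarrow> gray_rel2 B C (Gen (RCell b (id2 C g))) (Idt (rpath C b g))"
| gam_id_right: "\<lbrakk>f \<in> Arr B; c \<in> Obj C\<rbrakk>
    \<Longrightarrow> gray_rel2 B C (Gen (Gam f (id1 C c))) (Idt (lpath B f c))"
| gam_id_left: "\<lbrakk>g \<in> Arr C; b \<in> Obj B\<rbrakk>
    \<Longrightarrow> gray_rel2 B C (Gen (Gam (id1 B b) g)) (Idt (rpath C b g))"
| gam_comp_left: "\<lbrakk>f1 \<in> Arr B; f2 \<in> Arr B; src B f1 = tgt B f2; g \<in> Arr C\<rbrakk>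
    \<Longrightarrow> gray_rel2 B C (Gen (Gam (comp1 B f1 f2) g))
          (VC (HC (Gen (Gam f1 g)) (Idt (lpath B f2 (src C g))))
              (HC (Idt (lpath B f1 (tgt C g))) (Gen (Gam f2 g))))"
| gam_comp_right: "\<lbrakk>f \<in> Arr B; g1 \<in> Arr C; g2 \<in> Arr C; src C g1 = tgt C g2\<rbrakk>
    \<Longrightarrow> gray_rel2 B C (Gen (Gam f (comp1 C g1 g2)))
          (VC (HC (Idt (rpath C (tgt B f) g1)) (Gen (Gam f g2)))
              (HC (Gen (Gam f g1)) (Idt (rpath C (src B f) g2))))"
| gam_natural: "\<lbrakk>\<phi> \<in> Cell B; \<psi> \<in> Cell C\<rbrakk>
    \<Longrightarrow> gray_rel2 B C
          (VC (Gen (Gam (cod2 B \<phi>) (cod2 C \<psi>)))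
              (HC (Gen (LCell \<phi> (tgt0 C \<psi>))) (Gen (RCell (src0 B \<phi>) \<psi>))))
          (VC (HC (Gen (RCell (tgt0 B \<phi>) \<psi>)) (Gen (LCell \<phi> (src0 C \<psi>))))
              (Gen (Gam (dom2 B \<phi>) (dom2 C \<psi>))))"

definition gray_presentation ::
  "('o1, 'a1, 't1) two_cat \<Rightarrow> ('o2, 'a2, 't2) two_cat
    \<Rightarrow> ('o1 \<times> 'o2, ('o1, 'a1, 'o2, 'a2) gray_edge, ('o1, 'a1, 't1, 'o2, 'a2, 't2) gray_gen)
        presentation"
where
  "gray_presentation B C =
    \<lparr>P0 = Obj B \<times> Obj C,
     P1 = {LArr f c |f c. f \<in> Arr B \<and> c \<in> Obj C} \<union> {RArr b g |b g. b \<in> Obj B \<and> g \<in> Arr C},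
     esrc = (\<lambda>e. case e of LArr f c \<Rightarrow> (src B f, c) | RArr b g \<Rightarrow> (b, src C g)),
     etgt = (\<lambda>e. case e of LArr f c \<Rightarrow> (tgt B f, c) | RArr b g \<Rightarrow> (b, tgt C g)),
     rel1 = gray_rel1 B C,
     P2 = {LCell \<phi> c |\<phi> c. \<phi> \<in> Cell B \<and> c \<in> Obj C}
        \<union> {RCell b \<psi> |b \<psi>. b \<in> Obj B \<and> \<psi> \<in> Cell C}
        \<union> {Gam f g |f g. f \<in> Arr B \<and> g \<in> Arr C},
     gdom = (\<lambda>x. case x of LCell \<phi> c \<Rightarrow> lpath B (dom2 B \<phi>) c
                         | RCell b \<psi> \<Rightarrow> rpath C b (dom2 C \<psi>)
                         | Gam f g \<Rightarrow> lpath B f (tgt C g) \<cdot>\<^sub>p rpath C (src B f) g),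
     gcod = (\<lambda>x. case x of LCell \<phi> c \<Rightarrow> lpath B (cod2 B \<phi>) c
                         | RCell b \<psi> \<Rightarrow> rpath C b (cod2 C \<psi>)
                         | Gam f g \<Rightarrow> rpath C (tgt B f) g \<cdot>\<^sub>p lpath B f (src C g)),
     rel2 = gray_rel2 B C\<rparr>"

definition gray where
  "gray B C = presented (gray_presentation B C)"


section \<open>The iterated lax Gray tensor product\<close>

text \<open>
  The factors are indexed from 0: the product of \<open>n \<ge> 1\<close> factors is that of
  \<open>C 0, \<dots>, C (n - 1)\<close>.  The type of the cells of \<open>gray B C\<close> grows with the types of the cells
  of \<open>B\<close> and \<open>C\<close>, so the products for different \<open>n\<close> would have different types.  To define them
  by recursion on \<open>n\<close>, we transport \<open>gray B C\<close> at each step to one fixed type: the object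
  \<open>((a\<^sub>1, \<dots>, a\<^sub>k), c)\<close> becomes the list \<open>[a\<^sub>1, \<dots>, a\<^sub>k, c]\<close>, and a 1-cell or 2-cell, that is,
  an equivalence class, becomes a chosen representative, whose generators involve cells of the
  previous product.  Distinct classes are disjoint, so this changes \<open>gray B C\<close> only up to
  isomorphism.
\<close>

datatype ('o, 'a) arrn =
    Arr_base 'a
  | Arr_step "('o list, ('o, 'a) arrn, 'o, 'a) gray_path"

datatype ('o, 'a, 't) celln =
    Cell_base 't
  | Cell_step "('o list, ('o, 'a) arrn, ('o, 'a, 't) celln, 'o, 'a, 't) gray_tm"

definition rep :: "'x set \<Rightarrow> 'x" where
  "rep A = (SOME x. x \<in> A)"

definition obj_in :: "'o list \<times> 'o \<Rightarrow> 'o list" where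
  "obj_in x = fst x @ [snd x]"

definition arr_in :: "('o list, ('o, 'a) arrn, 'o, 'a) gray_path set \<Rightarrow> ('o, 'a) arrn" where
  "arr_in A = Arr_step (rep A)"

definition cell_in ::
  "('o list, ('o, 'a) arrn, ('o, 'a, 't) celln, 'o, 'a, 't) gray_tm set \<Rightarrow> ('o, 'a, 't) celln"
where
  "cell_in S = Cell_step (rep S)"

fun iter_gray ::
  "(nat \<Rightarrow> ('o, 'a, 't) two_cat) \<Rightarrow> nat \<Rightarrow> ('o list, ('o, 'a) arrn, ('o, 'a, 't) celln) two_cat"
where
  "iter_gray C (Suc 0) = relabel (\<lambda>a. [a]) Arr_base Cell_base (C 0)"
| "iter_gray C (Suc (Suc k)) =
    relabel obj_in arr_in cell_in (gray (iter_gray C (Suc k)) (C (Suc k)))"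

text \<open>
  The cells $\{f\}_i$, $\{\phi\}_i$ and $\gamma^{i,j}_{f,g}$ of the iterated product, at the
  tuple \<open>a\<close> that is their source 0-cell.
\<close>

fun iter_arr ::
  "(nat \<Rightarrow> ('o, 'a, 't) two_cat) \<Rightarrow> nat \<Rightarrow> nat \<Rightarrow> 'a \<Rightarrow> 'o list \<Rightarrow> ('o, 'a) arrn"
where
  "iter_arr C (Suc 0) i f a = Arr_base f"
| "iter_arr C (Suc (Suc k)) i f a =
    (let B = iter_gray C (Suc k); D = C (Suc k); P = gray_presentation B D in
     arr_in (cls1 P
       (if i \<le> k then lpath B (iter_arr C (Suc k) i f (butlast a)) (last a)
        else rpath D (butlast a) f)))"

fun iter_cell ::
  "(nat \<Rightarrow> ('o, 'a, 't) two_cat) \<Rightarrow> nat \<Rightarrow> nat \<Rightarrow> 't \<Rightarrow> 'o list \<Rightarrow> ('o, 'a, 't) celln"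
where
  "iter_cell C (Suc 0) i \<phi> a = Cell_base \<phi>"
| "iter_cell C (Suc (Suc k)) i \<phi> a =
    (let B = iter_gray C (Suc k); D = C (Suc k); P = gray_presentation B D in
     cell_in (cls2 P (Gen
       (if i \<le> k then LCell (iter_cell C (Suc k) i \<phi> (butlast a)) (last a)
        else RCell (butlast a) \<phi>))))"

fun iter_gam ::
  "(nat \<Rightarrow> ('o, 'a, 't) two_cat) \<Rightarrow> nat \<Rightarrow> nat \<Rightarrow> nat \<Rightarrow> 'a \<Rightarrow> 'a \<Rightarrow> 'o list
    \<Rightarrow> ('o, 'a, 't) celln"
where
  "iter_gam C (Suc (Suc k)) i j f g a =
    (let B = iter_gray C (Suc k); D = C (Suc k); P = gray_presentation B D in
     cell_in (cls2 P (Gen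
       (if j \<le> k then LCell (iter_gam C (Suc k) i j f g (butlast a)) (last a)
        else Gam (iter_arr C (Suc k) i f (butlast a)) g))))"


section \<open>The presentation by the generators of all factors\<close>

text \<open>
  A generator must record the unchanged components of the 0-cells it runs between, so each one
  carries its source tuple \<open>a\<close>: \<open>MArr i f a\<close> is
  $\{f\}_i : (a_1, \dots, a_i, \dots, a_n) \to (a_1, \dots, a_i', \dots, a_n)$, where
  $f : a_i \to a_i'$, and similarly for \<open>MCell i \<phi> a\<close>, which is $\{\phi\}_i$, and
  \<open>MGam i j f g a\<close>, which is $\gamma^{i,j}_{f,g}$.
\<close>

datatype ('o, 'a) multi_edge = MArr nat 'a "'o list"

datatype ('o, 'a, 't) multi_gen =
    MCell nat 't "'o list"
  | MGam nat nat 'a 'a "'o list"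

type_synonym ('o, 'a) multi_path = "('o list, ('o, 'a) multi_edge) path"

type_synonym ('o, 'a, 't) multi_tm =
  "('o list, ('o, 'a) multi_edge, ('o, 'a, 't) multi_gen) tm"

definition tuples :: "(nat \<Rightarrow> ('o, 'a, 't) two_cat) \<Rightarrow> nat \<Rightarrow> 'o list set" where
  "tuples C n = {a. length a = n \<and> (\<forall>i<n. a ! i \<in> Obj (C i))}"

text \<open>\<open>arr_at C n i f a\<close>: \<open>f\<close> is a 1-cell of \<open>C i\<close> and $\{f\}_i$ starts at the tuple \<open>a\<close>.\<close>

definition arr_at ::
  "(nat \<Rightarrow> ('o, 'a, 't) two_cat) \<Rightarrow> nat \<Rightarrow> nat \<Rightarrow> 'a \<Rightarrow> 'o list \<Rightarrow> bool"
where
  "arr_at C n i f a \<longleftrightarrow> i < n \<and> a \<in> tuples C n \<and> f \<in> Arr (C i) \<and> a ! i = src (C i) f"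

definition cell_at ::
  "(nat \<Rightarrow> ('o, 'a, 't) two_cat) \<Rightarrow> nat \<Rightarrow> nat \<Rightarrow> 't \<Rightarrow> 'o list \<Rightarrow> bool"
where
  "cell_at C n i \<phi> a \<longleftrightarrow> i < n \<and> a \<in> tuples C n \<and> \<phi> \<in> Cell (C i) \<and> a ! i = src0 (C i) \<phi>"

definition mpath :: "nat \<Rightarrow> 'a \<Rightarrow> 'o list \<Rightarrow> ('o, 'a) multi_path" where
  "mpath i f a = ([MArr i f a], a)"

abbreviation mid :: "nat \<Rightarrow> 'a \<Rightarrow> 'o list \<Rightarrow> ('o, 'a, 't) multi_tm" where
  "mid i f a \<equiv> Idt (mpath i f a)"

abbreviation mcell :: "nat \<Rightarrow> 't \<Rightarrow> 'o list \<Rightarrow> ('o, 'a, 't) multi_tm" where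
  "mcell i \<phi> a \<equiv> Gen (MCell i \<phi> a)"

abbreviation mgam :: "nat \<Rightarrow> nat \<Rightarrow> 'a \<Rightarrow> 'a \<Rightarrow> 'o list \<Rightarrow> ('o, 'a, 't) multi_tm" where
  "mgam i j f g a \<equiv> Gen (MGam i j f g a)"

inductive multi_rel1 ::
  "(nat \<Rightarrow> ('o, 'a, 't) two_cat) \<Rightarrow> nat \<Rightarrow> ('o, 'a) multi_path \<Rightarrow> ('o, 'a) multi_path \<Rightarrow> bool"
  for C n where
  comp: "\<lbrakk>arr_at C n i g a; f \<in> Arr (C i); src (C i) f = tgt (C i) g\<rbrakk>
    \<Longrightarrow> multi_rel1 C n (mpath i f (a[i := tgt (C i) g]) \<cdot>\<^sub>p mpath i g a)
                       (mpath i (comp1 (C i) f g) a)"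
| id: "\<lbrakk>a \<in> tuples C n; i < n\<rbrakk> \<Longrightarrow> multi_rel1 C n (mpath i (id1 (C i) (a ! i)) a) ([], a)"

inductive multi_rel2 ::
  "(nat \<Rightarrow> ('o, 'a, 't) two_cat) \<Rightarrow> nat \<Rightarrow> ('o, 'a, 't) multi_tm \<Rightarrow> ('o, 'a, 't) multi_tm \<Rightarrow> bool"
  for C n where
  vcomp: "\<lbrakk>cell_at C n i \<psi> a; \<phi> \<in> Cell (C i); dom2 (C i) \<phi> = cod2 (C i) \<psi>\<rbrakk>
    \<Longrightarrow> multi_rel2 C n (VC (mcell i \<phi> a) (mcell i \<psi> a)) (mcell i (vcomp (C i) \<phi> \<psi>) a)"
| hcomp: "\<lbrakk>cell_at C n i \<psi> a; \<phi> \<in> Cell (C i); src0 (C i) \<phi> = tgt0 (C i) \<psi>\<rbrakk>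
    \<Longrightarrow> multi_rel2 C n (HC (mcell i \<phi> (a[i := tgt0 (C i) \<psi>])) (mcell i \<psi> a))
                       (mcell i (hcomp (C i) \<phi> \<psi>) a)"
| id2: "arr_at C n i f a \<Longrightarrow> multi_rel2 C n (mcell i (id2 (C i) f) a) (mid i f a)"
| gam_id_right: "\<lbrakk>i < j; j < n; arr_at C n i f a\<rbrakk>
    \<Longrightarrow> multi_rel2 C n (mgam i j f (id1 (C j) (a ! j)) a) (mid i f a)"
| gam_id_left: "\<lbrakk>i < j; arr_at C n j f a\<rbrakk>
    \<Longrightarrow> multi_rel2 C n (mgam i j (id1 (C i) (a ! i)) f a) (mid j f a)"
| gam_comp_left:
    "\<lbrakk>i < j; arr_at C n i f2 a; arr_at C n j g a; f1 \<in> Arr (C i); src (C i) f1 = tgt (C i) f2\<rbrakk>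
    \<Longrightarrow> multi_rel2 C n (mgam i j (comp1 (C i) f1 f2) g a)
          (VC (HC (mgam i j f1 g (a[i := tgt (C i) f2])) (mid i f2 a))
              (HC (mid i f1 (a[i := tgt (C i) f2, j := tgt (C j) g])) (mgam i j f2 g a)))"
| gam_comp_right:
    "\<lbrakk>i < j; arr_at C n i f a; arr_at C n j g2 a; g1 \<in> Arr (C j); src (C j) g1 = tgt (C j) g2\<rbrakk>
    \<Longrightarrow> multi_rel2 C n (mgam i j f (comp1 (C j) g1 g2) a)
          (VC (HC (mid j g1 (a[i := tgt (C i) f, j := tgt (C j) g2])) (mgam i j f g2 a))
              (HC (mgam i j f g1 (a[j := tgt (C j) g2])) (mid j g2 a)))"
| gam_natural: "\<lbrakk>i < j; cell_at C n i \<phi> a; cell_at C n j \<psi> a\<rbrakk>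
    \<Longrightarrow> multi_rel2 C n
          (VC (HC (mcell j \<psi> (a[i := tgt0 (C i) \<phi>])) (mcell i \<phi> a))
              (mgam i j (dom2 (C i) \<phi>) (dom2 (C j) \<psi>) a))
          (VC (mgam i j (cod2 (C i) \<phi>) (cod2 (C j) \<psi>) a)
              (HC (mcell i \<phi> (a[j := tgt0 (C j) \<psi>])) (mcell j \<psi> a)))"
| yang_baxter:
    "\<lbrakk>i < j; j < k; arr_at C n i f a; arr_at C n j g a; arr_at C n k h a\<rbrakk>
    \<Longrightarrow> multi_rel2 C n
          (VC (HC (mid k h (a[i := tgt (C i) f, j := tgt (C j) g])) (mgam i j f g a))
          (VC (HC (mgam i k f h (a[j := tgt (C j) g])) (mid j g a))
              (HC (mid i f (a[j := tgt (C j) g, k := tgt (C k) h])) (mgam j k g h a))))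
          (VC (HC (mgam j k g h (a[i := tgt (C i) f])) (mid i f a))
          (VC (HC (mid j g (a[i := tgt (C i) f, k := tgt (C k) h])) (mgam i k f h a))
              (HC (mgam i j f g (a[k := tgt (C k) h])) (mid k h a))))"

definition multi_presentation ::
  "(nat \<Rightarrow> ('o, 'a, 't) two_cat) \<Rightarrow> nat
    \<Rightarrow> ('o list, ('o, 'a) multi_edge, ('o, 'a, 't) multi_gen) presentation"
where
  "multi_presentation C n =
    \<lparr>P0 = tuples C n,
     P1 = {MArr i f a |i f a. arr_at C n i f a},
     esrc = (\<lambda>e. case e of MArr i f a \<Rightarrow> a),
     etgt = (\<lambda>e. case e of MArr i f a \<Rightarrow> a[i := tgt (C i) f]),
     rel1 = multi_rel1 C n,
     P2 = {MCell i \<phi> a |i \<phi> a. cell_at C n i \<phi> a}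
        \<union> {MGam i j f g a |i j f g a. i < j \<and> arr_at C n i f a \<and> arr_at C n j g a},
     gdom = (\<lambda>x. case x of
         MCell i \<phi> a \<Rightarrow> mpath i (dom2 (C i) \<phi>) a
       | MGam i j f g a \<Rightarrow> mpath i f (a[j := tgt (C j) g]) \<cdot>\<^sub>p mpath j g a),
     gcod = (\<lambda>x. case x of
         MCell i \<phi> a \<Rightarrow> mpath i (cod2 (C i) \<phi>) a
       | MGam i j f g a \<Rightarrow> mpath j g (a[i := tgt (C i) f]) \<cdot>\<^sub>p mpath i f a),
     rel2 = multi_rel2 C n\<rparr>"

definition multi_gray ::
  "(nat \<Rightarrow> ('o, 'a, 't) two_cat) \<Rightarrow> nat
    \<Rightarrow> ('o list, ('o, 'a) multi_path set, ('o, 'a, 't) multi_tm set) two_cat"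
where
  "multi_gray C n = presented (multi_presentation C n)"

definition multi_arr :: 
  "(nat \<Rightarrow> ('o, 'a, 't) two_cat) \<Rightarrow> nat \<Rightarrow> nat \<Rightarrow> 'a \<Rightarrow> 'o list \<Rightarrow> ('o, 'a) multi_path set"
where
  "multi_arr C n i f a = cls1 (multi_presentation C n) (mpath i f a)"

definition multi_cell ::
  "(nat \<Rightarrow> ('o, 'a, 't) two_cat) \<Rightarrow> nat \<Rightarrow> nat \<Rightarrow> 't \<Rightarrow> 'o list \<Rightarrow> ('o, 'a, 't) multi_tm set"
where
  "multi_cell C n i \<phi> a = cls2 (multi_presentation C n) (mcell i \<phi> a)"

definition multi_gam ::
  "(nat \<Rightarrow> ('o, 'a, 't) two_cat) \<Rightarrow> nat \<Rightarrow> nat \<Rightarrow> nat \<Rightarrow> 'a \<Rightarrow> 'a \<Rightarrow> 'o list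
    \<Rightarrow> ('o, 'a, 't) multi_tm set"
where
  "multi_gam C n i j f g a = cls2 (multi_presentation C n) (mgam i j f g a)"

end

theory Submission
  imports Defs
begin

text \<open>
  Call the presentation by the generators of all factors $P_n$ and the iterated product $I_n$.  By
  induction on \<open>n\<close>, the evident assignment of cells of $I_n$ to the generators of $P_n$ respects
  the relations, reaches every cell, and identifies only congruent formal cells (the locale
  \<open>presents\<close>); the induced 2-functor is then the required isomorphism.  For one factor this holds
  because every formal composite reduces to a single generator.  For the step, $I_n \otimes C_n$
  denotes the lax Gray product with the next factor.

  The relations of $P_{n+1}$ hold in $I_n \otimes C_n$ (\<open>model_forward\<close>).  Those that do not mention
  the last factor are inherited from $P_n$ along the 2-functors $(-, \mathbf{Id}_c)$.  The others
  are relations of the Gray product, except for the Yang-Baxter equation with $k = n$ (factors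
  are numbered from 0): this is naturality of $\gamma_{-,h}$ at the 2-cell $\gamma^{i,j}_{f,g}$ of $I_n$, once
  $\gamma_{f \cdot g, h}$ and $\gamma_{g \cdot f, h}$ are written in terms of their two factors.

  Conversely, let \<open>K\<close> be a model of $P_{n+1}$ in any 2-category.  To extend it to $I_n \otimes C_n$,
  one has to define $\gamma_{f,h}$ for every 1-cell \<open>f\<close> of $I_n$ and to show that it is natural in
  every 2-cell, while the relations speak about generators only.  For fixed \<open>h\<close>, the cells
  $\gamma^{i,n}_{f,h}$ are the components at generators of a lax transformation between the
  restrictions of \<open>K\<close> to the source and to the target of \<open>h\<close>; the component at a path is a pasting
  of these squares (\<open>lax_ev\<close>).  It suffices to check naturality at the generating 2-cells of $P_n$
  (\<open>lax_ev_natural\<close>), and for the generators $\gamma^{i,j}_{f,g}$ this is the Yang-Baxter equation.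
  The remaining relations of the Gray product say that lax transformations compose and that 2-cells
  of $C_n$ are modifications between them (\<open>lax_ev_compose\<close>, \<open>lax_ev_modification\<close>).

  If \<open>K\<close> is the tautological model of $P_{n+1}$, the extension is a left inverse of the 2-functor
  into $I_n \otimes C_n$ (\<open>back_forward\<close>), which is therefore injective on classes.  It is surjective
  since its image contains the generators of the Gray product and is closed under composition.
\<close>


section \<open>Calculating in a strict 2-category\<close>

notation comp1 (infixr "\<star>\<index>" 75)
  and vcomp (infixr "\<bullet>\<index>" 70)
  and hcomp (infixr "\<diamondop>\<index>" 75)
  and id2 ("\<iota>\<index>")

context strict_2category
begin

text \<open>
  Boundaries are always unfolded to \<open>src X (dom2 X \<alpha>)\<close> and \<open>tgt X (dom2 X \<alpha>)\<close>, so that the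
  simplifier can check by itself that a composite is well-typed.
\<close>

lemmas src0_eq [simp] = src0_def [of X]
lemmas tgt0_eq [simp] = tgt0_def [of X]

declare src_obj [simp] tgt_obj [simp] id1_arr [simp] src_id1 [simp] tgt_id1 [simp]
  comp1_arr [simp] src_comp1 [simp] tgt_comp1 [simp] dom2_arr [simp] cod2_arr [simp]
  src_parallel [simp] tgt_parallel [simp] id2_cell [simp] dom2_id2 [simp] cod2_id2 [simp]
  vcomp_cell [simp] dom2_vcomp [simp] cod2_vcomp [simp]
  comp1_assoc [simp]

lemma hcomp_type [simp]:
  assumes "\<alpha> \<in> Cell X" "\<beta> \<in> Cell X" "src X (dom2 X \<beta>) = tgt X (dom2 X \<alpha>)"
  shows "\<beta> \<diamondop>\<^bsub>X\<^esub> \<alpha> \<in> Cell X" "dom2 X (\<beta> \<diamondop>\<^bsub>X\<^esub> \<alpha>) = dom2 X \<beta> \<star>\<^bsub>X\<^esub> dom2 X \<alpha>"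
    "cod2 X (\<beta> \<diamondop>\<^bsub>X\<^esub> \<alpha>) = cod2 X \<beta> \<star>\<^bsub>X\<^esub> cod2 X \<alpha>"
  using assms by (simp_all add: hcomp_cell dom2_hcomp cod2_hcomp)

text \<open>
  The boundary is a separate variable \<open>a\<close> or \<open>f\<close> because it has usually been rewritten before the
  law applies, and then no longer has the form \<open>tgt X f\<close> or \<open>cod2 X \<alpha>\<close>.
\<close>

lemma unit_laws [simp]:
  "\<lbrakk>f \<in> Arr X; a = tgt X f\<rbrakk> \<Longrightarrow> id1 X a \<star>\<^bsub>X\<^esub> f = f"
  "\<lbrakk>f \<in> Arr X; a = src X f\<rbrakk> \<Longrightarrow> f \<star>\<^bsub>X\<^esub> id1 X a = f"
  "\<lbrakk>\<alpha> \<in> Cell X; f = cod2 X \<alpha>\<rbrakk> \<Longrightarrow> \<iota>\<^bsub>X\<^esub> f \<bullet>\<^bsub>X\<^esub> \<alpha> = \<alpha>"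
  "\<lbrakk>\<alpha> \<in> Cell X; f = dom2 X \<alpha>\<rbrakk> \<Longrightarrow> \<alpha> \<bullet>\<^bsub>X\<^esub> \<iota>\<^bsub>X\<^esub> f = \<alpha>"
  "\<lbrakk>\<alpha> \<in> Cell X; a = tgt X (dom2 X \<alpha>)\<rbrakk> \<Longrightarrow> \<iota>\<^bsub>X\<^esub> (id1 X a) \<diamondop>\<^bsub>X\<^esub> \<alpha> = \<alpha>"
  "\<lbrakk>\<alpha> \<in> Cell X; a = src X (dom2 X \<alpha>)\<rbrakk> \<Longrightarrow> \<alpha> \<diamondop>\<^bsub>X\<^esub> \<iota>\<^bsub>X\<^esub> (id1 X a) = \<alpha>"
  by (simp_all add: comp1_id_left comp1_id_right vcomp_id_left vcomp_id_right)
    (use hcomp_id_left hcomp_id_right in \<open>auto\<close>)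

lemma hcomp_id2_merge:
  "\<lbrakk>f \<in> Arr X; g \<in> Arr X; src X g = tgt X f\<rbrakk> \<Longrightarrow> \<iota>\<^bsub>X\<^esub> g \<diamondop>\<^bsub>X\<^esub> \<iota>\<^bsub>X\<^esub> f = \<iota>\<^bsub>X\<^esub> (g \<star>\<^bsub>X\<^esub> f)"
  by (rule hcomp_id2)

lemma hcomp_assoc':
  "\<lbrakk>\<alpha> \<in> Cell X; \<beta> \<in> Cell X; \<delta> \<in> Cell X; src X (dom2 X \<beta>) = tgt X (dom2 X \<alpha>);
    src X (dom2 X \<delta>) = tgt X (dom2 X \<beta>)\<rbrakk> \<Longrightarrow> (\<delta> \<diamondop>\<^bsub>X\<^esub> \<beta>) \<diamondop>\<^bsub>X\<^esub> \<alpha> = \<delta> \<diamondop>\<^bsub>X\<^esub> (\<beta> \<diamondop>\<^bsub>X\<^esub> \<alpha>)"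
  by (simp add: hcomp_assoc)

lemma id2_comp1_hcomp:
  assumes "f \<in> Arr X" "g \<in> Arr X" "src X g = tgt X f" "\<alpha> \<in> Cell X"
  shows "src X f = tgt X (dom2 X \<alpha>) \<Longrightarrow> \<iota>\<^bsub>X\<^esub> (g \<star>\<^bsub>X\<^esub> f) \<diamondop>\<^bsub>X\<^esub> \<alpha> = \<iota>\<^bsub>X\<^esub> g \<diamondop>\<^bsub>X\<^esub> (\<iota>\<^bsub>X\<^esub> f \<diamondop>\<^bsub>X\<^esub> \<alpha>)"
    "src X (dom2 X \<alpha>) = tgt X g \<Longrightarrow> \<alpha> \<diamondop>\<^bsub>X\<^esub> \<iota>\<^bsub>X\<^esub> (g \<star>\<^bsub>X\<^esub> f) = (\<alpha> \<diamondop>\<^bsub>X\<^esub> \<iota>\<^bsub>X\<^esub> g) \<diamondop>\<^bsub>X\<^esub> \<iota>\<^bsub>X\<^esub> f"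
  using assms by (simp_all add: hcomp_assoc' flip: hcomp_id2_merge)

lemma interchange':
  "\<lbrakk>\<alpha> \<in> Cell X; \<alpha>' \<in> Cell X; \<beta> \<in> Cell X; \<beta>' \<in> Cell X;
    dom2 X \<alpha>' = cod2 X \<alpha>; dom2 X \<beta>' = cod2 X \<beta>; src X (dom2 X \<beta>) = tgt X (dom2 X \<alpha>)\<rbrakk>
    \<Longrightarrow> (\<beta>' \<bullet>\<^bsub>X\<^esub> \<beta>) \<diamondop>\<^bsub>X\<^esub> (\<alpha>' \<bullet>\<^bsub>X\<^esub> \<alpha>) = (\<beta>' \<diamondop>\<^bsub>X\<^esub> \<alpha>') \<bullet>\<^bsub>X\<^esub> (\<beta> \<diamondop>\<^bsub>X\<^esub> \<alpha>)"
  by (rule interchange) simp_all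

lemma whisker_vcomp:
  assumes "\<alpha> \<in> Cell X" "\<alpha>' \<in> Cell X" "dom2 X \<alpha>' = cod2 X \<alpha>" "f \<in> Arr X"
  shows "src X f = tgt X (dom2 X \<alpha>) \<Longrightarrow> \<iota>\<^bsub>X\<^esub> f \<diamondop>\<^bsub>X\<^esub> (\<alpha>' \<bullet>\<^bsub>X\<^esub> \<alpha>) = (\<iota>\<^bsub>X\<^esub> f \<diamondop>\<^bsub>X\<^esub> \<alpha>') \<bullet>\<^bsub>X\<^esub> (\<iota>\<^bsub>X\<^esub> f \<diamondop>\<^bsub>X\<^esub> \<alpha>)"
    "src X (dom2 X \<alpha>) = tgt X f \<Longrightarrow> (\<alpha>' \<bullet>\<^bsub>X\<^esub> \<alpha>) \<diamondop>\<^bsub>X\<^esub> \<iota>\<^bsub>X\<^esub> f = (\<alpha>' \<diamondop>\<^bsub>X\<^esub> \<iota>\<^bsub>X\<^esub> f) \<bullet>\<^bsub>X\<^esub> (\<alpha> \<diamondop>\<^bsub>X\<^esub> \<iota>\<^bsub>X\<^esub> f)"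
  using interchange'[of \<alpha> \<alpha>' "\<iota>\<^bsub>X\<^esub> f" "\<iota>\<^bsub>X\<^esub> f"] interchange'[of "\<iota>\<^bsub>X\<^esub> f" "\<iota>\<^bsub>X\<^esub> f" \<alpha> \<alpha>'] assms
  by simp_all

text \<open>
  Both orders of whiskering give the horizontal composite; together the two equations let cells on
  neighbouring strands slide past each other.
\<close>

lemma hcomp_split:
  assumes "\<alpha> \<in> Cell X" "\<beta> \<in> Cell X" "src X (dom2 X \<beta>) = tgt X (dom2 X \<alpha>)"
    "f = dom2 X \<alpha>" "f' = cod2 X \<alpha>" "g = dom2 X \<beta>" "g' = cod2 X \<beta>"
  shows "(\<beta> \<diamondop>\<^bsub>X\<^esub> \<iota>\<^bsub>X\<^esub> f') \<bullet>\<^bsub>X\<^esub> (\<iota>\<^bsub>X\<^esub> g \<diamondop>\<^bsub>X\<^esub> \<alpha>) = \<beta> \<diamondop>\<^bsub>X\<^esub> \<alpha>"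
    "(\<iota>\<^bsub>X\<^esub> g' \<diamondop>\<^bsub>X\<^esub> \<alpha>) \<bullet>\<^bsub>X\<^esub> (\<beta> \<diamondop>\<^bsub>X\<^esub> \<iota>\<^bsub>X\<^esub> f) = \<beta> \<diamondop>\<^bsub>X\<^esub> \<alpha>"
  unfolding assms(4-7)
  using interchange'[of \<alpha> "\<iota>\<^bsub>X\<^esub> (cod2 X \<alpha>)" "\<iota>\<^bsub>X\<^esub> (dom2 X \<beta>)" \<beta>] assms(1-3)
    interchange'[of "\<iota>\<^bsub>X\<^esub> (dom2 X \<alpha>)" \<alpha> \<beta> "\<iota>\<^bsub>X\<^esub> (cod2 X \<beta>)"]
  by (metis dom2_arr cod2_arr id2_cell dom2_id2 cod2_id2 unit_laws(3,4))+

end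


section \<open>Presentations and their models\<close>

lemma pcat_simps [simp]:
  "(es, a) \<cdot>\<^sub>p q = (es @ fst q, snd q)" "fst (p \<cdot>\<^sub>p q) = fst p @ fst q" "snd (p \<cdot>\<^sub>p q) = snd q"
  "psrc (p \<cdot>\<^sub>p q) = psrc q" "psrc (es, a) = a"
  by (simp_all add: pcat_def psrc_def)

lemma pcat_assoc [simp]: "(p \<cdot>\<^sub>p q) \<cdot>\<^sub>p r = p \<cdot>\<^sub>p q \<cdot>\<^sub>p r"
  by (simp add: pcat_def)

lemma pcat_Nil_right [simp]: "psrc p = a \<Longrightarrow> p \<cdot>\<^sub>p ([], a) = p"
  by (auto simp: pcat_def psrc_def)

lemma ptgt_simps [simp]: "ptgt P ([], a) = a" "ptgt P (e # es, a) = etgt P e"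
  by (simp_all add: ptgt_def)

lemma ptgt_pcat [simp]: "psrc p = ptgt P q \<Longrightarrow> ptgt P (p \<cdot>\<^sub>p q) = ptgt P p"
  by (cases p; cases "fst p") (auto simp: pcat_def psrc_def ptgt_def)

lemma is_path_simps [simp]:
  "is_path P ([], a) \<longleftrightarrow> a \<in> P0 P"
  "is_path P (e # es, a) \<longleftrightarrow> e \<in> P1 P \<and> is_path P (es, a) \<and> esrc P e = ptgt P (es, a)"
  by (simp_all add: is_path_def)

lemma is_path_induct [consumes 1, case_names Nil Cons]:
  assumes "is_path P p"
    and "\<And>a. a \<in> P0 P \<Longrightarrow> Q ([], a)"
    and "\<And>e es a. \<lbrakk>e \<in> P1 P; is_path P (es, a); esrc P e = ptgt P (es, a); Q (es, a)\<rbrakk>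
      \<Longrightarrow> Q (e # es, a)"
  shows "Q p"
proof -
  have "is_path P (es, a) \<Longrightarrow> Q (es, a)" for es a
    by (induction es) (use assms(2,3) in auto)
  then show ?thesis
    using assms(1) by (cases p) auto
qed

lemma cong1_whisker:
  "\<lbrakk>cong1 P p p'; is_path P q; psrc p = ptgt P q\<rbrakk> \<Longrightarrow> cong1 P (p \<cdot>\<^sub>p q) (p' \<cdot>\<^sub>p q)"
  "\<lbrakk>cong1 P q q'; is_path P p; psrc p = ptgt P q\<rbrakk> \<Longrightarrow> cong1 P (p \<cdot>\<^sub>p q) (p \<cdot>\<^sub>p q')"
  by (simp_all add: cong1.comp cong1.refl)

text \<open>
  In a well-formed presentation the generators are well-typed and the relations hold between
  parallel cells; then the quotient by the generated congruences is a strict 2-category.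
\<close>

text \<open>
  Typing of the edges alone already suffices to compose paths.  It is a separate condition because
  paths have to be composed in order to verify the rest of well-formedness.
\<close>

locale wf_edges =
  fixes P :: "('o, 'e, 'g) presentation"
  assumes esrc_obj: "e \<in> P1 P \<Longrightarrow> esrc P e \<in> P0 P"
    and etgt_obj: "e \<in> P1 P \<Longrightarrow> etgt P e \<in> P0 P"
begin

lemma ptgt_obj [simp]: "is_path P p \<Longrightarrow> ptgt P p \<in> P0 P"
  by (induction p rule: is_path_induct) (auto simp: etgt_obj)

lemma psrc_obj [simp]: "is_path P p \<Longrightarrow> psrc p \<in> P0 P"
  by (induction p rule: is_path_induct) auto

lemma is_path_pcat [simp]:
  assumes "is_path P q" "psrc p = ptgt P q"
  shows "is_path P (p \<cdot>\<^sub>p q) \<longleftrightarrow> is_path P p"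
proof -
  have "is_path P (es @ fst q, snd q) \<longleftrightarrow> is_path P (es, ptgt P q)" for es
  proof (induction es)
    case Nil
    then show ?case using assms by auto
  next
    case (Cons e es)
    have "ptgt P ((es, ptgt P q) \<cdot>\<^sub>p q) = ptgt P (es, ptgt P q)"
      by (intro ptgt_pcat) simp
    then show ?case using Cons by auto
  qed
  then show ?thesis
    using assms by (cases p) auto
qed

end

locale wf_presentation = wf_edges +
  assumes rel1_path: "rel1 P p q \<Longrightarrow> is_path P p \<and> is_path P q \<and> psrc p = psrc q \<and> ptgt P p = ptgt P q"
    and gen_path: "x \<in> P2 P \<Longrightarrow> is_path P (gdom P x) \<and> is_path P (gcod P x)
      \<and> psrc (gdom P x) = psrc (gcod P x) \<and> ptgt P (gdom P x) = ptgt P (gcod P x)"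
    and rel2_tm: "rel2 P s t \<Longrightarrow> wf_tm P s \<and> wf_tm P t
      \<and> cong1 P (tdom P s) (tdom P t) \<and> cong1 P (tcod P s) (tcod P t)"
begin

lemma cong1_path:
  "cong1 P p q \<Longrightarrow> is_path P p \<and> is_path P q \<and> psrc p = psrc q \<and> ptgt P p = ptgt P q"
  by (induction rule: cong1.induct) (use rel1_path in \<open>auto simp: psrc_def\<close>)

lemma wf_tm_path:
  "wf_tm P t \<Longrightarrow> is_path P (tdom P t) \<and> is_path P (tcod P t)
    \<and> psrc (tdom P t) = psrc (tcod P t) \<and> ptgt P (tdom P t) = ptgt P (tcod P t)"
proof (induction t)
  case (VC s t)
  then show ?case using cong1_path[of "tdom P s" "tcod P t"] by simp
qed (use gen_path in auto)

lemma wf_tm_path_simps [simp]: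
  assumes "wf_tm P t"
  shows "is_path P (tdom P t)" "is_path P (tcod P t)"
    "psrc (tcod P t) = psrc (tdom P t)" "ptgt P (tcod P t) = ptgt P (tdom P t)"
  using wf_tm_path[OF assms] by auto

lemma cong2_tm:
  "cong2 P s t \<Longrightarrow> wf_tm P s \<and> wf_tm P t \<and> cong1 P (tdom P s) (tdom P t)
    \<and> cong1 P (tcod P s) (tcod P t)"
proof (induction rule: cong2.induct)
  case (VC s s' t t')
  then show ?case by (auto intro: cong1.intros)
next
  case (HC s s' t t')
  moreover have "psrc (tdom P s') = ptgt P (tdom P t')"
    using HC cong1_path[of "tdom P s" "tdom P s'"] cong1_path[of "tdom P t" "tdom P t'"] by simp
  ultimately show ?case by (auto intro!: cong1.comp)
next
  case (interchange s' s t' t)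
  then show ?case
    using cong1_path[of "tdom P s'" "tcod P s"] cong1_path[of "tdom P t'" "tcod P t"]
    by (auto intro!: cong1.comp cong1.refl)
qed (use rel2_tm cong1_path in \<open>auto intro: cong1.intros\<close>)

lemma cls1_eq_iff: "is_path P p \<Longrightarrow> cls1 P p = cls1 P q \<longleftrightarrow> cong1 P p q"
  unfolding cls1_def by (auto intro: cong1.intros)

lemma cls2_eq_iff: "wf_tm P s \<Longrightarrow> cls2 P s = cls2 P t \<longleftrightarrow> cong2 P s t"
  unfolding cls2_def by (auto intro: cong2.intros)

lemma cls1_eqI: "cong1 P p q \<Longrightarrow> cls1 P p = cls1 P q"
  using cls1_eq_iff cong1_path by blast

lemma cls2_eqI: "cong2 P s t \<Longrightarrow> cls2 P s = cls2 P t"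
  using cls2_eq_iff cong2_tm by blast

lemma in_cls1: "is_path P p \<Longrightarrow> p \<in> cls1 P p"
  by (simp add: cls1_def cong1.refl)

lemma in_cls2: "wf_tm P t \<Longrightarrow> t \<in> cls2 P t"
  by (simp add: cls2_def cong2.refl)

lemma rep_cls1: "is_path P p \<Longrightarrow> cong1 P p (rep (cls1 P p))"
  using someI[of "\<lambda>x. x \<in> cls1 P p", OF in_cls1] by (simp add: rep_def cls1_def)

lemma rep_cls2: "wf_tm P t \<Longrightarrow> cong2 P t (rep (cls2 P t))"
  using someI[of "\<lambda>x. x \<in> cls2 P t", OF in_cls2] by (simp add: rep_def cls2_def)

text \<open>The operations of the quotient are computed on representatives.\<close>

lemma Obj_presented [simp]: "Obj (presented P) = P0 P"
  by (simp add: presented_def)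

lemma presented_arrE:
  assumes "A \<in> Arr (presented P)"
  obtains p where "is_path P p" "A = cls1 P p"
  using assms that unfolding presented_def by auto

lemma presented_cellE:
  assumes "S \<in> Cell (presented P)"
  obtains t where "wf_tm P t" "S = cls2 P t"
  using assms that unfolding presented_def by auto

lemma presented_id1 [simp]: "id1 (presented P) a = cls1 P ([], a)"
  by (simp add: presented_def)

lemma presented_path [simp]:
  assumes "is_path P p"
  shows "cls1 P p \<in> Arr (presented P)" "src (presented P) (cls1 P p) = psrc p"
    "tgt (presented P) (cls1 P p) = ptgt P p" "id2 (presented P) (cls1 P p) = cls2 P (Idt p)"
proof -
  have "psrc ` cls1 P p = {psrc p}" "ptgt P ` cls1 P p = {ptgt P p}"
    using in_cls1[OF assms] cong1_path by (fastforce simp: cls1_def)+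
  then show "src (presented P) (cls1 P p) = psrc p" "tgt (presented P) (cls1 P p) = ptgt P p"
    by (simp_all add: presented_def)
  have "(\<Union>q\<in>cls1 P p. cls2 P (Idt q)) = cls2 P (Idt p)"
    using in_cls1[OF assms] cls2_eqI[OF cong2.Idt] unfolding cls1_def by blast
  then show "id2 (presented P) (cls1 P p) = cls2 P (Idt p)"
    by (simp add: presented_def)
  show "cls1 P p \<in> Arr (presented P)"
    using assms by (simp add: presented_def del: split_paired_Ex) blast
qed

lemma presented_tm [simp]:
  assumes "wf_tm P t"
  shows "cls2 P t \<in> Cell (presented P)" "dom2 (presented P) (cls2 P t) = cls1 P (tdom P t)"
    "cod2 (presented P) (cls2 P t) = cls1 P (tcod P t)"
proof -
  have "cls1 P (tdom P s) = cls1 P (tdom P t) \<and> cls1 P (tcod P s) = cls1 P (tcod P t)"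
    if "s \<in> cls2 P t" for s
    using that cong2_tm[of t s] cls1_eqI unfolding cls2_def by (metis mem_Collect_eq)
  then have "(\<Union>s\<in>cls2 P t. cls1 P (tdom P s)) = cls1 P (tdom P t)"
    "(\<Union>s\<in>cls2 P t. cls1 P (tcod P s)) = cls1 P (tcod P t)"
    using in_cls2[OF assms] by blast+
  then show "dom2 (presented P) (cls2 P t) = cls1 P (tdom P t)"
    "cod2 (presented P) (cls2 P t) = cls1 P (tcod P t)"
    by (simp_all add: presented_def)
qed (use assms in \<open>auto simp: presented_def\<close>)

lemma presented_comp1 [simp]:
  assumes "is_path P p" "is_path P q" "psrc p = ptgt P q"
  shows "comp1 (presented P) (cls1 P p) (cls1 P q) = cls1 P (p \<cdot>\<^sub>p q)"
proof -
  have "cls1 P (p' \<cdot>\<^sub>p q') = cls1 P (p \<cdot>\<^sub>p q)" if "p' \<in> cls1 P p" "q' \<in> cls1 P q" for p' q'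
    using that assms cls1_eqI[OF cong1.comp, of p p' q q'] by (simp add: cls1_def)
  then have "(\<Union>p'\<in>cls1 P p. \<Union>q'\<in>cls1 P q. cls1 P (p' \<cdot>\<^sub>p q')) = cls1 P (p \<cdot>\<^sub>p q)"
    using in_cls1[OF assms(1)] in_cls1[OF assms(2)] by blast
  then show ?thesis
    by (simp add: presented_def)
qed

lemma presented_vcomp [simp]:
  assumes "wf_tm P s" "wf_tm P t" "cong1 P (tdom P s) (tcod P t)"
  shows "vcomp (presented P) (cls2 P s) (cls2 P t) = cls2 P (VC s t)"
proof -
  have "cls2 P (VC s' t') = cls2 P (VC s t)" if "s' \<in> cls2 P s" "t' \<in> cls2 P t" for s' t'
    using that assms cls2_eqI[OF cong2.VC, of s s' t t'] by (simp add: cls2_def)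
  then have "(\<Union>s'\<in>cls2 P s. \<Union>t'\<in>cls2 P t. cls2 P (VC s' t')) = cls2 P (VC s t)"
    using in_cls2[OF assms(1)] in_cls2[OF assms(2)] by blast
  then show ?thesis
    by (simp add: presented_def)
qed

lemma presented_hcomp [simp]:
  assumes "wf_tm P s" "wf_tm P t" "psrc (tdom P s) = ptgt P (tdom P t)"
  shows "hcomp (presented P) (cls2 P s) (cls2 P t) = cls2 P (HC s t)"
proof -
  have "cls2 P (HC s' t') = cls2 P (HC s t)" if "s' \<in> cls2 P s" "t' \<in> cls2 P t" for s' t'
    using that assms cls2_eqI[OF cong2.HC, of s s' t t'] by (simp add: cls2_def)
  then have "(\<Union>s'\<in>cls2 P s. \<Union>t'\<in>cls2 P t. cls2 P (HC s' t')) = cls2 P (HC s t)"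
    using in_cls2[OF assms(1)] in_cls2[OF assms(2)] by blast
  then show ?thesis
    by (simp add: presented_def)
qed

lemma presented_interchange:
  assumes "wf_tm P (VC s' s)" "wf_tm P (VC t' t)" "wf_tm P (HC s t)"
  shows "cls2 P (HC (VC s' s) (VC t' t)) = vcomp (presented P)
    (hcomp (presented P) (cls2 P s') (cls2 P t')) (hcomp (presented P) (cls2 P s) (cls2 P t))"
proof -
  have "psrc (tdom P s') = ptgt P (tdom P t')"
    using assms cong1_path[of "tdom P s'" "tcod P s"] cong1_path[of "tdom P t'" "tcod P t"]
    by simp
  then show ?thesis
    using assms cls2_eqI[OF cong2.interchange[OF assms]] by (simp add: cong1.comp)
qed

lemma presented_2category: "strict_2category (presented P)"
  by (unfold_locales; (elim presented_arrE presented_cellE)?; hypsubst?;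
     (simp add: cls1_eq_iff src0_def tgt0_def cong1.refl presented_interchange)?;
     (intro cls2_eqI cong2.VC_assoc cong2.VC_id_left cong2.VC_id_right cong2.HC_assoc
       cong2.HC_id_left cong2.HC_id_right cong2.HC_Idt; simp)?)

end

text \<open>
  An assignment of cells of \<open>Y\<close> to the generators of a presentation extends to paths and formal
  2-cells.  It is a model if it respects types and relations.
\<close>

fun ev1 :: "('p, 'b, 'u) two_cat \<Rightarrow> ('o \<Rightarrow> 'p) \<Rightarrow> ('e \<Rightarrow> 'b) \<Rightarrow> ('o, 'e) path \<Rightarrow> 'b" where
  "ev1 Y F0 E ([], a) = id1 Y (F0 a)"
| "ev1 Y F0 E (e # es, a) = comp1 Y (E e) (ev1 Y F0 E (es, a))"

fun ev2 ::
  "('p, 'b, 'u) two_cat \<Rightarrow> ('o \<Rightarrow> 'p) \<Rightarrow> ('e \<Rightarrow> 'b) \<Rightarrow> ('g \<Rightarrow> 'u) \<Rightarrow> ('o, 'e, 'g) tm \<Rightarrow> 'u"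
where
  "ev2 Y F0 E G (Gen x) = G x"
| "ev2 Y F0 E G (Idt p) = id2 Y (ev1 Y F0 E p)"
| "ev2 Y F0 E G (VC s t) = vcomp Y (ev2 Y F0 E G s) (ev2 Y F0 E G t)"
| "ev2 Y F0 E G (HC s t) = hcomp Y (ev2 Y F0 E G s) (ev2 Y F0 E G t)"

locale model =
  Y: strict_2category Y + wf_presentation P
  for Y :: "('p, 'b, 'u) two_cat" and P :: "('o, 'e, 'g) presentation" +
  fixes F0 :: "'o \<Rightarrow> 'p" and E :: "'e \<Rightarrow> 'b" and G :: "'g \<Rightarrow> 'u"
  assumes obj [simp]: "a \<in> P0 P \<Longrightarrow> F0 a \<in> Obj Y"
    and edge: "e \<in> P1 P \<Longrightarrow> E e \<in> Arr Y \<and> src Y (E e) = F0 (esrc P e) \<and> tgt Y (E e) = F0 (etgt P e)"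
    and gen: "x \<in> P2 P \<Longrightarrow> G x \<in> Cell Y
      \<and> dom2 Y (G x) = ev1 Y F0 E (gdom P x) \<and> cod2 Y (G x) = ev1 Y F0 E (gcod P x)"
    and rel1: "rel1 P p q \<Longrightarrow> ev1 Y F0 E p = ev1 Y F0 E q"
    and rel2: "rel2 P s t \<Longrightarrow> ev2 Y F0 E G s = ev2 Y F0 E G t"
begin

lemma edge_simps [simp]:
  assumes "e \<in> P1 P"
  shows "E e \<in> Arr Y" "src Y (E e) = F0 (esrc P e)" "tgt Y (E e) = F0 (etgt P e)"
  using edge[OF assms] by auto

lemma ev1_type:
  "is_path P p \<Longrightarrow> ev1 Y F0 E p \<in> Arr Y \<and> src Y (ev1 Y F0 E p) = F0 (psrc p)
    \<and> tgt Y (ev1 Y F0 E p) = F0 (ptgt P p)"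
  by (induction p rule: is_path_induct) auto

lemma ev1_simps [simp]:
  assumes "is_path P p"
  shows "ev1 Y F0 E p \<in> Arr Y" "src Y (ev1 Y F0 E p) = F0 (psrc p)"
    "tgt Y (ev1 Y F0 E p) = F0 (ptgt P p)"
  using ev1_type[OF assms] by auto

lemma ev1_single [simp]: "e \<in> P1 P \<Longrightarrow> a = esrc P e \<Longrightarrow> ev1 Y F0 E ([e], a) = E e"
  by (simp add: esrc_obj)

lemma ev1_pcat [simp]:
  assumes "is_path P p" "is_path P q" "psrc p = ptgt P q"
  shows "ev1 Y F0 E (p \<cdot>\<^sub>p q) = comp1 Y (ev1 Y F0 E p) (ev1 Y F0 E q)"
  using assms(1,3)
proof (induction p rule: is_path_induct)
  case (Nil a)
  then show ?case using assms(2) by (simp add: pcat_def)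
next
  case (Cons e es a)
  have "(e # es, a) \<cdot>\<^sub>p q = (e # fst ((es, a) \<cdot>\<^sub>p q), snd ((es, a) \<cdot>\<^sub>p q))"
    by simp
  then show ?case
    using Cons assms(2) by (simp only: ev1.simps prod.collapse) simp
qed

lemma ev1_cong: "cong1 P p q \<Longrightarrow> ev1 Y F0 E p = ev1 Y F0 E q"
  by (induction rule: cong1.induct) (auto simp: rel1 cong1_path)

lemma ev2_type:
  "wf_tm P t \<Longrightarrow> ev2 Y F0 E G t \<in> Cell Y \<and> dom2 Y (ev2 Y F0 E G t) = ev1 Y F0 E (tdom P t)
    \<and> cod2 Y (ev2 Y F0 E G t) = ev1 Y F0 E (tcod P t)"
  by (induction t) (auto simp: gen ev1_cong)

lemma ev2_simps [simp]:
  assumes "wf_tm P t"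
  shows "ev2 Y F0 E G t \<in> Cell Y" "dom2 Y (ev2 Y F0 E G t) = ev1 Y F0 E (tdom P t)"
    "cod2 Y (ev2 Y F0 E G t) = ev1 Y F0 E (tcod P t)"
  using ev2_type[OF assms] by auto

lemma ev2_cong: "cong2 P s t \<Longrightarrow> ev2 Y F0 E G s = ev2 Y F0 E G t"
proof (induction rule: cong2.induct)
  case (interchange s' s t' t)
  then show ?case by (auto intro!: Y.interchange' simp: ev1_cong)
qed (auto simp: rel2 ev1_cong Y.vcomp_assoc Y.hcomp_assoc' Y.hcomp_id2_merge)

lemma ev_rep [simp]:
  "is_path P p \<Longrightarrow> ev1 Y F0 E (rep (cls1 P p)) = ev1 Y F0 E p"
  "wf_tm P t \<Longrightarrow> ev2 Y F0 E G (rep (cls2 P t)) = ev2 Y F0 E G t"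
  using ev1_cong[OF rep_cls1] ev2_cong[OF rep_cls2] by simp_all

lemma induced_functor:
  "strict_2functor (presented P) Y F0 (\<lambda>A. ev1 Y F0 E (rep A)) (\<lambda>S. ev2 Y F0 E G (rep S))"
proof -
  interpret Q: strict_2category "presented P"
    by (rule presented_2category)
  show ?thesis
    by (unfold_locales; (elim presented_arrE presented_cellE)?; hypsubst?;
      simp add: cls1_eq_iff)
qed

end

text \<open>
  Evaluation in the tautological model is passage to classes, so equal values are congruent there.
  A functor that maps some other model of \<open>P\<close> to this one therefore shows that the other model
  identifies no more than the congruences do.
\<close>

lemma (in wf_presentation) tautological_model:
  shows "model (presented P) P (\<lambda>a. a) (\<lambda>e. cls1 P ([e], esrc P e)) (\<lambda>x. cls2 P (Gen x))" (is ?model)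
    and ev1_tautological:
      "is_path P p \<Longrightarrow> ev1 (presented P) (\<lambda>a. a) (\<lambda>e. cls1 P ([e], esrc P e)) p = cls1 P p"
    and ev2_tautological:
      "wf_tm P t \<Longrightarrow> ev2 (presented P) (\<lambda>a. a) (\<lambda>e. cls1 P ([e], esrc P e)) (\<lambda>x. cls2 P (Gen x)) t
        = cls2 P t"
proof -
  interpret Q: strict_2category "presented P"
    by (rule presented_2category)
  have 1: "ev1 (presented P) (\<lambda>a. a) (\<lambda>e. cls1 P ([e], esrc P e)) p = cls1 P p"
    if "is_path P p" for p
    using that by (induction rule: is_path_induct) (simp_all add: esrc_obj)
  have 2: "ev2 (presented P) (\<lambda>a. a) (\<lambda>e. cls1 P ([e], esrc P e)) (\<lambda>x. cls2 P (Gen x)) t = cls2 P t"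
    if "wf_tm P t" for t
    using that by (induction t) (simp_all add: 1)
  show ?model
  proof
    show "rel1 P p q \<Longrightarrow> ev1 (presented P) (\<lambda>a. a) (\<lambda>e. cls1 P ([e], esrc P e)) p =
        ev1 (presented P) (\<lambda>a. a) (\<lambda>e. cls1 P ([e], esrc P e)) q" for p q
      using rel1_path[of p q] cls1_eqI[OF cong1.rel, of p q] by (simp add: 1)
    show "rel2 P s t \<Longrightarrow> ev2 (presented P) (\<lambda>a. a) (\<lambda>e. cls1 P ([e], esrc P e)) (\<lambda>x. cls2 P (Gen x)) s =
        ev2 (presented P) (\<lambda>a. a) (\<lambda>e. cls1 P ([e], esrc P e)) (\<lambda>x. cls2 P (Gen x)) t" for s t
      using rel2_tm[of s t] cls2_eqI[OF cong2.rel, of s t] by (simp add: 2)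
  qed (simp_all add: gen_path 1 esrc_obj)
  show "is_path P p \<Longrightarrow> ev1 (presented P) (\<lambda>a. a) (\<lambda>e. cls1 P ([e], esrc P e)) p = cls1 P p"
    "wf_tm P t \<Longrightarrow> ev2 (presented P) (\<lambda>a. a) (\<lambda>e. cls1 P ([e], esrc P e)) (\<lambda>x. cls2 P (Gen x)) t
      = cls2 P t"
    by (fact 1 2)+
qed

text \<open>
  The composite of a model with a 2-functor \<open>T\<close>.  Agreement is demanded on generators only, because
  the assignments in the applications differ on arguments that are not generators.
\<close>

locale model_image =
  model Y P F0 E G + T: strict_2functor Y Z T0 T1 T2
  for Y :: "('p, 'b, 'u) two_cat" and P :: "('o, 'e, 'g) presentation" and F0 E G
    and Z :: "('q, 'c, 'v) two_cat" and T0 T1 T2 +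
  fixes F0' E' G'
  assumes obj': "a \<in> P0 P \<Longrightarrow> F0' a = T0 (F0 a)"
    and edge': "e \<in> P1 P \<Longrightarrow> E' e = T1 (E e)"
    and gen': "x \<in> P2 P \<Longrightarrow> G' x = T2 (G x)"
begin

lemma ev1_image: "is_path P p \<Longrightarrow> ev1 Z F0' E' p = T1 (ev1 Y F0 E p)"
  by (induction p rule: is_path_induct) (simp_all add: obj' edge' T.F1_id T.F1_comp)

lemma ev2_image: "wf_tm P t \<Longrightarrow> ev2 Z F0' E' G' t = T2 (ev2 Y F0 E G t)"
  by (induction t)
    (simp_all add: gen' ev1_image ev1_cong T.F2_id T.F2_vcomp T.F2_hcomp)

lemma model_image: "model Z P F0' E' G'"
proof
  show "rel1 P p q \<Longrightarrow> ev1 Z F0' E' p = ev1 Z F0' E' q" for p q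
    using rel1_path rel1 by (simp add: ev1_image)
  show "rel2 P s t \<Longrightarrow> ev2 Z F0' E' G' s = ev2 Z F0' E' G' t" for s t
    using rel2_tm[of s t] rel2 by (simp add: ev2_image)
qed (simp_all add: obj' edge' gen' gen gen_path ev1_image T.F0_obj T.F1_arr T.F2_cell T.F1_src
    T.F1_tgt T.F2_dom T.F2_cod esrc_obj etgt_obj)

end

text \<open>
  \<open>P\<close> presents \<open>Y\<close> if the functor induced by a model is an isomorphism: completeness is its
  injectivity on classes.
\<close>

locale presents = model +
  assumes F0_bij: "bij_betw F0 (P0 P) (Obj Y)"
    and complete1: "\<lbrakk>is_path P p; is_path P q; ev1 Y F0 E p = ev1 Y F0 E q\<rbrakk> \<Longrightarrow> cong1 P p q"
    and complete2: "\<lbrakk>wf_tm P s; wf_tm P t; ev2 Y F0 E G s = ev2 Y F0 E G t\<rbrakk> \<Longrightarrow> cong2 P s t"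
    and surj1: "f \<in> Arr Y \<Longrightarrow> \<exists>p. is_path P p \<and> ev1 Y F0 E p = f"
    and surj2: "\<alpha> \<in> Cell Y \<Longrightarrow> \<exists>t. wf_tm P t \<and> ev2 Y F0 E G t = \<alpha>"
begin

lemma induced_isomorphism:
  "strict_2isomorphism (presented P) Y F0 (\<lambda>A. ev1 Y F0 E (rep A)) (\<lambda>S. ev2 Y F0 E G (rep S))"
proof -
  interpret I: strict_2functor "presented P" Y F0 "\<lambda>A. ev1 Y F0 E (rep A)" "\<lambda>S. ev2 Y F0 E G (rep S)"
    by (rule induced_functor)
  show ?thesis
  proof
    show "bij_betw F0 (Obj (presented P)) (Obj Y)"
      using F0_bij by simp
    show "bij_betw (\<lambda>A. ev1 Y F0 E (rep A)) (Arr (presented P)) (Arr Y)"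
    proof (rule bij_betw_imageI)
      show "inj_on (\<lambda>A. ev1 Y F0 E (rep A)) (Arr (presented P))"
        by (rule inj_onI) (auto elim!: presented_arrE intro!: cls1_eqI complete1)
      show "(\<lambda>A. ev1 Y F0 E (rep A)) ` Arr (presented P) = Arr Y"
      proof
        show "Arr Y \<subseteq> (\<lambda>A. ev1 Y F0 E (rep A)) ` Arr (presented P)"
        proof
          fix f
          assume "f \<in> Arr Y"
          then obtain p where "is_path P p" "f = ev1 Y F0 E p"
            using surj1 by metis
          then show "f \<in> (\<lambda>A. ev1 Y F0 E (rep A)) ` Arr (presented P)"
            by (intro image_eqI[of _ _ "cls1 P p"]) simp_all
        qed
      qed (auto intro: I.F1_arr)
    qed
    show "bij_betw (\<lambda>S. ev2 Y F0 E G (rep S)) (Cell (presented P)) (Cell Y)"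
    proof (rule bij_betw_imageI)
      show "inj_on (\<lambda>S. ev2 Y F0 E G (rep S)) (Cell (presented P))"
        by (rule inj_onI) (auto elim!: presented_cellE intro!: cls2_eqI complete2)
      show "(\<lambda>S. ev2 Y F0 E G (rep S)) ` Cell (presented P) = Cell Y"
      proof
        show "Cell Y \<subseteq> (\<lambda>S. ev2 Y F0 E G (rep S)) ` Cell (presented P)"
        proof
          fix \<alpha>
          assume "\<alpha> \<in> Cell Y"
          then obtain t where "wf_tm P t" "\<alpha> = ev2 Y F0 E G t"
            using surj2 by metis
          then show "\<alpha> \<in> (\<lambda>S. ev2 Y F0 E G (rep S)) ` Cell (presented P)"
            by (intro image_eqI[of _ _ "cls2 P t"]) simp_all
        qed
      qed (auto intro: I.F2_cell)
    qed
  qed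
qed

end

lemma presents_image:
  assumes "presents Y P F0 E G" and "strict_2isomorphism Y Z T0 T1 T2"
    and "\<And>a. a \<in> P0 P \<Longrightarrow> F0' a = T0 (F0 a)" "\<And>e. e \<in> P1 P \<Longrightarrow> E' e = T1 (E e)"
    and "\<And>x. x \<in> P2 P \<Longrightarrow> G' x = T2 (G x)"
  shows "presents Z P F0' E' G'"
proof -
  interpret presents Y P F0 E G by fact
  interpret T: strict_2isomorphism Y Z T0 T1 T2 by fact
  interpret model_image Y P F0 E G Z T0 T1 T2 F0' E' G'
    by unfold_locales (fact assms(3-5))+
  interpret model Z P F0' E' G' by (rule model_image)
  show ?thesis
  proof
    have "bij_betw (T0 \<circ> F0) (P0 P) (Obj Z)"
      using F0_bij T.F0_bij by (rule bij_betw_trans)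
    then show "bij_betw F0' (P0 P) (Obj Z)"
      by (rule bij_betw_cong[THEN iffD1, rotated]) (simp add: assms(3))
    show "cong1 P p q" if "is_path P p" "is_path P q" "ev1 Z F0' E' p = ev1 Z F0' E' q" for p q
      using that T.F1_bij by (auto intro!: complete1 simp: ev1_image dest!: bij_betw_imp_inj_on inj_onD)
    show "cong2 P s t" if "wf_tm P s" "wf_tm P t" "ev2 Z F0' E' G' s = ev2 Z F0' E' G' t" for s t
      using that T.F2_bij by (auto intro!: complete2 simp: ev2_image dest!: bij_betw_imp_inj_on inj_onD)
    show "\<exists>p. is_path P p \<and> ev1 Z F0' E' p = f" if "f \<in> Arr Z" for f
      using that T.F1_bij surj1 ev1_image unfolding bij_betw_def by (metis imageE)
    show "\<exists>t. wf_tm P t \<and> ev2 Z F0' E' G' t = \<alpha>" if "\<alpha> \<in> Cell Z" for \<alpha>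
      using that T.F2_bij surj2 ev2_image unfolding bij_betw_def by (metis imageE)
  qed
qed

lemma relabel_isomorphism:
  assumes "strict_2category X" "inj_on h0 (Obj X)" "inj_on h1 (Arr X)" "inj_on h2 (Cell X)"
  shows "strict_2isomorphism X (relabel h0 h1 h2 X) h0 h1 h2"
proof -
  interpret strict_2category X by fact
  have [simp]: "a \<in> Obj X \<Longrightarrow> inv_into (Obj X) h0 (h0 a) = a"
    "f \<in> Arr X \<Longrightarrow> inv_into (Arr X) h1 (h1 f) = f"
    "\<alpha> \<in> Cell X \<Longrightarrow> inv_into (Cell X) h2 (h2 \<alpha>) = \<alpha>" for a f \<alpha>
    using assms by simp_all
  have [simp]: "f \<in> Arr X \<Longrightarrow> g \<in> Arr X \<Longrightarrow> h1 f = h1 g \<longleftrightarrow> f = g"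
    "a \<in> Obj X \<Longrightarrow> b \<in> Obj X \<Longrightarrow> h0 a = h0 b \<longleftrightarrow> a = b" for f g a b
    using assms by (auto dest: inj_onD)
  have R: "Obj (relabel h0 h1 h2 X) = h0 ` Obj X" "Arr (relabel h0 h1 h2 X) = h1 ` Arr X"
    "Cell (relabel h0 h1 h2 X) = h2 ` Cell X"
    by (simp_all add: relabel_def Let_def)
  have R' [simp]:
    "f \<in> Arr X \<Longrightarrow> src (relabel h0 h1 h2 X) (h1 f) = h0 (src X f)"
    "f \<in> Arr X \<Longrightarrow> tgt (relabel h0 h1 h2 X) (h1 f) = h0 (tgt X f)"
    "a \<in> Obj X \<Longrightarrow> id1 (relabel h0 h1 h2 X) (h0 a) = h1 (id1 X a)"
    "\<lbrakk>f \<in> Arr X; g \<in> Arr X\<rbrakk> \<Longrightarrow> comp1 (relabel h0 h1 h2 X) (h1 g) (h1 f) = h1 (comp1 X g f)"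
    "\<alpha> \<in> Cell X \<Longrightarrow> dom2 (relabel h0 h1 h2 X) (h2 \<alpha>) = h1 (dom2 X \<alpha>)"
    "\<alpha> \<in> Cell X \<Longrightarrow> cod2 (relabel h0 h1 h2 X) (h2 \<alpha>) = h1 (cod2 X \<alpha>)"
    "f \<in> Arr X \<Longrightarrow> id2 (relabel h0 h1 h2 X) (h1 f) = h2 (id2 X f)"
    "\<lbrakk>\<alpha> \<in> Cell X; \<beta> \<in> Cell X\<rbrakk> \<Longrightarrow> vcomp (relabel h0 h1 h2 X) (h2 \<beta>) (h2 \<alpha>) = h2 (vcomp X \<beta> \<alpha>)"
    "\<lbrakk>\<alpha> \<in> Cell X; \<beta> \<in> Cell X\<rbrakk> \<Longrightarrow> hcomp (relabel h0 h1 h2 X) (h2 \<beta>) (h2 \<alpha>) = h2 (hcomp X \<beta> \<alpha>)"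
    for f g a \<alpha> \<beta>
    by (simp_all add: relabel_def Let_def)
  have "strict_2category (relabel h0 h1 h2 X)"
    by (unfold_locales; (unfold R)?; (elim imageE)?; hypsubst?;
      simp add: src0_def tgt0_def vcomp_assoc hcomp_assoc hcomp_id2_merge interchange)
  then interpret S: strict_2category "relabel h0 h1 h2 X" .
  show ?thesis
    by (unfold_locales; simp add: R inj_on_imp_bij_betw assms(2-4))
qed

text \<open>Distinct classes are disjoint, hence determined by their chosen elements.\<close>

lemma (in wf_presentation) rep_inj:
  "inj_on rep (Arr (presented P))" "inj_on rep (Cell (presented P))"
proof -
  show "inj_on rep (Arr (presented P))"
    by (rule inj_onI) (metis presented_arrE rep_cls1 cls1_eqI)
  show "inj_on rep (Cell (presented P))"
    by (rule inj_onI) (metis presented_cellE rep_cls2 cls2_eqI)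
qed


section \<open>Lax transformations between models\<close>

text \<open>
  Let \<open>F\<close> and \<open>F'\<close> be models of \<open>P\<close> in \<open>Y\<close>.  A lax transformation between them consists of 1-cells
  \<open>r a\<close> from \<open>F a\<close> to \<open>F' a\<close> and of squares $\gamma_e : F'e \cdot r \to r \cdot Fe$, one for each
  edge.  Squares of consecutive edges are pasted as in the rule
  $\gamma_{f_1 \cdot f_2, g} = (\gamma_{f_1, g} \cdot f_2) \circ (f_1 \cdot \gamma_{f_2, g})$ of
  the Gray tensor product, where \<open>r\<close> is $(\mathbf{Id}, g)$ and the models are the inclusions of the
  first factor at the target and the source of \<open>g\<close>.
\<close>

fun lax_ev ::
  "('p, 'b, 'u) two_cat \<Rightarrow> ('o \<Rightarrow> 'p) \<Rightarrow> ('e \<Rightarrow> 'b) \<Rightarrow> ('e \<Rightarrow> 'b) \<Rightarrow> ('o \<Rightarrow> 'b) \<Rightarrow> ('e \<Rightarrow> 'u)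
    \<Rightarrow> ('o, 'e) path \<Rightarrow> 'u"
where
  "lax_ev Y F0 E E' r \<gamma> ([], a) = id2 Y (r a)"
| "lax_ev Y F0 E E' r \<gamma> (e # es, a) =
    vcomp Y (hcomp Y (\<gamma> e) (id2 Y (ev1 Y F0 E (es, a))))
            (hcomp Y (id2 Y (E' e)) (lax_ev Y F0 E E' r \<gamma> (es, a)))"

text \<open>
  Pasting needs only the types of \<open>r\<close> and \<open>\<gamma>\<close>; compatibility with the relations and with the
  generating 2-cells is added in \<open>lax_transformation\<close>.
\<close>

locale lax_data =
  Y: strict_2category Y + F: model Y P F0 E G + F': model Y P F0' E' G'
  for Y :: "('p, 'b, 'u) two_cat" (structure) and P :: "('o, 'e, 'g) presentation" and F0 E G F0' E' G' +
  fixes r :: "'o \<Rightarrow> 'b" and \<gamma> :: "'e \<Rightarrow> 'u"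
  assumes comp_obj: "a \<in> P0 P \<Longrightarrow> r a \<in> Arr Y \<and> src Y (r a) = F0 a \<and> tgt Y (r a) = F0' a"
    and comp_edge: "e \<in> P1 P \<Longrightarrow> \<gamma> e \<in> Cell Y \<and> dom2 Y (\<gamma> e) = comp1 Y (E' e) (r (esrc P e))
      \<and> cod2 Y (\<gamma> e) = comp1 Y (r (etgt P e)) (E e)"
begin

abbreviation \<Gamma> where "\<Gamma> \<equiv> lax_ev Y F0 E E' r \<gamma>"
abbreviation f where "f \<equiv> ev1 Y F0 E"
abbreviation f' where "f' \<equiv> ev1 Y F0' E'"

lemma comp_obj_simps [simp]:
  assumes "a \<in> P0 P"
  shows "r a \<in> Arr Y" "src Y (r a) = F0 a" "tgt Y (r a) = F0' a"
  using comp_obj[OF assms] by auto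

lemma comp_edge_simps [simp]:
  assumes "e \<in> P1 P"
  shows "\<gamma> e \<in> Cell Y" "dom2 Y (\<gamma> e) = E' e \<star> r (esrc P e)" "cod2 Y (\<gamma> e) = r (etgt P e) \<star> E e"
  using comp_edge[OF assms] by auto

declare F.esrc_obj [simp] F.etgt_obj [simp]

lemma lax_ev_type:
  "is_path P p \<Longrightarrow> \<Gamma> p \<in> Cell Y \<and> dom2 Y (\<Gamma> p) = f' p \<star> r (psrc p)
    \<and> cod2 Y (\<Gamma> p) = r (ptgt P p) \<star> f p"
proof (induction p rule: is_path_induct)
  case (Cons e es a)
  then have "a \<in> P0 P" using F.psrc_obj[of "(es, a)"] by simp
  with Cons show ?case by simp
qed simp

lemma lax_ev_simps [simp]:
  assumes "is_path P p"
  shows "\<Gamma> p \<in> Cell Y" "dom2 Y (\<Gamma> p) = f' p \<star> r (psrc p)"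
    "cod2 Y (\<Gamma> p) = r (ptgt P p) \<star> f p"
  using lax_ev_type[OF assms] by auto

lemma lax_ev_single [simp]: "e \<in> P1 P \<Longrightarrow> a = esrc P e \<Longrightarrow> \<Gamma> ([e], a) = \<gamma> e"
  by (simp add: Y.hcomp_id2_merge)

lemma lax_ev_pcat:
  assumes "is_path P p" "is_path P q" "psrc p = ptgt P q"
  shows "\<Gamma> (p \<cdot>\<^sub>p q) = (\<Gamma> p \<diamondop> \<iota> (f q)) \<bullet> (\<iota> (f' p) \<diamondop> \<Gamma> q)"
  using assms(1,3)
proof (induction p rule: is_path_induct)
  case (Nil a)
  then show ?case using assms(2) by (simp add: pcat_def Y.hcomp_id2_merge)
next
  case (Cons e es a)
  let ?p = "(es, a)"
  have [simp]: "is_path P ?p" "esrc P e = ptgt P ?p" "ptgt P q = a" "e \<in> P1 P" "is_path P q"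
    "a \<in> P0 P"
    using Cons assms(2) F.psrc_obj[of ?p] by auto
  have IH: "\<Gamma> (?p \<cdot>\<^sub>p q) = (\<Gamma> ?p \<diamondop> \<iota> (f q)) \<bullet> (\<iota> (f' ?p) \<diamondop> \<Gamma> q)"
    by (rule Cons.IH) simp
  have "(e # es, a) \<cdot>\<^sub>p q = (e # fst (?p \<cdot>\<^sub>p q), snd (?p \<cdot>\<^sub>p q))"
    by simp
  then have "\<Gamma> ((e # es, a) \<cdot>\<^sub>p q) =
      (\<gamma> e \<diamondop> \<iota> (f (?p \<cdot>\<^sub>p q))) \<bullet> (\<iota> (E' e) \<diamondop> \<Gamma> (?p \<cdot>\<^sub>p q))"
    by (simp only: lax_ev.simps prod.collapse)
  also have "\<dots> = (\<gamma> e \<diamondop> \<iota> (f ?p \<star> f q)) \<bullet>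
      (\<iota> (E' e) \<diamondop> ((\<Gamma> ?p \<diamondop> \<iota> (f q)) \<bullet> (\<iota> (f' ?p) \<diamondop> \<Gamma> q)))"
    by (simp add: IH del: pcat_simps(1))
  also have "\<dots> = (((\<gamma> e \<diamondop> \<iota> (f ?p)) \<bullet> (\<iota> (E' e) \<diamondop> \<Gamma> ?p)) \<diamondop> \<iota> (f q)) \<bullet>
      (\<iota> (E' e \<star> f' ?p) \<diamondop> \<Gamma> q)"
    by (simp del: pcat_simps(1) add: Y.whisker_vcomp Y.vcomp_assoc Y.hcomp_assoc' Y.id2_comp1_hcomp)
  finally show ?case by simp
qed

end

locale lax_transformation = lax_data +
  assumes comp_rel1: "rel1 P p q \<Longrightarrow> lax_ev Y F0 E E' r \<gamma> p = lax_ev Y F0 E E' r \<gamma> q"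
    and comp_gen: "x \<in> P2 P \<Longrightarrow>
      vcomp Y (lax_ev Y F0 E E' r \<gamma> (gcod P x)) (hcomp Y (G' x) (id2 Y (r (psrc (gdom P x)))))
      = vcomp Y (hcomp Y (id2 Y (r (ptgt P (gdom P x)))) (G x)) (lax_ev Y F0 E E' r \<gamma> (gdom P x))"
begin

lemma lax_ev_cong: "cong1 P p q \<Longrightarrow> \<Gamma> p = \<Gamma> q"
proof (induction rule: cong1.induct)
  case (comp p p' q q')
  then show ?case
    using F.cong1_path[of p p'] F.cong1_path[of q q'] F.ev1_cong[of q q'] F'.ev1_cong[of p p']
    by (simp add: lax_ev_pcat)
qed (simp_all add: comp_rel1)

abbreviation g where "g \<equiv> ev2 Y F0 E G"
abbreviation g' where "g' \<equiv> ev2 Y F0' E' G'"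

text \<open>
  Naturality passes from generating 2-cells to all 2-cells: naturality squares are stacked for
  \<open>VC\<close> and placed side by side for \<open>HC\<close>.  When the generator is some $\gamma^{i,j}_{f,g}$ and the
  transformation is $\gamma^{-,k}_{-,h}$, the hypothesis is the Yang-Baxter equation.
\<close>

lemma lax_ev_natural:
  "wf_tm P t \<Longrightarrow> \<Gamma> (tcod P t) \<bullet> (g' t \<diamondop> \<iota> (r (psrc (tdom P t))))
    = (\<iota> (r (ptgt P (tdom P t))) \<diamondop> g t) \<bullet> \<Gamma> (tdom P t)"
proof (induction t)
  case (Gen x)
  then show ?case by (simp add: comp_gen)
next
  case (Idt p)
  then show ?case by (simp add: Y.hcomp_id2_merge)
next
  case (VC s t)
  let ?a = "psrc (tdom P t)" and ?b = "ptgt P (tdom P t)"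
  have st: "wf_tm P s" "wf_tm P t" "cong1 P (tdom P s) (tcod P t)"
    using VC.prems by auto
  have [simp]: "psrc (tdom P s) = ?a" "ptgt P (tdom P s) = ?b"
    "f (tdom P s) = f (tcod P t)" "f' (tdom P s) = f' (tcod P t)"
    "\<Gamma> (tdom P s) = \<Gamma> (tcod P t)"
    using F.cong1_path[OF st(3)] lax_ev_cong[OF st(3)] F.ev1_cong[OF st(3)] F'.ev1_cong[OF st(3)]
      st by auto
  have "\<Gamma> (tcod P s) \<bullet> ((g' s \<bullet> g' t) \<diamondop> \<iota> (r ?a))
      = (\<Gamma> (tcod P s) \<bullet> (g' s \<diamondop> \<iota> (r ?a))) \<bullet> (g' t \<diamondop> \<iota> (r ?a))"
    using st by (simp add: Y.whisker_vcomp Y.vcomp_assoc)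
  also have "\<dots> = (\<iota> (r ?b) \<diamondop> g s) \<bullet> (\<Gamma> (tcod P t) \<bullet> (g' t \<diamondop> \<iota> (r ?a)))"
    using st VC.IH(1) by (simp add: Y.vcomp_assoc)
  also have "\<dots> = (\<iota> (r ?b) \<diamondop> (g s \<bullet> g t)) \<bullet> \<Gamma> (tdom P t)"
    using st VC.IH(2) by (simp add: Y.whisker_vcomp Y.vcomp_assoc)
  finally show ?case by simp
next
  case (HC s t)
  let ?a = "psrc (tdom P t)" and ?b = "ptgt P (tdom P t)" and ?c = "ptgt P (tdom P s)"
  let ?p1 = "tdom P s" and ?q1 = "tcod P s" and ?p2 = "tdom P t" and ?q2 = "tcod P t"
  have [simp]: "wf_tm P s" "wf_tm P t" "psrc ?p1 = ?b"
    using HC.prems by auto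
  have IH: "\<Gamma> ?q1 \<bullet> (g' s \<diamondop> \<iota> (r ?b)) = (\<iota> (r ?c) \<diamondop> g s) \<bullet> \<Gamma> ?p1"
    "\<Gamma> ?q2 \<bullet> (g' t \<diamondop> \<iota> (r ?a)) = (\<iota> (r ?b) \<diamondop> g t) \<bullet> \<Gamma> ?p2"
    using HC.IH by simp_all
  have "\<Gamma> (?q1 \<cdot>\<^sub>p ?q2) \<bullet> ((g' s \<diamondop> g' t) \<diamondop> \<iota> (r ?a))
      = (\<Gamma> ?q1 \<diamondop> \<iota> (f ?q2)) \<bullet> ((\<iota> (f' ?q1) \<diamondop> \<Gamma> ?q2) \<bullet> (g' s \<diamondop> (g' t \<diamondop> \<iota> (r ?a))))"
    by (simp add: lax_ev_pcat Y.vcomp_assoc Y.hcomp_assoc')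
  also have "(\<iota> (f' ?q1) \<diamondop> \<Gamma> ?q2) \<bullet> (g' s \<diamondop> (g' t \<diamondop> \<iota> (r ?a)))
      = (\<iota> (f' ?q1) \<bullet> g' s) \<diamondop> (\<Gamma> ?q2 \<bullet> (g' t \<diamondop> \<iota> (r ?a)))"
    by (rule Y.interchange'[symmetric]) simp_all
  also have "\<dots> = (g' s \<bullet> \<iota> (f' ?p1)) \<diamondop> ((\<iota> (r ?b) \<diamondop> g t) \<bullet> \<Gamma> ?p2)"
    by (simp add: IH)
  also have "\<dots> = (g' s \<diamondop> (\<iota> (r ?b) \<diamondop> g t)) \<bullet> (\<iota> (f' ?p1) \<diamondop> \<Gamma> ?p2)"
    by (rule Y.interchange') simp_all
  also have "(\<Gamma> ?q1 \<diamondop> \<iota> (f ?q2)) \<bullet> \<dots>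
      = ((\<Gamma> ?q1 \<diamondop> \<iota> (f ?q2)) \<bullet> ((g' s \<diamondop> \<iota> (r ?b)) \<diamondop> g t)) \<bullet> (\<iota> (f' ?p1) \<diamondop> \<Gamma> ?p2)"
    by (simp add: Y.vcomp_assoc Y.hcomp_assoc')
  also have "(\<Gamma> ?q1 \<diamondop> \<iota> (f ?q2)) \<bullet> ((g' s \<diamondop> \<iota> (r ?b)) \<diamondop> g t)
      = (\<Gamma> ?q1 \<bullet> (g' s \<diamondop> \<iota> (r ?b))) \<diamondop> (\<iota> (f ?q2) \<bullet> g t)"
    by (rule Y.interchange'[symmetric]) simp_all
  also have "\<dots> = ((\<iota> (r ?c) \<diamondop> g s) \<bullet> \<Gamma> ?p1) \<diamondop> (g t \<bullet> \<iota> (f ?p2))"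
    by (simp add: IH)
  also have "\<dots> = ((\<iota> (r ?c) \<diamondop> g s) \<diamondop> g t) \<bullet> (\<Gamma> ?p1 \<diamondop> \<iota> (f ?p2))"
    by (rule Y.interchange') simp_all
  finally show ?case
    by (simp add: lax_ev_pcat Y.vcomp_assoc Y.hcomp_assoc')
qed

end

text \<open>
  Extends $\gamma_{f, \mathbf{Id}} = f$ from edges to paths.
\<close>

lemma lax_ev_identity:
  fixes Y (structure)
  assumes "model Y P F0 E G" and "is_path P p"
    and "\<And>a. a \<in> P0 P \<Longrightarrow> r a = id1 Y (F0 a)" "\<And>e. e \<in> P1 P \<Longrightarrow> \<gamma> e = id2 Y (E e)"
  shows "lax_ev Y F0 E E r \<gamma> p = id2 Y (ev1 Y F0 E p)"
proof -
  interpret model Y P F0 E G by fact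
  show ?thesis
    using assms(2) by (induction p rule: is_path_induct) (simp_all add: assms(3,4) Y.hcomp_id2_merge)
qed

text \<open>
  The cells \<open>\<psi> a\<close> form a modification between two lax transformations.  This extends naturality of
  $\gamma_{f,g}$ in \<open>g\<close> from edges to paths: \<open>\<psi>\<close> is pushed through one square after the other.
\<close>

lemma lax_ev_modification:
  fixes Y (structure)
  assumes "lax_data Y P F0 E G F0' E' G' r \<gamma>" "lax_data Y P F0 E G F0' E' G' s \<delta>"
    and cell: "\<And>a. a \<in> P0 P \<Longrightarrow> \<psi> a \<in> Cell Y \<and> dom2 Y (\<psi> a) = r a \<and> cod2 Y (\<psi> a) = s a"
    and edge: "\<And>e. e \<in> P1 P \<Longrightarrow> vcomp Y (\<delta> e) (hcomp Y (id2 Y (E' e)) (\<psi> (esrc P e)))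
      = vcomp Y (hcomp Y (\<psi> (etgt P e)) (id2 Y (E e))) (\<gamma> e)"
    and "is_path P p"
  shows "vcomp Y (lax_ev Y F0 E E' s \<delta> p) (hcomp Y (id2 Y (ev1 Y F0' E' p)) (\<psi> (psrc p)))
    = vcomp Y (hcomp Y (\<psi> (ptgt P p)) (id2 Y (ev1 Y F0 E p))) (lax_ev Y F0 E E' r \<gamma> p)"
proof -
  interpret R: lax_data Y P F0 E G F0' E' G' r \<gamma> by fact
  interpret S: lax_data Y P F0 E G F0' E' G' s \<delta> by fact
  note [simp] = cell
  show ?thesis
    using assms(5)
  proof (induction p rule: is_path_induct)
    case (Nil a)
    then show ?case by simp
  next
    case (Cons e es a)
    let ?p = "(es, a)"
    let ?f = "ev1 Y F0 E ?p" and ?f' = "ev1 Y F0' E' ?p"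
    let ?R = "R.\<Gamma> ?p" and ?S = "S.\<Gamma> ?p"
    have [simp]: "is_path P ?p" "esrc P e = ptgt P ?p" "e \<in> P1 P" "a \<in> P0 P"
      using Cons R.F.psrc_obj[of ?p] by auto
    have IH: "vcomp Y ?S (hcomp Y (id2 Y ?f') (\<psi> a)) = vcomp Y (hcomp Y (\<psi> (esrc P e)) (id2 Y ?f)) ?R"
      using Cons.IH by simp
    have "S.\<Gamma> (e # es, a) \<bullet> (\<iota> (E' e \<star> ?f') \<diamondop> \<psi> a)
        = (\<delta> e \<diamondop> \<iota> ?f) \<bullet> (\<iota> (E' e) \<diamondop> (?S \<bullet> (\<iota> ?f' \<diamondop> \<psi> a)))"
      by (simp add: R.Y.whisker_vcomp R.Y.vcomp_assoc R.Y.id2_comp1_hcomp)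
    also have "\<dots> = ((\<delta> e \<bullet> (\<iota> (E' e) \<diamondop> \<psi> (esrc P e))) \<diamondop> \<iota> ?f) \<bullet> (\<iota> (E' e) \<diamondop> ?R)"
      unfolding IH by (simp add: R.Y.whisker_vcomp R.Y.vcomp_assoc R.Y.hcomp_assoc')
    also have "\<dots> = (\<psi> (etgt P e) \<diamondop> \<iota> (E e \<star> ?f)) \<bullet> R.\<Gamma> (e # es, a)"
      unfolding edge[OF \<open>e \<in> P1 P\<close>]
      by (simp add: R.Y.whisker_vcomp R.Y.vcomp_assoc R.Y.id2_comp1_hcomp)
    finally show ?case by simp
  qed
qed

text \<open>
  Extends $\gamma_{f, g_1 \cdot g_2} = (g_1 \cdot \gamma_{f, g_2}) \circ (\gamma_{f, g_1} \cdot g_2)$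
  from edges to paths, by pasting two rows of squares.
\<close>

lemma lax_ev_compose:
  fixes Y (structure)
  assumes "lax_data Y P F0 E G F0' E' G' r \<gamma>" "lax_data Y P F0' E' G' F0'' E'' G'' s \<delta>"
    and obj: "\<And>a. a \<in> P0 P \<Longrightarrow> rs a = comp1 Y (s a) (r a)"
    and edge: "\<And>e. e \<in> P1 P \<Longrightarrow> \<epsilon> e
      = vcomp Y (hcomp Y (id2 Y (s (etgt P e))) (\<gamma> e)) (hcomp Y (\<delta> e) (id2 Y (r (esrc P e))))"
    and "is_path P p"
  shows "lax_ev Y F0 E E'' rs \<epsilon> p
    = vcomp Y (hcomp Y (id2 Y (s (ptgt P p))) (lax_ev Y F0 E E' r \<gamma> p))
        (hcomp Y (lax_ev Y F0' E' E'' s \<delta> p) (id2 Y (r (psrc p))))"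
proof -
  interpret R: lax_data Y P F0 E G F0' E' G' r \<gamma> by fact
  interpret S: lax_data Y P F0' E' G' F0'' E'' G'' s \<delta> by fact
  show ?thesis
    using assms(5)
  proof (induction p rule: is_path_induct)
    case (Nil a)
    then show ?case by (simp add: obj R.Y.hcomp_id2_merge)
  next
    case (Cons e es a)
    let ?p = "(es, a)"
    let ?f = "ev1 Y F0 E ?p" and ?f' = "ev1 Y F0' E' ?p"
    let ?R = "R.\<Gamma> ?p" and ?S = "S.\<Gamma> ?p"
    let ?c = "ptgt P ?p" and ?d = "etgt P e"
    have [simp]: "is_path P ?p" "esrc P e = ?c" "e \<in> P1 P" "a \<in> P0 P"
      using Cons R.F.psrc_obj[of ?p] by auto
    \<comment> \<open>The first square of the upper row and the rest of the lower row have no strand in common.\<close>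
    have slide: "(\<delta> e \<diamondop> \<iota> (r ?c \<star> ?f)) \<bullet> (\<iota> (E'' e \<star> s ?c) \<diamondop> ?R)
        = (\<iota> (s ?d \<star> E' e) \<diamondop> ?R) \<bullet> (\<delta> e \<diamondop> \<iota> (?f' \<star> r a))"
      by (rule HOL.trans[OF R.Y.hcomp_split(1) R.Y.hcomp_split(2)[symmetric]]) simp_all
    have "lax_ev Y F0 E E'' rs \<epsilon> (e # es, a)
        = (((\<iota> (s ?d) \<diamondop> \<gamma> e) \<bullet> (\<delta> e \<diamondop> \<iota> (r ?c))) \<diamondop> \<iota> ?f)
          \<bullet> (\<iota> (E'' e) \<diamondop> ((\<iota> (s ?c) \<diamondop> ?R) \<bullet> (?S \<diamondop> \<iota> (r a))))"
      using Cons by (simp add: edge)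
    also have "\<dots> = (\<iota> (s ?d) \<diamondop> (\<gamma> e \<diamondop> \<iota> ?f)) \<bullet>
        ((\<delta> e \<diamondop> \<iota> (r ?c \<star> ?f)) \<bullet> (\<iota> (E'' e \<star> s ?c) \<diamondop> ?R)) \<bullet> (\<iota> (E'' e) \<diamondop> (?S \<diamondop> \<iota> (r a)))"
      by (simp add: R.Y.whisker_vcomp R.Y.vcomp_assoc R.Y.hcomp_assoc' R.Y.id2_comp1_hcomp)
    also have "\<dots> = (\<iota> (s ?d) \<diamondop> ((\<gamma> e \<diamondop> \<iota> ?f) \<bullet> (\<iota> (E' e) \<diamondop> ?R))) \<bullet>
        (((\<delta> e \<diamondop> \<iota> ?f') \<bullet> (\<iota> (E'' e) \<diamondop> ?S)) \<diamondop> \<iota> (r a))"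
      unfolding slide
      by (simp add: R.Y.whisker_vcomp R.Y.vcomp_assoc R.Y.hcomp_assoc' R.Y.id2_comp1_hcomp)
    finally show ?case by simp
  qed
qed


section \<open>The lax Gray tensor product of two 2-categories\<close>

locale gray_product = B: strict_2category B + C: strict_2category C
  for B :: "('o1, 'a1, 't1) two_cat" and C :: "('o2, 'a2, 't2) two_cat"
begin

abbreviation Q where "Q \<equiv> gray_presentation B C"

lemma gray_presentation_simps [simp]:
  "P0 Q = Obj B \<times> Obj C"
  "LArr f c \<in> P1 Q \<longleftrightarrow> f \<in> Arr B \<and> c \<in> Obj C"
  "RArr b g \<in> P1 Q \<longleftrightarrow> b \<in> Obj B \<and> g \<in> Arr C"
  "esrc Q (LArr f c) = (src B f, c)" "esrc Q (RArr b g) = (b, src C g)"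
  "etgt Q (LArr f c) = (tgt B f, c)" "etgt Q (RArr b g) = (b, tgt C g)"
  "rel1 Q = gray_rel1 B C"
  "LCell \<phi> c \<in> P2 Q \<longleftrightarrow> \<phi> \<in> Cell B \<and> c \<in> Obj C"
  "RCell b \<psi> \<in> P2 Q \<longleftrightarrow> b \<in> Obj B \<and> \<psi> \<in> Cell C"
  "Gam f g \<in> P2 Q \<longleftrightarrow> f \<in> Arr B \<and> g \<in> Arr C"
  "gdom Q (LCell \<phi> c) = lpath B (dom2 B \<phi>) c"
  "gcod Q (LCell \<phi> c) = lpath B (cod2 B \<phi>) c"
  "gdom Q (RCell b \<psi>) = rpath C b (dom2 C \<psi>)"
  "gcod Q (RCell b \<psi>) = rpath C b (cod2 C \<psi>)"
  "gdom Q (Gam f g) = lpath B f (tgt C g) \<cdot>\<^sub>p rpath C (src B f) g"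
  "gcod Q (Gam f g) = rpath C (tgt B f) g \<cdot>\<^sub>p lpath B f (src C g)"
  "rel2 Q = gray_rel2 B C"
  by (auto simp: gray_presentation_def)

sublocale wf_edges Q
proof
  fix e
  assume "e \<in> P1 Q"
  then show "esrc Q e \<in> P0 Q" "etgt Q e \<in> P0 Q"
    by (cases e; simp)+
qed

lemma gray_path_simps [simp]:
  "is_path Q (lpath B f c) \<longleftrightarrow> f \<in> Arr B \<and> c \<in> Obj C"
  "is_path Q (rpath C b g) \<longleftrightarrow> b \<in> Obj B \<and> g \<in> Arr C"
  "psrc (lpath B f c) = (src B f, c)" "psrc (rpath C b g) = (b, src C g)"
  "ptgt Q (lpath B f c) = (tgt B f, c)" "ptgt Q (rpath C b g) = (b, tgt C g)"
  by (auto simp: lpath_def rpath_def)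

lemma gray_cong1:
  "\<lbrakk>f1 \<in> Arr B; f2 \<in> Arr B; src B f1 = tgt B f2; c \<in> Obj C\<rbrakk>
    \<Longrightarrow> cong1 Q (lpath B f1 c \<cdot>\<^sub>p lpath B f2 c) (lpath B (comp1 B f1 f2) c)"
  "\<lbrakk>g1 \<in> Arr C; g2 \<in> Arr C; src C g1 = tgt C g2; b \<in> Obj B\<rbrakk>
    \<Longrightarrow> cong1 Q (rpath C b g1 \<cdot>\<^sub>p rpath C b g2) (rpath C b (comp1 C g1 g2))"
  "\<lbrakk>b \<in> Obj B; c \<in> Obj C\<rbrakk> \<Longrightarrow> cong1 Q (lpath B (id1 B b) c) ([], (b, c))"
  "\<lbrakk>b \<in> Obj B; c \<in> Obj C\<rbrakk> \<Longrightarrow> cong1 Q (rpath C b (id1 C c)) ([], (b, c))"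
  by (simp_all add: cong1.rel gray_rel1.intros)

sublocale wf_presentation Q
proof
  fix p q
  assume "rel1 Q p q"
  then show "is_path Q p \<and> is_path Q q \<and> psrc p = psrc q \<and> ptgt Q p = ptgt Q q"
    unfolding gray_presentation_simps by cases auto
next
  fix x
  assume "x \<in> P2 Q"
  then show "is_path Q (gdom Q x) \<and> is_path Q (gcod Q x) \<and> psrc (gdom Q x) = psrc (gcod Q x)
      \<and> ptgt Q (gdom Q x) = ptgt Q (gcod Q x)"
    by (cases x) auto
next
  fix s t
  assume "rel2 Q s t"
  then show "wf_tm Q s \<and> wf_tm Q t \<and> cong1 Q (tdom Q s) (tdom Q t) \<and> cong1 Q (tcod Q s) (tcod Q t)"
    unfolding gray_presentation_simps
  proof cases
    case (gam_id_right f c)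
    then show ?thesis
      using cong1_whisker(2)[OF gray_cong1(4)[of "src B f" c], of "lpath B f c"]
        cong1_whisker(1)[OF gray_cong1(4)[of "tgt B f" c], of "lpath B f c"]
      by (simp add: cong1.refl)
  next
    case (gam_id_left g b)
    then show ?thesis
      using cong1_whisker(2)[OF gray_cong1(3)[of b "src C g"], of "rpath C b g"]
        cong1_whisker(1)[OF gray_cong1(3)[of b "tgt C g"], of "rpath C b g"]
      by (simp add: cong1.refl)
  next
    case (gam_comp_left f1 f2 g)
    then show ?thesis
      using cong1_whisker(1)[OF gray_cong1(1)[of f1 f2 "tgt C g"], of "rpath C (src B f2) g"]
        cong1_whisker(2)[OF gray_cong1(1)[of f1 f2 "src C g"], of "rpath C (tgt B f1) g"]
      by (simp add: cong1.refl cong1.sym)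
  next
    case (gam_comp_right f g1 g2)
    then show ?thesis
      using cong1_whisker(2)[OF gray_cong1(2)[of g1 g2 "src B f"], of "lpath B f (tgt C g1)"]
        cong1_whisker(1)[OF gray_cong1(2)[of g1 g2 "tgt B f"], of "lpath B f (src C g2)"]
      by (simp add: cong1.refl cong1.sym)
  qed (simp_all add: cong1.refl gray_cong1)
qed

text \<open>
  From here on the defining relations are used as equations between cells of \<open>gray B C\<close>.  They are
  obtained by evaluating the relations in the tautological model.
\<close>

abbreviation L1 where "L1 f c \<equiv> cls1 Q (lpath B f c)"
abbreviation R1 where "R1 b g \<equiv> cls1 Q (rpath C b g)"
abbreviation L2 where "L2 \<phi> c \<equiv> cls2 Q (Gen (LCell \<phi> c))"
abbreviation R2 where "R2 b \<psi> \<equiv> cls2 Q (Gen (RCell b \<psi>))"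
abbreviation \<gamma> where "\<gamma> f g \<equiv> cls2 Q (Gen (Gam f g))"

sublocale Z: strict_2category "gray B C"
  unfolding gray_def by (rule presented_2category)

lemma Obj_gray [simp]: "Obj (gray B C) = Obj B \<times> Obj C"
  by (simp add: gray_def)

lemma id1_gray [simp]: "id1 (gray B C) a = cls1 Q ([], a)"
  by (simp add: gray_def)

lemma gray_arr [simp]:
  assumes "is_path Q p"
  shows "cls1 Q p \<in> Arr (gray B C)" "src (gray B C) (cls1 Q p) = psrc p"
    "tgt (gray B C) (cls1 Q p) = ptgt Q p"
  using assms by (simp_all add: gray_def)

lemma gray_gen [simp]:
  assumes "x \<in> P2 Q"
  shows "cls2 Q (Gen x) \<in> Cell (gray B C)"
    "dom2 (gray B C) (cls2 Q (Gen x)) = cls1 Q (gdom Q x)"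
    "cod2 (gray B C) (cls2 Q (Gen x)) = cls1 Q (gcod Q x)"
  using assms by (simp_all add: gray_def)

lemma gray_pcat [simp]:
  assumes "is_path Q p" "is_path Q q" "psrc p = ptgt Q q"
  shows "cls1 Q (p \<cdot>\<^sub>p q) = cls1 Q p \<star>\<^bsub>gray B C\<^esub> cls1 Q q"
  using assms by (simp add: gray_def)

lemma tautological_gray:
  "model (gray B C) Q (\<lambda>a. a) (\<lambda>e. cls1 Q ([e], esrc Q e)) (\<lambda>x. cls2 Q (Gen x))"
  unfolding gray_def by (rule tautological_model)

lemma gray_rel1_eq: "gray_rel1 B C p q \<Longrightarrow> cls1 Q p = cls1 Q q"
  by (rule cls1_eqI, rule cong1.rel) simp

lemma ev1_gray [simp]:
  "is_path Q p \<Longrightarrow> ev1 (gray B C) (\<lambda>a. a) (\<lambda>e. cls1 Q ([e], esrc Q e)) p = cls1 Q p"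
  unfolding gray_def by (rule ev1_tautological)

lemma gray_rel2_eq:
  assumes "gray_rel2 B C s t"
  shows "ev2 (gray B C) (\<lambda>a. a) (\<lambda>e. cls1 Q ([e], esrc Q e)) (\<lambda>x. cls2 Q (Gen x)) s
    = ev2 (gray B C) (\<lambda>a. a) (\<lambda>e. cls1 Q ([e], esrc Q e)) (\<lambda>x. cls2 Q (Gen x)) t"
  by (rule model.rel2[OF tautological_gray]) (simp add: assms)

lemmas L1_comp = gray_rel1_eq[OF gray_rel1.left_comp, symmetric]
  and R1_comp = gray_rel1_eq[OF gray_rel1.right_comp, symmetric]
  and L1_id = gray_rel1_eq[OF gray_rel1.left_id]
  and R1_id = gray_rel1_eq[OF gray_rel1.right_id]
  and L2_vcomp = gray_rel2_eq[OF gray_rel2.left_vcomp, symmetric, simplified]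
  and L2_hcomp = gray_rel2_eq[OF gray_rel2.left_hcomp, symmetric, simplified]
  and L2_id2 = gray_rel2_eq[OF gray_rel2.left_id2, simplified ev2.simps]
  and R2_vcomp = gray_rel2_eq[OF gray_rel2.right_vcomp, symmetric, simplified]
  and R2_hcomp = gray_rel2_eq[OF gray_rel2.right_hcomp, symmetric, simplified]
  and R2_id2 = gray_rel2_eq[OF gray_rel2.right_id2, simplified ev2.simps]
  and \<gamma>_id_right = gray_rel2_eq[OF gray_rel2.gam_id_right, simplified ev2.simps]
  and \<gamma>_id_left = gray_rel2_eq[OF gray_rel2.gam_id_left, simplified ev2.simps]
  and \<gamma>_comp_left = gray_rel2_eq[OF gray_rel2.gam_comp_left, simplified ev2.simps]
  and \<gamma>_comp_right = gray_rel2_eq[OF gray_rel2.gam_comp_right, simplified ev2.simps]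
  and \<gamma>_natural = gray_rel2_eq[OF gray_rel2.gam_natural, simplified ev2.simps]

lemma left_functor:
  assumes "c \<in> Obj C"
  shows "strict_2functor B (gray B C) (\<lambda>b. (b, c)) (\<lambda>f. L1 f c) (\<lambda>\<phi>. L2 \<phi> c)"
  by unfold_locales
    (simp_all add: assms L1_comp L1_id L2_vcomp L2_hcomp L2_id2)

end


section \<open>The presentation by the generators of all factors\<close>

locale family =
  fixes C :: "nat \<Rightarrow> ('o, 'a, 't) two_cat" and n :: nat
  assumes factor: "i < n \<Longrightarrow> strict_2category (C i)"
begin

abbreviation M where "M \<equiv> multi_presentation C n"

lemmas factor_simps [simp] =
  strict_2category.src_obj[OF factor] strict_2category.tgt_obj[OF factor]
  strict_2category.id1_arr[OF factor] strict_2category.src_id1[OF factor]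
  strict_2category.tgt_id1[OF factor] strict_2category.comp1_arr[OF factor]
  strict_2category.src_comp1[OF factor] strict_2category.tgt_comp1[OF factor]
  strict_2category.dom2_arr[OF factor] strict_2category.cod2_arr[OF factor]
  strict_2category.src_parallel[OF factor] strict_2category.tgt_parallel[OF factor]
  strict_2category.id2_cell[OF factor] strict_2category.dom2_id2[OF factor]
  strict_2category.cod2_id2[OF factor] strict_2category.vcomp_cell[OF factor]
  strict_2category.dom2_vcomp[OF factor] strict_2category.cod2_vcomp[OF factor]
  strict_2category.hcomp_type[OF factor]

lemma tuples_simps [simp]:
  "a \<in> tuples C n \<Longrightarrow> length a = n"
  "a \<in> tuples C n \<Longrightarrow> i < n \<Longrightarrow> a ! i \<in> Obj (C i)"
  "a \<in> tuples C n \<Longrightarrow> x \<in> Obj (C i) \<Longrightarrow> a[i := x] \<in> tuples C n"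
  by (auto simp: tuples_def) (metis length_list_update nth_list_update_eq nth_list_update_neq)

lemma multi_presentation_simps [simp]:
  "P0 M = tuples C n"
  "MArr i f a \<in> P1 M \<longleftrightarrow> arr_at C n i f a"
  "esrc M (MArr i f a) = a" "etgt M (MArr i f a) = a[i := tgt (C i) f]"
  "rel1 M = multi_rel1 C n"
  "MCell i \<phi> a \<in> P2 M \<longleftrightarrow> cell_at C n i \<phi> a"
  "MGam i j f g a \<in> P2 M \<longleftrightarrow> i < j \<and> arr_at C n i f a \<and> arr_at C n j g a"
  "gdom M (MCell i \<phi> a) = mpath i (dom2 (C i) \<phi>) a"
  "gcod M (MCell i \<phi> a) = mpath i (cod2 (C i) \<phi>) a"
  "gdom M (MGam i j f g a) = mpath i f (a[j := tgt (C j) g]) \<cdot>\<^sub>p mpath j g a"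
  "gcod M (MGam i j f g a) = mpath j g (a[i := tgt (C i) f]) \<cdot>\<^sub>p mpath i f a"
  "rel2 M = multi_rel2 C n"
  by (auto simp: multi_presentation_def)

lemmas at_defs [simp] = arr_at_def cell_at_def src0_def tgt0_def

sublocale wf_edges M
proof
  fix e
  assume "e \<in> P1 M"
  then show "esrc M e \<in> P0 M" "etgt M e \<in> P0 M"
    by (cases e; simp)+
qed

lemma multi_path_simps [simp]:
  "is_path M (mpath i f a) \<longleftrightarrow> arr_at C n i f a"
  "psrc (mpath i f a) = a"
  "ptgt M (mpath i f a) = a[i := tgt (C i) f]"
  by (auto simp: mpath_def)

lemma path_tuples [simp]:
  "is_path M p \<Longrightarrow> psrc p \<in> tuples C n" "is_path M p \<Longrightarrow> ptgt M p \<in> tuples C n"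
  using psrc_obj[of p] ptgt_obj[of p] by simp_all

lemma multi_cong1:
  "\<lbrakk>arr_at C n i g a; f \<in> Arr (C i); src (C i) f = tgt (C i) g; a' = a[i := tgt (C i) g]\<rbrakk>
    \<Longrightarrow> cong1 M (mpath i f a' \<cdot>\<^sub>p mpath i g a) (mpath i (comp1 (C i) f g) a)"
  "\<lbrakk>a \<in> tuples C n; i < n; a ! i = x\<rbrakk> \<Longrightarrow> cong1 M (mpath i (id1 (C i) x) a) ([], a)"
  by (auto simp del: at_defs intro!: cong1.rel multi_rel1.intros)

sublocale wf_presentation M
proof
  fix p q
  assume "rel1 M p q"
  then show "is_path M p \<and> is_path M q \<and> psrc p = psrc q \<and> ptgt M p = ptgt M q"
    unfolding multi_presentation_simps by cases auto
next
  fix x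
  assume "x \<in> P2 M"
  then show "is_path M (gdom M x) \<and> is_path M (gcod M x) \<and> psrc (gdom M x) = psrc (gcod M x)
      \<and> ptgt M (gdom M x) = ptgt M (gcod M x)"
    by (cases x) (auto simp: list_update_swap)
next
  fix s t
  assume "rel2 M s t"
  then show "wf_tm M s \<and> wf_tm M t \<and> cong1 M (tdom M s) (tdom M t) \<and> cong1 M (tcod M s) (tcod M t)"
    unfolding multi_presentation_simps
  proof cases
    case (gam_id_right i j f a)
    then show ?thesis
      using cong1_whisker(2)[OF multi_cong1(2)[of a j "a ! j"], of "mpath i f a"]
        cong1_whisker(1)[OF multi_cong1(2)[of "a[i := tgt (C i) f]" j "a ! j"], of "mpath i f a"]
      by (simp add: cong1.refl)
  next
    case (gam_id_left i j f a)
    then show ?thesis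
      using cong1_whisker(2)[OF multi_cong1(2)[of a i "a ! i"], of "mpath j f a"]
        cong1_whisker(1)[OF multi_cong1(2)[of "a[j := tgt (C j) f]" i "a ! i"], of "mpath j f a"]
      by (simp add: cong1.refl)
  next
    case (gam_comp_left i j f2 a g f1)
    then show ?thesis
      using cong1_whisker(1)[OF multi_cong1(1)[of i f2 "a[j := tgt (C j) g]" f1], of _ "mpath j g a"]
        cong1_whisker(2)[OF multi_cong1(1)[of i f2 a f1], of _ "mpath j g (a[i := tgt (C i) f1])"]
      by (simp add: cong1.refl cong1.sym list_update_swap)
  next
    case (gam_comp_right i j f a g2 g1)
    then show ?thesis
      using cong1_whisker(2)[OF multi_cong1(1)[of j g2 a g1], of _ "mpath i f (a[j := tgt (C j) g1])"]
        cong1_whisker(1)[OF multi_cong1(1)[of j g2 "a[i := tgt (C i) f]" g1], of _ "mpath i f a"]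
      by (simp add: cong1.refl cong1.sym list_update_swap)
  qed (simp_all add: cong1.refl multi_cong1 list_update_swap)
qed

end


section \<open>Adjoining one factor\<close>

lemma ev1_map: "ev1 Y F0 E (map_prod (map h) k p) = ev1 Y (\<lambda>a. F0 (k a)) (\<lambda>e. E (h e)) p"
proof (cases p)
  case (Pair es a)
  then show ?thesis by (induction es arbitrary: p) auto
qed

lemma ev2_map:
  "ev2 Y F0 E G (map_tm k h l t) = ev2 Y (\<lambda>a. F0 (k a)) (\<lambda>e. E (h e)) (\<lambda>x. G (l x)) t"
  by (induction t) (simp_all add: ev1_map)

text \<open>
  An object \<open>c\<close> of the last of \<open>n + 1\<close> factors embeds the generators for the first \<open>n\<close> factors into
  those for all factors, by keeping the last component constantly equal to \<open>c\<close>.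
\<close>

primrec snoc_edge :: "'o \<Rightarrow> ('o, 'a) multi_edge \<Rightarrow> ('o, 'a) multi_edge" where
  "snoc_edge c (MArr i f a) = MArr i f (a @ [c])"

primrec snoc_gen :: "'o \<Rightarrow> ('o, 'a, 't) multi_gen \<Rightarrow> ('o, 'a, 't) multi_gen" where
  "snoc_gen c (MCell i \<phi> a) = MCell i \<phi> (a @ [c])"
| "snoc_gen c (MGam i j f g a) = MGam i j f g (a @ [c])"

abbreviation snoc_path :: "'o \<Rightarrow> ('o, 'a) multi_path \<Rightarrow> ('o, 'a) multi_path" where
  "snoc_path c \<equiv> map_prod (map (snoc_edge c)) (\<lambda>a. a @ [c])"

abbreviation snoc_tm :: "'o \<Rightarrow> ('o, 'a, 't) multi_tm \<Rightarrow> ('o, 'a, 't) multi_tm" where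
  "snoc_tm c \<equiv> map_tm (\<lambda>a. a @ [c]) (snoc_edge c) (snoc_gen c)"

lemma snoc_mpath [simp]: "snoc_path c (mpath i f a) = mpath i f (a @ [c])"
  by (simp add: mpath_def)

lemma snoc_pcat [simp]: "snoc_path c (p \<cdot>\<^sub>p q) = snoc_path c p \<cdot>\<^sub>p snoc_path c q"
  by (simp add: pcat_def map_prod_def case_prod_beta)

lemma tuples_snoc [simp]: "b @ [c] \<in> tuples C (Suc n) \<longleftrightarrow> b \<in> tuples C n \<and> c \<in> Obj (C n)"
  by (auto simp: tuples_def nth_append All_less_Suc)

lemma tuples_SucE:
  assumes "a \<in> tuples C (Suc n)"
  obtains b c where "a = b @ [c]" "b \<in> tuples C n" "c \<in> Obj (C n)"
proof -
  have "a = butlast a @ [last a]"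
    using assms by (cases "a = []") (auto simp: tuples_def)
  with assms that show thesis by (metis tuples_snoc)
qed

locale family_Suc = family C "Suc n" for C :: "nat \<Rightarrow> ('o, 'a, 't) two_cat" and n
begin

abbreviation P where "P \<equiv> multi_presentation C n"
abbreviation P' where "P' \<equiv> multi_presentation C (Suc n)"

sublocale P: family C n
  by (rule family.intro, rule factor) simp

lemma update_snoc [simp]:
  "b \<in> tuples C n \<Longrightarrow> i < n \<Longrightarrow> (b @ [c])[i := x] = b[i := x] @ [c]"
  "b \<in> tuples C n \<Longrightarrow> (b @ [c])[n := x] = b @ [x]"
  "b \<in> tuples C n \<Longrightarrow> i < n \<Longrightarrow> (b @ [c]) ! i = b ! i"
  "b \<in> tuples C n \<Longrightarrow> (b @ [c]) ! n = c"
  by (auto simp: list_update_append nth_append)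

lemma snoc_rel1:
  assumes "c \<in> Obj (C n)" "multi_rel1 C n p q"
  shows "multi_rel1 C (Suc n) (snoc_path c p) (snoc_path c q)"
  using assms(2)
proof cases
  case (comp i g a f)
  then show ?thesis
    using multi_rel1.comp[of C "Suc n" i g "a @ [c]" f] assms(1) by simp
next
  case (id a i)
  then show ?thesis
    using multi_rel1.id[of "a @ [c]" C "Suc n" i] assms(1) by simp
qed

lemma snoc_rel2:
  assumes "c \<in> Obj (C n)" "multi_rel2 C n s t"
  shows "multi_rel2 C (Suc n) (snoc_tm c s) (snoc_tm c t)"
  using assms(2)
proof cases
  case (vcomp i \<psi> a \<phi>)
  then show ?thesis
    using multi_rel2.vcomp[of C "Suc n" i \<psi> "a @ [c]" \<phi>] assms(1) by simp
next
  case (hcomp i \<psi> a \<phi>)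
  then show ?thesis
    using multi_rel2.hcomp[of C "Suc n" i \<psi> "a @ [c]" \<phi>] assms(1) by simp
next
  case (id2 i f a)
  then show ?thesis
    using multi_rel2.id2[of C "Suc n" i f "a @ [c]"] assms(1) by simp
next
  case (gam_id_right i j f a)
  then show ?thesis
    using multi_rel2.gam_id_right[of i j "Suc n" C f "a @ [c]"] assms(1) by simp
next
  case (gam_id_left i j f a)
  then show ?thesis
    using multi_rel2.gam_id_left[of i j C "Suc n" f "a @ [c]"] assms(1) by simp
next
  case (gam_comp_left i j f2 a g f1)
  then show ?thesis
    using multi_rel2.gam_comp_left[of i j C "Suc n" f2 "a @ [c]" g f1] assms(1) by simp
next
  case (gam_comp_right i j f a g2 g1)
  then show ?thesis
    using multi_rel2.gam_comp_right[of i j C "Suc n" f "a @ [c]" g2 g1] assms(1) by simp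
next
  case (gam_natural i j \<phi> a \<psi>)
  then show ?thesis
    using multi_rel2.gam_natural[of i j C "Suc n" \<phi> "a @ [c]" \<psi>] assms(1) by simp
next
  case (yang_baxter i j k f a g h)
  then show ?thesis
    using multi_rel2.yang_baxter[of i j k C "Suc n" f "a @ [c]" g h] assms(1) by simp
qed

lemma snoc_edge_simps [simp]:
  assumes "c \<in> Obj (C n)" "e \<in> P1 P"
  shows "snoc_edge c e \<in> P1 P'" "esrc P' (snoc_edge c e) = esrc P e @ [c]"
    "etgt P' (snoc_edge c e) = etgt P e @ [c]"
  using assms by (cases e; simp)+

lemma snoc_gen_simps [simp]:
  assumes "c \<in> Obj (C n)" "x \<in> P2 P"
  shows "snoc_gen c x \<in> P2 P'" "gdom P' (snoc_gen c x) = snoc_path c (gdom P x)"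
    "gcod P' (snoc_gen c x) = snoc_path c (gcod P x)"
  using assms by (cases x; simp)+

lemma psrc_snoc [simp]: "psrc (snoc_path c p) = psrc p @ [c]"
  by (simp add: psrc_def)

lemma is_path_snoc:
  assumes "c \<in> Obj (C n)"
  shows "is_path P p \<Longrightarrow> is_path P' (snoc_path c p) \<and> ptgt P' (snoc_path c p) = ptgt P p @ [c]"
  by (induction p rule: is_path_induct) (simp_all add: assms)

lemma cong1_snoc:
  assumes "c \<in> Obj (C n)"
  shows "cong1 P p q \<Longrightarrow> cong1 P' (snoc_path c p) (snoc_path c q)"
proof (induction rule: cong1.induct)
  case (comp p p' q q')
  then show ?case
    using P.cong1_path[of q q'] is_path_snoc[OF assms, of q] by (auto intro!: cong1.comp)
next
  case (rel p q)
  then show ?case using snoc_rel1[OF assms] by (simp add: cong1.rel)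
next
  case (refl p)
  then show ?case using is_path_snoc[OF assms] by (simp add: cong1.refl)
qed (blast intro: cong1.sym cong1.trans)+

lemma wf_tm_snoc:
  assumes "c \<in> Obj (C n)"
  shows "wf_tm P t \<Longrightarrow> wf_tm P' (snoc_tm c t) \<and> tdom P' (snoc_tm c t) = snoc_path c (tdom P t)
    \<and> tcod P' (snoc_tm c t) = snoc_path c (tcod P t)"
  by (induction t) (simp_all add: is_path_snoc assms cong1_snoc)

lemma edge_SucE:
  assumes "x \<in> P1 P'"
  obtains (old) c y where "c \<in> Obj (C n)" "y \<in> P1 P" "x = snoc_edge c y"
  | (new) b f where "b \<in> tuples C n" "f \<in> Arr (C n)" "x = MArr n f (b @ [src (C n) f])"
proof (cases x)
  case (MArr i f a)
  with assms have at: "arr_at C (Suc n) i f a" by simp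
  then obtain b c where b: "a = b @ [c]" "b \<in> tuples C n" "c \<in> Obj (C n)"
    by (auto elim: tuples_SucE)
  show thesis
  proof (cases "i < n")
    case True
    then show thesis using old[of c "MArr i f b"] at b MArr by simp
  next
    case False
    then have "i = n" using at by simp
    then show thesis using new[of b f] at b MArr by simp
  qed
qed

lemma gen_SucE:
  assumes "x \<in> P2 P'"
  obtains (old) c y where "c \<in> Obj (C n)" "y \<in> P2 P" "x = snoc_gen c y"
  | (cell) b \<phi> where "b \<in> tuples C n" "\<phi> \<in> Cell (C n)" "x = MCell n \<phi> (b @ [src0 (C n) \<phi>])"
  | (gam) i f g b where "arr_at C n i f b" "g \<in> Arr (C n)"
    "x = MGam i n f g (b @ [src (C n) g])"
proof (cases x)
  case (MCell i \<phi> a)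
  with assms have at: "cell_at C (Suc n) i \<phi> a" by simp
  then obtain b c where b: "a = b @ [c]" "b \<in> tuples C n" "c \<in> Obj (C n)"
    by (auto elim: tuples_SucE)
  show thesis
  proof (cases "i < n")
    case True
    then show thesis using old[of c "MCell i \<phi> b"] at b MCell by simp
  next
    case False
    then have "i = n" using at by simp
    then show thesis using cell[of b \<phi>] at b MCell by simp
  qed
next
  case (MGam i j f g a)
  with assms have at: "i < j" "arr_at C (Suc n) i f a" "arr_at C (Suc n) j g a" by simp_all
  then obtain b c where b: "a = b @ [c]" "b \<in> tuples C n" "c \<in> Obj (C n)"
    by (auto elim: tuples_SucE)
  show thesis
  proof (cases "j < n")
    case True
    then show thesis using old[of c "MGam i j f g b"] at b MGam by simp
  next
    case False
    then have "j = n" "i < n" using at by simp_all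
    then show thesis using gam[of i f b g] at b MGam by simp
  qed
qed

text \<open>Every relation of \<open>P\<close> becomes one of \<open>P'\<close> when the constant last component \<open>c\<close> is added.\<close>

lemma model_snoc:
  assumes "model Y P' F0 E G" "c \<in> Obj (C n)"
  shows "model Y P (\<lambda>a. F0 (a @ [c])) (\<lambda>e. E (snoc_edge c e)) (\<lambda>x. G (snoc_gen c x))"
proof -
  interpret K: model Y P' F0 E G by fact
  have c: "c \<in> Obj (C n)" by fact
  show ?thesis
  proof
    show "rel1 P p q \<Longrightarrow> ev1 Y (\<lambda>a. F0 (a @ [c])) (\<lambda>e. E (snoc_edge c e)) p
        = ev1 Y (\<lambda>a. F0 (a @ [c])) (\<lambda>e. E (snoc_edge c e)) q" for p q
      using K.rel1[of "snoc_path c p" "snoc_path c q"] snoc_rel1[OF c] by (simp add: ev1_map)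
    show "rel2 P s t \<Longrightarrow> ev2 Y (\<lambda>a. F0 (a @ [c])) (\<lambda>e. E (snoc_edge c e)) (\<lambda>x. G (snoc_gen c x)) s
        = ev2 Y (\<lambda>a. F0 (a @ [c])) (\<lambda>e. E (snoc_edge c e)) (\<lambda>x. G (snoc_gen c x)) t" for s t
      using K.rel2[of "snoc_tm c s" "snoc_tm c t"] snoc_rel2[OF c] by (simp add: ev2_map)
  qed (simp_all add: K.gen c ev1_map)
qed

end


text \<open>
  The induction step is carried out for an arbitrary 2-category \<open>I\<close> presented by \<open>P\<close>, in place of
  the iterated product of the first \<open>n\<close> factors.
\<close>

locale gray_step = J: presents I "multi_presentation C n" "\<lambda>a. a" e g + family_Suc C n
  for C :: "nat \<Rightarrow> ('o, 'a, 't) two_cat" and n and I :: "('o list, 'b, 'u) two_cat" and e g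
begin

sublocale Q: gray_product I "C n"
  by (rule gray_product.intro) (simp_all add: factor J.Y.strict_2category_axioms)

abbreviation Z where "Z \<equiv> gray I (C n)"

text \<open>
  The recursion that defines the cells $\{f\}_i$, $\{\phi\}_i$ and $\gamma^{i,j}_{f,g}$ of the
  iterated product, before relabelling.
\<close>

fun fwd1 where
  "fwd1 (MArr i f a) = (if i < n then Q.L1 (e (MArr i f (butlast a))) (last a) else Q.R1 (butlast a) f)"

fun fwd2 where
  "fwd2 (MCell i \<phi> a) =
    (if i < n then Q.L2 (g (MCell i \<phi> (butlast a))) (last a) else Q.R2 (butlast a) \<phi>)"
| "fwd2 (MGam i j f h a) =
    (if j < n then Q.L2 (g (MGam i j f h (butlast a))) (last a)
     else Q.\<gamma> (e (MArr i f (butlast a))) h)"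

abbreviation fwd0 :: "'o list \<Rightarrow> 'o list \<times> 'o" where "fwd0 a \<equiv> (butlast a, last a)"

lemma Obj_I [simp]: "Obj I = tuples C n"
  using J.F0_bij by (simp add: bij_betw_def)

text \<open>
  On the generators over \<open>c\<close> the forward assignment is the given model of \<open>P\<close> followed by the
  2-functor $(-, \mathbf{Id}_c)$; so it satisfies all relations among these generators.
\<close>

lemma fwd_old:
  assumes "c \<in> Obj (C n)"
  shows "model_image I P (\<lambda>a. a) e g Z (\<lambda>a. (a, c)) (\<lambda>f. Q.L1 f c) (\<lambda>\<phi>. Q.L2 \<phi> c)
    (\<lambda>a. fwd0 (a @ [c])) (\<lambda>y. fwd1 (snoc_edge c y)) (\<lambda>x. fwd2 (snoc_gen c x))"
proof -
  interpret T: strict_2functor I Z "\<lambda>a. (a, c)" "\<lambda>f. Q.L1 f c" "\<lambda>\<phi>. Q.L2 \<phi> c"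
    by (rule Q.left_functor) fact
  show ?thesis
  proof
    fix y
    assume "y \<in> P1 P"
    then show "fwd1 (snoc_edge c y) = Q.L1 (e y) c"
      by (cases y) simp
  next
    fix x
    assume "x \<in> P2 P"
    then show "fwd2 (snoc_gen c x) = Q.L2 (g x) c"
      by (cases x) simp_all
  qed simp
qed

lemma fwd_snoc:
  assumes "c \<in> Obj (C n)"
  shows "is_path P p \<Longrightarrow> ev1 Z fwd0 fwd1 (snoc_path c p) = Q.L1 (ev1 I (\<lambda>a. a) e p) c"
    "wf_tm P t \<Longrightarrow> ev2 Z fwd0 fwd1 fwd2 (snoc_tm c t) = Q.L2 (ev2 I (\<lambda>a. a) e g t) c"
  using model_image.ev1_image[OF fwd_old[OF assms]] model_image.ev2_image[OF fwd_old[OF assms]]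
  by (simp_all add: ev1_map ev2_map)

lemma e_type [simp]:
  assumes "arr_at C n i f b"
  shows "e (MArr i f b) \<in> Arr I" "src I (e (MArr i f b)) = b"
    "tgt I (e (MArr i f b)) = b[i := tgt (C i) f]"
  using assms J.edge[of "MArr i f b"] by simp_all

lemma e_single [simp]:
  assumes "arr_at C n i f b"
  shows "ev1 I (\<lambda>a. a) e (mpath i f b) = e (MArr i f b)"
  using assms by (simp add: mpath_def)

lemma g_cell_type [simp]:
  assumes "cell_at C n i \<phi> b"
  shows "g (MCell i \<phi> b) \<in> Cell I" "dom2 I (g (MCell i \<phi> b)) = e (MArr i (dom2 (C i) \<phi>) b)"
    "cod2 I (g (MCell i \<phi> b)) = e (MArr i (cod2 (C i) \<phi>) b)"
  using assms J.gen[of "MCell i \<phi> b"] by simp_all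

lemma g_gam_type [simp]:
  assumes "i < j" "arr_at C n i f b" "arr_at C n j h b"
  shows "g (MGam i j f h b) \<in> Cell I"
    "dom2 I (g (MGam i j f h b)) = e (MArr i f (b[j := tgt (C j) h])) \<star>\<^bsub>I\<^esub> e (MArr j h b)"
    "cod2 I (g (MGam i j f h b)) = e (MArr j h (b[i := tgt (C i) f])) \<star>\<^bsub>I\<^esub> e (MArr i f b)"
  using assms J.gen[of "MGam i j f h b"] by simp_all

lemma e_comp:
  assumes "arr_at C n i f2 b" "f1 \<in> Arr (C i)" "src (C i) f1 = tgt (C i) f2"
  shows "e (MArr i (f1 \<star>\<^bsub>C i\<^esub> f2) b) = e (MArr i f1 (b[i := tgt (C i) f2])) \<star>\<^bsub>I\<^esub> e (MArr i f2 b)"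
  using assms J.rel1[OF multi_rel1.comp[of C n i f2 b f1, folded P.multi_presentation_simps(5)]] by simp

lemma e_id:
  assumes "b \<in> tuples C n" "i < n" "b ! i = x"
  shows "e (MArr i (id1 (C i) x) b) = id1 I b"
  using assms P.tuples_simps(2)[of b i]
    J.rel1[OF multi_rel1.id[of b C n i, folded P.multi_presentation_simps(5)]] by simp

lemma fwd_old_rel:
  assumes "c \<in> Obj (C n)"
  shows "multi_rel1 C n p q
      \<Longrightarrow> ev1 Z fwd0 fwd1 (snoc_path c p) = ev1 Z fwd0 fwd1 (snoc_path c q)"
    "multi_rel2 C n s t
      \<Longrightarrow> ev2 Z fwd0 fwd1 fwd2 (snoc_tm c s) = ev2 Z fwd0 fwd1 fwd2 (snoc_tm c t)"
  using model.rel1[OF model_image.model_image[OF fwd_old[OF assms]], of p q]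
    model.rel2[OF model_image.model_image[OF fwd_old[OF assms]], of s t]
  by (simp_all add: ev1_map ev2_map)

lemma fwd_single [simp]:
  "arr_at C n i f b \<Longrightarrow> c \<in> Obj (C n) \<Longrightarrow>
    ev1 Z fwd0 fwd1 (mpath i f (b @ [c])) = Q.L1 (e (MArr i f b)) c"
  "b \<in> tuples C n \<Longrightarrow> f \<in> Arr (C n) \<Longrightarrow> c = src (C n) f \<Longrightarrow>
    ev1 Z fwd0 fwd1 (mpath n f (b @ [c])) = Q.R1 b f"
  by (simp_all add: mpath_def flip: Q.id1_gray)

text \<open>
  A relation without the last factor is inherited from \<open>P\<close>; otherwise it is a relation of the Gray
  product.
\<close>

lemma fwd_rel1:
  assumes "multi_rel1 C (Suc n) p q"
  shows "ev1 Z fwd0 fwd1 p = ev1 Z fwd0 fwd1 q"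
  using assms
proof cases
  case (comp i g a f)
  then obtain b c where b: "a = b @ [c]" "b \<in> tuples C n" "c \<in> Obj (C n)"
    by (auto elim: tuples_SucE)
  show ?thesis
  proof (cases "i < n")
    case True
    then show ?thesis
      using comp b fwd_old_rel(1)[OF b(3) multi_rel1.comp[of C n i g b f]] by simp
  next
    case False
    then have "i = n" using comp by simp
    then show ?thesis
      using comp b by (simp add: mpath_def Q.R1_comp flip: Q.id1_gray)
  qed
next
  case (id a i)
  then obtain b c where b: "a = b @ [c]" "b \<in> tuples C n" "c \<in> Obj (C n)"
    by (auto elim: tuples_SucE)
  show ?thesis
  proof (cases "i < n")
    case True
    then show ?thesis
      using id b fwd_old_rel(1)[OF b(3) multi_rel1.id[of b C n i]] by simp
  next
    case False
    then have "i = n" using id by simp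
    then show ?thesis
      using id b by (simp add: Q.R1_id)
  qed
qed

text \<open>
  The same two cases.  Among the relations with the last factor, only the Yang-Baxter equation is
  not an instance of a relation of the Gray product.
\<close>

lemma fwd_rel2:
  assumes "multi_rel2 C (Suc n) s t"
  shows "ev2 Z fwd0 fwd1 fwd2 s = ev2 Z fwd0 fwd1 fwd2 t"
  using assms
proof cases
  case (vcomp i \<psi> a \<phi>)
  then obtain b c where b: "a = b @ [c]" "b \<in> tuples C n" "c \<in> Obj (C n)"
    by (auto elim: tuples_SucE)
  show ?thesis
  proof (cases "i < n")
    case True
    then show ?thesis
      using vcomp b fwd_old_rel(2)[OF b(3) multi_rel2.vcomp[of C n i \<psi> b \<phi>]] by simp
  next
    case False
    then have "i = n" using vcomp by simp
    then show ?thesis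
      using vcomp b by (simp add: Q.R2_vcomp)
  qed
next
  case (hcomp i \<psi> a \<phi>)
  then obtain b c where b: "a = b @ [c]" "b \<in> tuples C n" "c \<in> Obj (C n)"
    by (auto elim: tuples_SucE)
  show ?thesis
  proof (cases "i < n")
    case True
    then show ?thesis
      using hcomp b fwd_old_rel(2)[OF b(3) multi_rel2.hcomp[of C n i \<psi> b \<phi>]] by simp
  next
    case False
    then have "i = n" using hcomp by simp
    then show ?thesis
      using hcomp b by (simp add: Q.R2_hcomp)
  qed
next
  case (id2 i f a)
  then obtain b c where b: "a = b @ [c]" "b \<in> tuples C n" "c \<in> Obj (C n)"
    by (auto elim: tuples_SucE)
  show ?thesis
  proof (cases "i < n")
    case True
    then show ?thesis
      using id2 b fwd_old_rel(2)[OF b(3) multi_rel2.id2[of C n i f b]] by simp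
  next
    case False
    then have "i = n" using id2 by simp
    then show ?thesis
      using id2 b by (simp add: Q.R2_id2)
  qed
next
  case (gam_id_right i j f a)
  then obtain b c where b: "a = b @ [c]" "b \<in> tuples C n" "c \<in> Obj (C n)"
    by (auto elim: tuples_SucE)
  show ?thesis
  proof (cases "j < n")
    case True
    then show ?thesis
      using gam_id_right b fwd_old_rel(2)[OF b(3) multi_rel2.gam_id_right[of i j n C f b]] by simp
  next
    case False
    then have "j = n" using gam_id_right by simp
    then show ?thesis
      using gam_id_right b by (simp add: Q.\<gamma>_id_right)
  qed
next
  case (gam_id_left i j f a)
  then obtain b c where b: "a = b @ [c]" "b \<in> tuples C n" "c \<in> Obj (C n)"
    by (auto elim: tuples_SucE)
  show ?thesis
  proof (cases "j < n")
    case True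
    then show ?thesis
      using gam_id_left b fwd_old_rel(2)[OF b(3) multi_rel2.gam_id_left[of i j C n f b]] by simp
  next
    case False
    then have "j = n" using gam_id_left by simp
    then show ?thesis
      using gam_id_left b by (simp add: Q.\<gamma>_id_left e_id)
  qed
next
  case (gam_comp_left i j f2 a h f1)
  then obtain b c where b: "a = b @ [c]" "b \<in> tuples C n" "c \<in> Obj (C n)"
    by (auto elim: tuples_SucE)
  show ?thesis
  proof (cases "j < n")
    case True
    then show ?thesis
      using gam_comp_left b fwd_old_rel(2)[OF b(3) multi_rel2.gam_comp_left[of i j C n f2 b h f1]]
      by simp
  next
    case False
    then have "j = n" using gam_comp_left by simp
    then show ?thesis
      using gam_comp_left b by (simp add: Q.\<gamma>_comp_left e_comp)
  qed
next
  case (gam_comp_right i j f a g2 g1)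
  then obtain b c where b: "a = b @ [c]" "b \<in> tuples C n" "c \<in> Obj (C n)"
    by (auto elim: tuples_SucE)
  show ?thesis
  proof (cases "j < n")
    case True
    then show ?thesis
      using gam_comp_right b fwd_old_rel(2)[OF b(3) multi_rel2.gam_comp_right[of i j C n f b g2 g1]]
      by simp
  next
    case False
    then have "j = n" using gam_comp_right by simp
    then show ?thesis
      using gam_comp_right b by (simp add: Q.\<gamma>_comp_right)
  qed
next
  case (gam_natural i j \<phi> a \<psi>)
  then obtain b c where b: "a = b @ [c]" "b \<in> tuples C n" "c \<in> Obj (C n)"
    by (auto elim: tuples_SucE)
  show ?thesis
  proof (cases "j < n")
    case True
    then show ?thesis
      using gam_natural b fwd_old_rel(2)[OF b(3) multi_rel2.gam_natural[of i j C n \<phi> b \<psi>]]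
      by simp
  next
    case False
    then have "j = n" using gam_natural by simp
    then show ?thesis
      using gam_natural b Q.\<gamma>_natural[of "g (MCell i \<phi> b)" \<psi>] by simp
  qed
next
  case (yang_baxter i j k f a f' h)
  then obtain b c where b: "a = b @ [c]" "b \<in> tuples C n" "c \<in> Obj (C n)"
    by (auto elim: tuples_SucE)
  show ?thesis
  proof (cases "k < n")
    case True
    then show ?thesis
      using yang_baxter b fwd_old_rel(2)[OF b(3) multi_rel2.yang_baxter[of i j k C n f b f' h]]
      by simp
  next
    case False
    then have "k = n" using yang_baxter by simp
    \<comment> \<open>Naturality of \<gamma> at the 2-cell $\gamma^{i,j}$ of the first factor and the identity of \<open>h\<close>, where
      the \<gamma> of a composite 1-cell splits into two squares.\<close>
    then show ?thesis
      using yang_baxter b Q.\<gamma>_natural[of "g (MGam i j f f' b)" "id2 (C n) h"]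
      by (simp add: Q.\<gamma>_comp_left Q.R2_id2 Q.L1_comp Q.Z.vcomp_assoc list_update_swap)
  qed
qed

lemma model_forward: "model Z P' fwd0 fwd1 fwd2"
proof
  fix a
  assume "a \<in> P0 P'"
  then show "fwd0 a \<in> Obj Z"
    by (auto elim: tuples_SucE)
next
  fix x
  assume "x \<in> P1 P'"
  then show "fwd1 x \<in> Arr Z \<and> src Z (fwd1 x) = fwd0 (esrc P' x) \<and> tgt Z (fwd1 x) = fwd0 (etgt P' x)"
  proof (cases rule: edge_SucE)
    case (old c y)
    then show ?thesis
      using model.edge[OF model_image.model_image[OF fwd_old], of c y] by simp
  next
    case (new b f)
    then show ?thesis by simp
  qed
next
  fix x
  assume "x \<in> P2 P'"
  then show "fwd2 x \<in> Cell Z \<and> dom2 Z (fwd2 x) = ev1 Z fwd0 fwd1 (gdom P' x)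
      \<and> cod2 Z (fwd2 x) = ev1 Z fwd0 fwd1 (gcod P' x)"
  proof (cases rule: gen_SucE)
    case (old c y)
    then show ?thesis
      using model.gen[OF model_image.model_image[OF fwd_old], of c y] by (simp add: ev1_map)
  next
    case (cell b \<phi>)
    then show ?thesis by (simp add: mpath_def flip: Q.id1_gray)
  next
    case (gam i f h b)
    then show ?thesis by (simp add: mpath_def flip: Q.id1_gray)
  qed
qed (simp_all add: fwd_rel1 fwd_rel2)

end


section \<open>The inverse functor\<close>

text \<open>
  Any model \<open>K\<close> of \<open>P'\<close> yields a model \<open>H\<close> of the Gray product of \<open>I\<close> and the last factor.  The cell
  $\gamma_{f,h}$ is needed for all 1-cells \<open>f\<close> of \<open>I\<close>, whereas \<open>K\<close> provides it for generators only.
  It is obtained by pasting, as the component of a lax transformation between the restrictions of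
  \<open>K\<close> to the source and the target of \<open>h\<close>.
\<close>

locale gray_back = gray_step C n I e g + K: model Y "multi_presentation C (Suc n)" K0 K1 K2
  for C :: "nat \<Rightarrow> ('o, 'a, 't) two_cat" and n and I :: "('o list, 'b, 'u) two_cat" and e g
    and Y :: "('p, 'c, 'v) two_cat" (structure) and K0 K1 K2
begin

abbreviation A0 where "A0 c \<equiv> \<lambda>a. K0 (a @ [c])"
abbreviation A1 where "A1 c \<equiv> \<lambda>y. K1 (snoc_edge c y)"
abbreviation A2 where "A2 c \<equiv> \<lambda>x. K2 (snoc_gen c x)"

lemma A_model: "c \<in> Obj (C n) \<Longrightarrow> model Y P (A0 c) (A1 c) (A2 c)"
  by (rule model_snoc) (rule K.model_axioms)

definition r where "r h b = K1 (MArr n h (b @ [src (C n) h]))"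

primrec \<gamma> where "\<gamma> h (MArr i f b) = K2 (MGam i n f h (b @ [src (C n) h]))"

definition cell where "cell \<psi> b = K2 (MCell n \<psi> (b @ [src0 (C n) \<psi>]))"

lemma K1_type [simp]:
  assumes "arr_at C (Suc n) i f a"
  shows "K1 (MArr i f a) \<in> Arr Y" "src Y (K1 (MArr i f a)) = K0 a"
    "tgt Y (K1 (MArr i f a)) = K0 (a[i := tgt (C i) f])"
  using assms K.edge[of "MArr i f a"] by simp_all

lemma K_single [simp]: "arr_at C (Suc n) i f a \<Longrightarrow> ev1 Y K0 K1 (mpath i f a) = K1 (MArr i f a)"
  by (simp add: mpath_def)

lemma K2_cell_type [simp]:
  assumes "cell_at C (Suc n) i \<phi> a"
  shows "K2 (MCell i \<phi> a) \<in> Cell Y" "dom2 Y (K2 (MCell i \<phi> a)) = K1 (MArr i (dom2 (C i) \<phi>) a)"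
    "cod2 Y (K2 (MCell i \<phi> a)) = K1 (MArr i (cod2 (C i) \<phi>) a)"
  using assms K.gen[of "MCell i \<phi> a"] by simp_all

lemma K2_gam_type [simp]:
  assumes "i < j" "arr_at C (Suc n) i f a" "arr_at C (Suc n) j h a"
  shows "K2 (MGam i j f h a) \<in> Cell Y"
    "dom2 Y (K2 (MGam i j f h a)) = K1 (MArr i f (a[j := tgt (C j) h])) \<star> K1 (MArr j h a)"
    "cod2 Y (K2 (MGam i j f h a)) = K1 (MArr j h (a[i := tgt (C i) f])) \<star> K1 (MArr i f a)"
  using assms K.gen[of "MGam i j f h a"] by simp_all

lemmas K_rel1 = K.rel1[unfolded multi_presentation_simps]
lemmas K_rel2 = K.rel2[unfolded multi_presentation_simps]

lemma r_type [simp]: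
  assumes "h \<in> Arr (C n)" "b \<in> tuples C n"
  shows "r h b \<in> Arr Y" "src Y (r h b) = K0 (b @ [src (C n) h])"
    "tgt Y (r h b) = K0 (b @ [tgt (C n) h])"
  using assms by (simp_all add: r_def)

lemma cell_type [simp]:
  assumes "\<psi> \<in> Cell (C n)" "b \<in> tuples C n"
  shows "cell \<psi> b \<in> Cell Y" "dom2 Y (cell \<psi> b) = r (dom2 (C n) \<psi>) b"
    "cod2 Y (cell \<psi> b) = r (cod2 (C n) \<psi>) b"
  using assms by (simp_all add: r_def cell_def)

abbreviation \<Gamma> where
  "\<Gamma> h \<equiv> lax_ev Y (A0 (src (C n) h)) (A1 (src (C n) h)) (A1 (tgt (C n) h)) (r h) (\<gamma> h)"

lemma lax_data:
  assumes "h \<in> Arr (C n)"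
  shows "lax_data Y P (A0 (src (C n) h)) (A1 (src (C n) h)) (A2 (src (C n) h))
    (A0 (tgt (C n) h)) (A1 (tgt (C n) h)) (A2 (tgt (C n) h)) (r h) (\<gamma> h)"
proof -
  interpret S: model Y P "A0 (src (C n) h)" "A1 (src (C n) h)" "A2 (src (C n) h)"
    by (rule A_model) (simp add: assms)
  interpret T: model Y P "A0 (tgt (C n) h)" "A1 (tgt (C n) h)" "A2 (tgt (C n) h)"
    by (rule A_model) (simp add: assms)
  show ?thesis
  proof
    fix x
    assume "x \<in> P1 P"
    then show "\<gamma> h x \<in> Cell Y \<and> dom2 Y (\<gamma> h x) = A1 (tgt (C n) h) x \<star> r h (esrc P x)
        \<and> cod2 Y (\<gamma> h x) = r h (etgt P x) \<star> A1 (src (C n) h) x"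
      using assms by (cases x) (simp add: r_def)
  qed (simp add: assms)
qed

text \<open>
  The component at a path depends only on its class because \<open>\<gamma>\<close> respects identities and composition
  in \<open>f\<close>.  Naturality at the generators $\{\phi\}_i$ is naturality of \<open>\<gamma>\<close>, and naturality at the
  generators $\gamma^{i,j}$ is exactly the Yang-Baxter equation.
\<close>

lemma lax_transformation:
  assumes h: "h \<in> Arr (C n)"
  shows "lax_transformation Y P (A0 (src (C n) h)) (A1 (src (C n) h)) (A2 (src (C n) h))
    (A0 (tgt (C n) h)) (A1 (tgt (C n) h)) (A2 (tgt (C n) h)) (r h) (\<gamma> h)"
proof -
  let ?c = "src (C n) h"
  interpret L: lax_data Y P "A0 (src (C n) h)" "A1 (src (C n) h)" "A2 (src (C n) h)"
    "A0 (tgt (C n) h)" "A1 (tgt (C n) h)" "A2 (tgt (C n) h)" "r h" "\<gamma> h"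
    by (rule lax_data) fact
  have single: "\<Gamma> h (mpath i f b) = K2 (MGam i n f h (b @ [?c]))"
    "L.f (mpath i f b) = K1 (MArr i f (b @ [?c]))"
    "L.f' (mpath i f b) = K1 (MArr i f (b @ [tgt (C n) h]))" if "arr_at C n i f b" for i f b
    using that by (simp_all add: mpath_def h r_def K.Y.hcomp_id2_merge)
  show ?thesis
  proof
    fix p q
    assume "rel1 P p q"
    then show "\<Gamma> h p = \<Gamma> h q"
      unfolding P.multi_presentation_simps
    proof cases
      case (comp i f2 a f1)
      then show ?thesis
        using h K_rel2(1)[OF multi_rel2.gam_comp_left[of i n C "Suc n" f2 "a @ [?c]" h f1]]
        by (simp add: L.lax_ev_pcat single)
    next
      case (id a i)
      then show ?thesis
        using h K_rel2(1)[OF multi_rel2.gam_id_left[of i n C "Suc n" h "a @ [?c]"]]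
        by (simp add: r_def single)
    qed
  next
    fix x
    assume "x \<in> P2 P"
    then show "\<Gamma> h (gcod P x) \<bullet> (A2 (tgt (C n) h) x \<diamondop> \<iota> (r h (psrc (gdom P x))))
      = (\<iota> (r h (ptgt P (gdom P x))) \<diamondop> A2 (src (C n) h) x) \<bullet> \<Gamma> h (gdom P x)"
    proof (cases x)
      case (MCell i \<phi> a)
      with \<open>x \<in> P2 P\<close> show ?thesis
        using h K_rel2(1)[OF multi_rel2.gam_natural[of i n C "Suc n" \<phi> "a @ [?c]" "id2 (C n) h"]]
          K_rel2(1)[OF multi_rel2.id2[of C "Suc n" n h "a @ [?c]"]]
          K_rel2(1)[OF multi_rel2.id2[of C "Suc n" n h "a[i := tgt0 (C i) \<phi>] @ [?c]"]]
        by (simp add: r_def single)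
    next
      case (MGam i j f f' a)
      with \<open>x \<in> P2 P\<close> show ?thesis
        using h K_rel2(1)[OF multi_rel2.yang_baxter[of i j n C "Suc n" f "a @ [?c]" f' h]]
        by (simp add: r_def single L.lax_ev_pcat K.Y.vcomp_assoc list_update_swap)
    qed
  qed
qed

text \<open>
  Completeness of the presentation of \<open>I\<close> makes the values below independent of the chosen paths and
  formal 2-cells.
\<close>

definition path_of where "path_of f = (SOME p. is_path P p \<and> ev1 I (\<lambda>a. a) e p = f)"
definition tm_of where "tm_of \<phi> = (SOME t. wf_tm P t \<and> ev2 I (\<lambda>a. a) e g t = \<phi>)"

fun H0 where "H0 (b, c) = K0 (b @ [c])"

fun H1 where
  "H1 (LArr f c) = ev1 Y (A0 c) (A1 c) (path_of f)"
| "H1 (RArr b h) = r h b"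

fun H2 where
  "H2 (LCell \<phi> c) = ev2 Y (A0 c) (A1 c) (A2 c) (tm_of \<phi>)"
| "H2 (RCell b \<psi>) = cell \<psi> b"
| "H2 (Gam f h) = \<Gamma> h (path_of f)"

lemma path_of: "is_path P p \<Longrightarrow> cong1 P p (path_of (ev1 I (\<lambda>a. a) e p))"
  using someI[of "\<lambda>q. is_path P q \<and> ev1 I (\<lambda>a. a) e q = ev1 I (\<lambda>a. a) e p" p] J.complete1[of p]
  by (simp add: path_of_def)

lemma tm_of: "wf_tm P t \<Longrightarrow> cong2 P t (tm_of (ev2 I (\<lambda>a. a) e g t))"
  using someI[of "\<lambda>s. wf_tm P s \<and> ev2 I (\<lambda>a. a) e g s = ev2 I (\<lambda>a. a) e g t" t] J.complete2[of t]
  by (simp add: tm_of_def)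

lemma H1_L [simp]:
  assumes "is_path P p" "c \<in> Obj (C n)"
  shows "H1 (LArr (ev1 I (\<lambda>a. a) e p) c) = ev1 Y (A0 c) (A1 c) p"
  using model.ev1_cong[OF A_model path_of] assms by simp

lemma H2_L [simp]:
  assumes "wf_tm P t" "c \<in> Obj (C n)"
  shows "H2 (LCell (ev2 I (\<lambda>a. a) e g t) c) = ev2 Y (A0 c) (A1 c) (A2 c) t"
  using model.ev2_cong[OF A_model tm_of] assms by simp

lemma H2_\<gamma> [simp]:
  assumes "is_path P p" "h \<in> Arr (C n)"
  shows "H2 (Gam (ev1 I (\<lambda>a. a) e p) h) = \<Gamma> h p"
  using lax_transformation.lax_ev_cong[OF lax_transformation path_of] assms by simp

declare H1.simps(1) [simp del] H2.simps(1) [simp del] H2.simps(3) [simp del]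

lemma I_arrE:
  assumes "f \<in> Arr I"
  obtains p where "is_path P p" "f = ev1 I (\<lambda>a. a) e p"
  using assms J.surj1 by metis

lemma I_cellE:
  assumes "\<phi> \<in> Cell I"
  obtains t where "wf_tm P t" "\<phi> = ev2 I (\<lambda>a. a) e g t"
  using assms J.surj2 by metis

lemma H_edge:
  assumes "x \<in> P1 Q.Q"
  shows "H1 x \<in> Arr Y \<and> src Y (H1 x) = H0 (esrc Q.Q x) \<and> tgt Y (H1 x) = H0 (etgt Q.Q x)"
proof (cases x)
  case (LArr f c)
  with assms have fc: "f \<in> Arr I" "c \<in> Obj (C n)" by auto
  then obtain p where p: "is_path P p" "f = ev1 I (\<lambda>a. a) e p"
    by (auto elim: I_arrE)
  show ?thesis
    using LArr fc p model.ev1_type[OF A_model[OF fc(2)] p(1)] by simp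
next
  case (RArr b h)
  with assms show ?thesis by auto
qed

lemma H_single [simp]:
  "f \<in> Arr I \<Longrightarrow> c \<in> Obj (C n) \<Longrightarrow> ev1 Y H0 H1 (lpath I f c) = H1 (LArr f c)"
  "h \<in> Arr (C n) \<Longrightarrow> b \<in> tuples C n \<Longrightarrow> ev1 Y H0 H1 (rpath (C n) b h) = H1 (RArr b h)"
  using H_edge[of "LArr f c"] H_edge[of "RArr b h"]
  by (simp_all add: lpath_def rpath_def)

lemma H_double [simp]:
  assumes "f \<in> Arr I" "h \<in> Arr (C n)" "c \<in> Obj (C n)" "b \<in> tuples C n"
  shows "c = tgt (C n) h \<Longrightarrow> b = src I f \<Longrightarrow>
      ev1 Y H0 H1 (lpath I f c \<cdot>\<^sub>p rpath (C n) b h) = H1 (LArr f c) \<star> H1 (RArr b h)"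
    "c = src (C n) h \<Longrightarrow> b = tgt I f \<Longrightarrow>
      ev1 Y H0 H1 (rpath (C n) b h \<cdot>\<^sub>p lpath I f c) = H1 (RArr b h) \<star> H1 (LArr f c)"
  using H_edge[of "LArr f c"] H_edge[of "RArr b h"] assms
  by (simp_all add: lpath_def rpath_def)

lemma H_gen:
  assumes "x \<in> P2 Q.Q"
  shows "H2 x \<in> Cell Y \<and> dom2 Y (H2 x) = ev1 Y H0 H1 (gdom Q.Q x)
    \<and> cod2 Y (H2 x) = ev1 Y H0 H1 (gcod Q.Q x)"
proof (cases x)
  case (LCell \<phi> c)
  with assms have fc: "\<phi> \<in> Cell I" "c \<in> Obj (C n)" by auto
  then obtain t where t: "wf_tm P t" "\<phi> = ev2 I (\<lambda>a. a) e g t"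
    by (auto elim: I_cellE)
  show ?thesis
    using LCell fc t model.ev2_type[OF A_model[OF fc(2)] t(1)] by simp
next
  case (RCell b \<psi>)
  with assms show ?thesis by auto
next
  case (Gam f h)
  with assms have fc: "f \<in> Arr I" "h \<in> Arr (C n)" by auto
  then obtain p where p: "is_path P p" "f = ev1 I (\<lambda>a. a) e p"
    by (auto elim: I_arrE)
  show ?thesis
    using Gam fc p lax_data.lax_ev_type[OF lax_data[OF fc(2)] p(1)] by simp
qed

lemma H_rel1:
  assumes "gray_rel1 I (C n) p q"
  shows "ev1 Y H0 H1 p = ev1 Y H0 H1 q"
  using assms
proof cases
  case (left_comp f1 f2 c)
  then obtain p1 p2 where p: "is_path P p1" "f1 = ev1 I (\<lambda>a. a) e p1"
    "is_path P p2" "f2 = ev1 I (\<lambda>a. a) e p2"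
    by (auto elim!: I_arrE)
  interpret A: model Y P "A0 c" "A1 c" "A2 c" by (rule A_model) fact
  have "f1 \<star>\<^bsub>I\<^esub> f2 = ev1 I (\<lambda>a. a) e (p1 \<cdot>\<^sub>p p2)" "psrc p1 = ptgt P p2"
    using p left_comp by simp_all
  then show ?thesis
    using left_comp p H1_L[of "p1 \<cdot>\<^sub>p p2" c] H_edge[of "LArr f1 c"] H_edge[of "LArr f2 c"]
    by (simp add: lpath_def)
next
  case (right_comp h1 h2 b)
  then show ?thesis
    using K_rel1[OF multi_rel1.comp[of C "Suc n" n h2 "b @ [src (C n) h2]" h1]]
    by (simp add: rpath_def r_def)
next
  case (left_id b c)
  then show ?thesis
    using H1_L[of "([], b)" c] by simp
next
  case (right_id b c)
  then show ?thesis
    using K_rel1[OF multi_rel1.id[of "b @ [c]" C "Suc n" n]] by (simp add: r_def)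
qed

text \<open>
  A 2-cell \<open>\<psi>\<close> of the last factor is a modification between the lax transformations that belong to
  its domain and its codomain: at edges this is naturality of \<open>\<gamma>\<close> with an identity in the other
  factor.
\<close>

lemma modification:
  assumes "\<psi> \<in> Cell (C n)" "is_path P p"
  shows "\<Gamma> (cod2 (C n) \<psi>) p \<bullet> (\<iota> (ev1 Y (A0 (tgt0 (C n) \<psi>)) (A1 (tgt0 (C n) \<psi>)) p) \<diamondop> cell \<psi> (psrc p))
    = (cell \<psi> (ptgt P p) \<diamondop> \<iota> (ev1 Y (A0 (src0 (C n) \<psi>)) (A1 (src0 (C n) \<psi>)) p)) \<bullet> \<Gamma> (dom2 (C n) \<psi>) p"
proof -
  let ?c = "src (C n) (dom2 (C n) \<psi>)" and ?c' = "tgt (C n) (dom2 (C n) \<psi>)"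
  let ?d = "dom2 (C n) \<psi>" and ?d' = "cod2 (C n) \<psi>"
  have [simp]: "?d \<in> Arr (C n)" "?d' \<in> Arr (C n)" "src (C n) ?d' = ?c" "tgt (C n) ?d' = ?c'"
    using assms(1) by simp_all
  have edge: "\<gamma> ?d' x \<bullet> (\<iota> (A1 ?c' x) \<diamondop> cell \<psi> (esrc P x))
      = (cell \<psi> (etgt P x) \<diamondop> \<iota> (A1 ?c x)) \<bullet> \<gamma> ?d x" if "x \<in> P1 P" for x
  proof (cases x)
    case (MArr i f b)
    with that assms(1) show ?thesis
      using K_rel2(1)[OF multi_rel2.gam_natural[of i n C "Suc n" "id2 (C i) f" "b @ [?c]" \<psi>]]
        K_rel2(1)[OF multi_rel2.id2[of C "Suc n" i f "b @ [?c]"]]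
        K_rel2(1)[OF multi_rel2.id2[of C "Suc n" i f "b @ [?c']"]]
      by (simp add: cell_def)
  qed
  show ?thesis
    using lax_ev_modification[OF lax_data[of ?d] lax_data[of ?d', simplified], of "cell \<psi>" p]
      assms edge by simp
qed

lemma H_rel2:
  assumes "gray_rel2 I (C n) s t"
  shows "ev2 Y H0 H1 H2 s = ev2 Y H0 H1 H2 t"
  using assms
proof cases
  case (left_vcomp \<phi>1 \<phi>2 c)
  then obtain t1 t2 where t: "wf_tm P t1" "\<phi>1 = ev2 I (\<lambda>a. a) e g t1"
    "wf_tm P t2" "\<phi>2 = ev2 I (\<lambda>a. a) e g t2"
    by (auto elim!: I_cellE)
  then have "wf_tm P (VC t1 t2)"
    using left_vcomp J.complete1[of "tdom P t1" "tcod P t2"] by simp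
  then show ?thesis
    using left_vcomp t H2_L[of "VC t1 t2" c] by simp
next
  case (left_hcomp \<phi>1 \<phi>2 c)
  then obtain t1 t2 where t: "wf_tm P t1" "\<phi>1 = ev2 I (\<lambda>a. a) e g t1"
    "wf_tm P t2" "\<phi>2 = ev2 I (\<lambda>a. a) e g t2"
    by (auto elim!: I_cellE)
  then have "wf_tm P (HC t1 t2)"
    using left_hcomp by simp
  then show ?thesis
    using left_hcomp t H2_L[of "HC t1 t2" c] by simp
next
  case (left_id2 f c)
  then obtain p where p: "is_path P p" "f = ev1 I (\<lambda>a. a) e p"
    by (auto elim: I_arrE)
  then show ?thesis
    using left_id2 H2_L[of "Idt p" c] by simp
next
  case (right_vcomp \<psi>1 \<psi>2 b)
  then show ?thesis
    using K_rel2(1)[OF multi_rel2.vcomp[of C "Suc n" n \<psi>2 "b @ [src0 (C n) \<psi>2]" \<psi>1]]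
    by (simp add: cell_def)
next
  case (right_hcomp \<psi>1 \<psi>2 b)
  then show ?thesis
    using K_rel2(1)[OF multi_rel2.hcomp[of C "Suc n" n \<psi>2 "b @ [src0 (C n) \<psi>2]" \<psi>1]]
    by (simp add: cell_def)
next
  case (right_id2 h b)
  then show ?thesis
    using K_rel2(1)[OF multi_rel2.id2[of C "Suc n" n h "b @ [src (C n) h]"]]
    by (simp add: cell_def r_def)
next
  case (gam_id_right f c)
  then obtain p where p: "is_path P p" "f = ev1 I (\<lambda>a. a) e p"
    by (auto elim: I_arrE)
  have "\<Gamma> (id1 (C n) c) p = \<iota> (ev1 Y (A0 c) (A1 c) p)"
  proof -
    have "r (id1 (C n) c) b = id1 Y (A0 c b)" if "b \<in> tuples C n" for b
      using that gam_id_right K_rel1[OF multi_rel1.id[of "b @ [c]" C "Suc n" n]]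
      by (simp add: r_def)
    moreover have "\<gamma> (id1 (C n) c) x = \<iota> (A1 c x)" if "x \<in> P1 P" for x
    proof (cases x)
      case (MArr i f' b)
      with that gam_id_right show ?thesis
        using K_rel2(1)[OF multi_rel2.gam_id_right[of i n "Suc n" C f' "b @ [c]"]] by simp
    qed
    ultimately show ?thesis
      using lax_ev_identity[OF A_model[of c] p(1), of "r (id1 (C n) c)" "\<gamma> (id1 (C n) c)"]
        gam_id_right by simp
  qed
  then show ?thesis
    using gam_id_right p by simp
next
  case (gam_id_left h b)
  then show ?thesis
    using H2_\<gamma>[of "([], b)" h] by simp
next
  case (gam_comp_left f1 f2 h)
  then obtain p1 p2 where p: "is_path P p1" "f1 = ev1 I (\<lambda>a. a) e p1"
    "is_path P p2" "f2 = ev1 I (\<lambda>a. a) e p2"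
    by (auto elim!: I_arrE)
  have "f1 \<star>\<^bsub>I\<^esub> f2 = ev1 I (\<lambda>a. a) e (p1 \<cdot>\<^sub>p p2)" "psrc p1 = ptgt P p2"
    using p gam_comp_left by simp_all
  then show ?thesis
    using gam_comp_left p lax_data.lax_ev_pcat[OF lax_data[of h], of p1 p2] H2_\<gamma>[of "p1 \<cdot>\<^sub>p p2" h]
    by simp
next
  case (gam_comp_right f h1 h2)
  then obtain p where p: "is_path P p" "f = ev1 I (\<lambda>a. a) e p"
    by (auto elim: I_arrE)
  have obj: "r (h1 \<star>\<^bsub>C n\<^esub> h2) b = r h1 b \<star> r h2 b" if "b \<in> tuples C n" for b
    using that gam_comp_right
      K_rel1[OF multi_rel1.comp[of C "Suc n" n h2 "b @ [src (C n) h2]" h1]]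
    by (simp add: r_def)
  have edge: "\<gamma> (h1 \<star>\<^bsub>C n\<^esub> h2) x
      = (\<iota> (r h1 (etgt P x)) \<diamondop> \<gamma> h2 x) \<bullet> (\<gamma> h1 x \<diamondop> \<iota> (r h2 (esrc P x)))" if "x \<in> P1 P" for x
  proof (cases x)
    case (MArr i f' b)
    with that gam_comp_right show ?thesis
      using K_rel2(1)[OF multi_rel2.gam_comp_right[of i n C "Suc n" f' "b @ [src (C n) h2]" h2 h1]]
      by (simp add: r_def)
  qed
  have "\<Gamma> (h1 \<star>\<^bsub>C n\<^esub> h2) p
      = (\<iota> (r h1 (ptgt P p)) \<diamondop> \<Gamma> h2 p) \<bullet> (\<Gamma> h1 p \<diamondop> \<iota> (r h2 (psrc p)))"
    using gam_comp_right p(1) obj edge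
      lax_ev_compose[OF lax_data[of h2] lax_data[of h1, unfolded gam_comp_right(6)],
        of "r (h1 \<star>\<^bsub>C n\<^esub> h2)" "\<gamma> (h1 \<star>\<^bsub>C n\<^esub> h2)" p]
    by simp
  then show ?thesis
    using gam_comp_right p by simp
next
  case (gam_natural \<phi> \<psi>)
  then obtain t where t: "wf_tm P t" "\<phi> = ev2 I (\<lambda>a. a) e g t"
    by (auto elim: I_cellE)
  let ?d = "dom2 (C n) \<psi>" and ?d' = "cod2 (C n) \<psi>"
  let ?c = "src (C n) ?d" and ?c' = "tgt (C n) ?d"
  let ?p = "tdom P t" and ?q = "tcod P t"
  let ?\<phi> = "ev2 Y (A0 ?c) (A1 ?c) (A2 ?c) t" and ?\<phi>' = "ev2 Y (A0 ?c') (A1 ?c') (A2 ?c') t"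
  let ?f = "ev1 Y (A0 ?c) (A1 ?c)" and ?f' = "ev1 Y (A0 ?c') (A1 ?c')"
  let ?a = "psrc ?p" and ?b = "ptgt P ?p"
  have [simp]: "\<psi> \<in> Cell (C n)" "src (C n) ?d' = ?c" "tgt (C n) ?d' = ?c'"
    "?c \<in> Obj (C n)" "?c' \<in> Obj (C n)" "?d \<in> Arr (C n)" "?d' \<in> Arr (C n)" "wf_tm P t"
    using gam_natural t by simp_all
  interpret A: model Y P "A0 ?c" "A1 ?c" "A2 ?c" by (rule A_model) simp
  interpret A': model Y P "A0 ?c'" "A1 ?c'" "A2 ?c'" by (rule A_model) simp
  interpret L: lax_transformation Y P "A0 ?c" "A1 ?c" "A2 ?c" "A0 ?c'" "A1 ?c'" "A2 ?c'" "r ?d'" "\<gamma> ?d'"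
    using lax_transformation[of ?d'] by simp
  interpret L0: lax_data Y P "A0 ?c" "A1 ?c" "A2 ?c" "A0 ?c'" "A1 ?c'" "A2 ?c'" "r ?d" "\<gamma> ?d"
    by (rule lax_data) simp
  \<comment> \<open>The horizontal composite is split, so that first \<phi> passes by naturality of the lax
    transformation and then \<psi> passes by the modification property.\<close>
  have "L.\<Gamma> ?q \<bullet> (?\<phi>' \<diamondop> cell \<psi> ?a)
      = L.\<Gamma> ?q \<bullet> ((?\<phi>' \<diamondop> \<iota> (r ?d' ?a)) \<bullet> (\<iota> (?f' ?p) \<diamondop> cell \<psi> ?a))"
    by (subst K.Y.hcomp_split(1)) simp_all
  also have "\<dots> = (\<iota> (r ?d' ?b) \<diamondop> ?\<phi>) \<bullet> (L.\<Gamma> ?p \<bullet> (\<iota> (?f' ?p) \<diamondop> cell \<psi> ?a))"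
    using L.lax_ev_natural[of t] by (simp flip: K.Y.vcomp_assoc)
  also have "L.\<Gamma> ?p \<bullet> (\<iota> (?f' ?p) \<diamondop> cell \<psi> ?a) = (cell \<psi> ?b \<diamondop> \<iota> (?f ?p)) \<bullet> L0.\<Gamma> ?p"
    using modification[of \<psi> ?p] by simp
  also have "(\<iota> (r ?d' ?b) \<diamondop> ?\<phi>) \<bullet> \<dots> = ((\<iota> (r ?d' ?b) \<diamondop> ?\<phi>) \<bullet> (cell \<psi> ?b \<diamondop> \<iota> (?f ?p))) \<bullet> L0.\<Gamma> ?p"
    by (simp add: K.Y.vcomp_assoc)
  also have "(\<iota> (r ?d' ?b) \<diamondop> ?\<phi>) \<bullet> (cell \<psi> ?b \<diamondop> \<iota> (?f ?p)) = cell \<psi> ?b \<diamondop> ?\<phi>"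
    by (rule K.Y.hcomp_split(2)) simp_all
  finally show ?thesis
    using gam_natural t by simp
qed

lemma model_back: "model Y Q.Q H0 H1 H2"
proof
  fix a
  assume "a \<in> P0 Q.Q"
  then show "H0 a \<in> Obj Y" by auto
qed (use H_edge H_gen H_rel1 H_rel2 in simp_all)

text \<open>
  The functor induced by \<open>H\<close> carries the forward model to \<open>K\<close>.  It is enough to compare the two on
  generators.
\<close>

lemma back_forward:
  "strict_2functor Z Y H0 (\<lambda>A. ev1 Y H0 H1 (rep A)) (\<lambda>S. ev2 Y H0 H1 H2 (rep S))"
  "is_path P' p \<Longrightarrow> ev1 Y K0 K1 p = ev1 Y H0 H1 (rep (ev1 Z fwd0 fwd1 p))"
  "wf_tm P' t \<Longrightarrow> ev2 Y K0 K1 K2 t = ev2 Y H0 H1 H2 (rep (ev2 Z fwd0 fwd1 fwd2 t))"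
proof -
  interpret H: model Y Q.Q H0 H1 H2 by (rule model_back)
  show T: "strict_2functor Z Y H0 (\<lambda>A. ev1 Y H0 H1 (rep A)) (\<lambda>S. ev2 Y H0 H1 H2 (rep S))"
    unfolding gray_def by (rule H.induced_functor)
  interpret T: strict_2functor Z Y H0 "\<lambda>A. ev1 Y H0 H1 (rep A)" "\<lambda>S. ev2 Y H0 H1 H2 (rep S)"
    by (rule T)
  interpret F: model Z P' fwd0 fwd1 fwd2 by (rule model_forward)
  interpret model_image Z P' fwd0 fwd1 fwd2 Y H0 "\<lambda>A. ev1 Y H0 H1 (rep A)"
    "\<lambda>S. ev2 Y H0 H1 H2 (rep S)" K0 K1 K2
  proof
    fix a
    assume "a \<in> P0 P'"
    then show "K0 a = H0 (fwd0 a)"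
      by (auto elim: tuples_SucE)
  next
    fix x
    assume "x \<in> P1 P'"
    then show "K1 x = ev1 Y H0 H1 (rep (fwd1 x))"
    proof (cases rule: edge_SucE)
      case (old c y)
      then obtain i f b where y: "y = MArr i f b" "arr_at C n i f b"
        by (cases y) simp
      have "is_path P (mpath i f b)" using y by simp
      then have "H1 (LArr (e (MArr i f b)) c) = K1 (MArr i f (b @ [c]))"
        using H1_L[of "mpath i f b" c] old y model.ev1_single[OF A_model, of c "MArr i f b"]
        by (simp add: mpath_def)
      then show ?thesis
        using old y by simp
    next
      case (new b f)
      then show ?thesis by (simp add: r_def)
    qed
  next
    fix x
    assume "x \<in> P2 P'"
    then show "K2 x = ev2 Y H0 H1 H2 (rep (fwd2 x))"
    proof (cases rule: gen_SucE)
      case (old c y)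
      then have "fwd2 x = Q.L2 (g y) c"
        by (cases y) simp_all
      then show ?thesis
        using old H2_L[of "Gen y" c] J.gen[of y] by simp
    next
      case (cell b \<phi>)
      then show ?thesis by (simp add: gray_back.cell_def[OF gray_back_axioms])
    next
      case (gam i f h b)
      have "is_path P (mpath i f b)" using gam by simp
      then have "H2 (Gam (e (MArr i f b)) h) = K2 (MGam i n f h (b @ [src (C n) h]))"
        using H2_\<gamma>[of "mpath i f b" h] gam lax_data.lax_ev_single[OF lax_data, of h "MArr i f b"]
        by (simp add: mpath_def)
      then show ?thesis
        using gam by simp
    qed
  qed
  show "is_path P' p \<Longrightarrow> ev1 Y K0 K1 p = ev1 Y H0 H1 (rep (ev1 Z fwd0 fwd1 p))"
    by (rule ev1_image)
  show "wf_tm P' t \<Longrightarrow> ev2 Y K0 K1 K2 t = ev2 Y H0 H1 H2 (rep (ev2 Z fwd0 fwd1 fwd2 t))"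
    by (rule ev2_image)
qed

end


section \<open>The induction step\<close>

context gray_step
begin

text \<open>
  For \<open>K\<close> take the tautological model of \<open>P'\<close>.  Equal values of the forward model have equal images
  under the functor back, and these images are the classes.
\<close>

lemma complete:
  "\<lbrakk>is_path P' p; is_path P' q; ev1 Z fwd0 fwd1 p = ev1 Z fwd0 fwd1 q\<rbrakk> \<Longrightarrow> cong1 P' p q"
  "\<lbrakk>wf_tm P' s; wf_tm P' t; ev2 Z fwd0 fwd1 fwd2 s = ev2 Z fwd0 fwd1 fwd2 t\<rbrakk> \<Longrightarrow> cong2 P' s t"
proof -
  interpret K: gray_back C n I e g "presented P'" "\<lambda>a. a" "\<lambda>x. cls1 P' ([x], esrc P' x)"
    "\<lambda>x. cls2 P' (Gen x)"
    by (intro gray_back.intro gray_step_axioms tautological_model)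
  show "\<lbrakk>is_path P' p; is_path P' q; ev1 Z fwd0 fwd1 p = ev1 Z fwd0 fwd1 q\<rbrakk> \<Longrightarrow> cong1 P' p q"
    using K.back_forward(2)[of p] K.back_forward(2)[of q]
    by (simp add: ev1_tautological flip: cls1_eq_iff)
  show "\<lbrakk>wf_tm P' s; wf_tm P' t; ev2 Z fwd0 fwd1 fwd2 s = ev2 Z fwd0 fwd1 fwd2 t\<rbrakk> \<Longrightarrow> cong2 P' s t"
    using K.back_forward(3)[of s] K.back_forward(3)[of t]
    by (simp add: ev2_tautological flip: cls2_eq_iff)
qed

lemma fwd0_bij: "bij_betw fwd0 (P0 P') (Obj Z)"
proof (rule bij_betw_byWitness[where f' = "\<lambda>(b, c). b @ [c]"])
  show "\<forall>a\<in>P0 P'. (case fwd0 a of (b, c) \<Rightarrow> b @ [c]) = a"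
    by (auto elim: tuples_SucE)
  show "fwd0 ` P0 P' \<subseteq> Obj Z"
    by (auto elim: tuples_SucE)
qed auto

lemma fwd0_inj: "a \<in> tuples C (Suc n) \<Longrightarrow> a' \<in> tuples C (Suc n) \<Longrightarrow> fwd0 a = fwd0 a' \<Longrightarrow> a = a'"
  using fwd0_bij by (auto simp: bij_betw_def dest: inj_onD)

interpretation F: model Z P' fwd0 fwd1 fwd2
  by (rule model_forward)

lemma fwd_edge:
  assumes "x \<in> P1 Q.Q"
  shows "\<exists>p. is_path P' p \<and> ev1 Z fwd0 fwd1 p = cls1 Q.Q ([x], esrc Q.Q x)"
proof (cases x)
  case (LArr f c)
  with assms obtain p where "is_path P p" "ev1 I (\<lambda>a. a) e p = f" "c \<in> Obj (C n)"
    using J.surj1[of f] by auto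
  then show ?thesis
    using LArr is_path_snoc[of c p] fwd_snoc(1)[of c p]
    by (intro exI[of _ "snoc_path c p"]) (simp add: lpath_def)
next
  case (RArr b h)
  with assms show ?thesis
    by (intro exI[of _ "mpath n h (b @ [src (C n) h])"]) (simp add: rpath_def)
qed

lemma fwd_surj1:
  assumes "A \<in> Arr Z"
  shows "\<exists>p. is_path P' p \<and> ev1 Z fwd0 fwd1 p = A"
proof -
  have "\<exists>p. is_path P' p \<and> ev1 Z fwd0 fwd1 p = cls1 Q.Q q" if "is_path Q.Q q" for q
    using that
  proof (induction q rule: is_path_induct)
    case (Nil a)
    then show ?case
      by (intro exI[of _ "([], fst a @ [snd a])"]) auto
  next
    case (Cons x es a)
    obtain p0 where p0: "is_path P' p0" "ev1 Z fwd0 fwd1 p0 = cls1 Q.Q ([x], esrc Q.Q x)"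
      using fwd_edge Cons by blast
    obtain p where p: "is_path P' p" "ev1 Z fwd0 fwd1 p = cls1 Q.Q (es, a)"
      using Cons by blast
    have x: "is_path Q.Q ([x], esrc Q.Q x)" "is_path Q.Q (es, a)" "esrc Q.Q x = ptgt Q.Q (es, a)"
      using Cons Q.esrc_obj[of x] by simp_all
    have "fwd0 (psrc p0) = src Z (ev1 Z fwd0 fwd1 p0)" "fwd0 (ptgt P' p) = tgt Z (ev1 Z fwd0 fwd1 p)"
      using p0(1) p(1) by simp_all
    then have "psrc p0 = ptgt P' p"
      using p0 p x by (intro fwd0_inj) simp_all
    then show ?case
      using p0 p x Q.gray_pcat[of "([x], esrc Q.Q x)" "(es, a)"]
      by (intro exI[of _ "p0 \<cdot>\<^sub>p p"]) simp
  qed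
  then show ?thesis
    using assms unfolding gray_def by (auto elim: Q.presented_arrE)
qed

text \<open>
  Surjectivity on 2-cells is an induction over the formal 2-cells of the Gray product.  Preimages of
  composable cells are composable themselves by completeness and by injectivity on objects.
\<close>

definition reached where
  "reached \<alpha> \<longleftrightarrow> (\<exists>t. wf_tm P' t \<and> ev2 Z fwd0 fwd1 fwd2 t = \<alpha>)"

lemma reachedI: "wf_tm P' t \<Longrightarrow> ev2 Z fwd0 fwd1 fwd2 t = \<alpha> \<Longrightarrow> reached \<alpha>"
  by (auto simp: reached_def)

lemma reached_id2:
  assumes "A \<in> Arr Z"
  shows "reached (\<iota>\<^bsub>Z\<^esub> A)"
proof -
  obtain p where "is_path P' p" "ev1 Z fwd0 fwd1 p = A"
    using fwd_surj1[OF assms] by blast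
  then show ?thesis by (intro reachedI[of "Idt p"]) simp_all
qed

lemma reached_vcomp:
  assumes "reached \<beta>" "reached \<alpha>" "dom2 Z \<beta> = cod2 Z \<alpha>"
  shows "reached (\<beta> \<bullet>\<^bsub>Z\<^esub> \<alpha>)"
proof -
  obtain s t where "wf_tm P' s" "ev2 Z fwd0 fwd1 fwd2 s = \<beta>" "wf_tm P' t" "ev2 Z fwd0 fwd1 fwd2 t = \<alpha>"
    using assms(1,2) unfolding reached_def by blast
  then show ?thesis
    using assms(3) by (intro reachedI[of "VC s t"]) (auto intro: complete(1))
qed

lemma reached_hcomp:
  assumes "reached \<beta>" "reached \<alpha>" "src Z (dom2 Z \<beta>) = tgt Z (dom2 Z \<alpha>)"
  shows "reached (\<beta> \<diamondop>\<^bsub>Z\<^esub> \<alpha>)"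
proof -
  obtain s t where st: "wf_tm P' s" "ev2 Z fwd0 fwd1 fwd2 s = \<beta>" "wf_tm P' t" "ev2 Z fwd0 fwd1 fwd2 t = \<alpha>"
    using assms(1,2) unfolding reached_def by blast
  then have "psrc (tdom P' s) = ptgt P' (tdom P' t)"
    using assms(3) by (intro fwd0_inj) auto
  with st show ?thesis
    by (intro reachedI[of "HC s t"]) simp_all
qed

text \<open>
  The \<open>\<gamma>\<close> of an arbitrary 1-cell is pasted from those of the edges of a path.
\<close>

lemma reached_\<gamma>:
  assumes "is_path P p" "h \<in> Arr (C n)"
  shows "reached (Q.\<gamma> (ev1 I (\<lambda>a. a) e p) h)"
  using assms(1)
proof (induction p rule: is_path_induct)
  case (Nil b)
  then show ?case
    using assms(2) by (simp add: Q.\<gamma>_id_left reached_id2)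
next
  case (Cons y es a)
  let ?f = "ev1 I (\<lambda>a. a) e (es, a)"
  have y: "e y \<in> Arr I" "src I (e y) = ptgt P (es, a)" "?f \<in> Arr I"
    "src I ?f = psrc (es, a)" "tgt I ?f = ptgt P (es, a)" "ptgt P (es, a) \<in> tuples C n"
    "a \<in> tuples C n"
    using Cons P.path_tuples[of "(es, a)"] by simp_all
  have "reached (Q.\<gamma> (e y) h)"
  proof (cases y)
    case (MArr i f b)
    then show ?thesis
      using Cons(1) assms(2) by (intro reachedI[of "mgam i n f h (b @ [src (C n) h])"]) simp_all
  qed
  then show ?case
    using Cons.IH assms(2) y
    by (auto simp: Q.\<gamma>_comp_left intro!: reached_vcomp reached_hcomp reached_id2)
qed

lemma fwd_surj2:
  assumes "S \<in> Cell Z"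
  shows "\<exists>t. wf_tm P' t \<and> ev2 Z fwd0 fwd1 fwd2 t = S"
proof -
  have "reached (cls2 Q.Q u)" if "wf_tm Q.Q u" for u
    using that
  proof (induction u)
    case (Gen x)
    show ?case
    proof (cases x)
      case (LCell \<phi> c)
      with Gen obtain t where "wf_tm P t" "ev2 I (\<lambda>a. a) e g t = \<phi>" "c \<in> Obj (C n)"
        using J.surj2[of \<phi>] by auto
      then show ?thesis
        using LCell wf_tm_snoc[of c t] fwd_snoc(2)[of c t]
        by (intro reachedI[of "snoc_tm c t"]) simp_all
    next
      case (RCell b \<psi>)
      then show ?thesis
        using Gen by (intro reachedI[of "mcell n \<psi> (b @ [src0 (C n) \<psi>])"]) simp_all
    next
      case (Gam f h)
      with Gen obtain p where "is_path P p" "ev1 I (\<lambda>a. a) e p = f" "h \<in> Arr (C n)"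
        using J.surj1[of f] by auto
      then show ?thesis
        using Gam reached_\<gamma> by blast
    qed
  next
    case (Idt q)
    then have "cls2 Q.Q (Idt q) = \<iota>\<^bsub>Z\<^esub> (cls1 Q.Q q)" "cls1 Q.Q q \<in> Arr Z"
      by (simp_all add: gray_def)
    then show ?case by (simp only: reached_id2)
  next
    case (VC u v)
    then have "cls2 Q.Q (VC u v) = cls2 Q.Q u \<bullet>\<^bsub>Z\<^esub> cls2 Q.Q v"
      "dom2 Z (cls2 Q.Q u) = cod2 Z (cls2 Q.Q v)"
      by (simp_all add: gray_def Q.cls1_eq_iff)
    with VC show ?case by (simp add: reached_vcomp)
  next
    case (HC u v)
    then have "cls2 Q.Q (HC u v) = cls2 Q.Q u \<diamondop>\<^bsub>Z\<^esub> cls2 Q.Q v"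
      "src Z (dom2 Z (cls2 Q.Q u)) = tgt Z (dom2 Z (cls2 Q.Q v))"
      by (simp_all add: gray_def)
    with HC show ?case by (simp add: reached_hcomp)
  qed
  then show ?thesis
    using assms unfolding gray_def reached_def by (auto elim!: Q.presented_cellE)
qed

lemma gray_presents: "presents Z P' fwd0 fwd1 fwd2"
  by unfold_locales (fact fwd0_bij complete fwd_surj1 fwd_surj2)+

end


section \<open>A single factor\<close>

lemma tuples_single: "a \<in> tuples C (Suc 0) \<longleftrightarrow> (\<exists>x. a = [x] \<and> x \<in> Obj (C 0))"
  by (auto simp: tuples_def length_Suc_conv)

locale single_factor = family C "Suc 0" for C :: "nat \<Rightarrow> ('o, 'a, 't) two_cat"
begin

sublocale D: strict_2category "C 0"
  by (simp add: factor)

fun base1 :: "('o, 'a) multi_edge \<Rightarrow> 'a" where "base1 (MArr i f a) = f"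

text \<open>
  With a single factor there is no pair $i < j$, hence no generator \<open>MGam\<close>.
\<close>

primrec base2 :: "('o, 'a, 't) multi_gen \<Rightarrow> 't" where
  "base2 (MCell i \<phi> a) = \<phi>"
| "base2 (MGam i j f g a) = undefined"

lemma hd_inj: "a \<in> tuples C (Suc 0) \<Longrightarrow> b \<in> tuples C (Suc 0) \<Longrightarrow> hd a = hd b \<Longrightarrow> a = b"
  by (auto simp: tuples_single)

lemma single_simps [simp]:
  "a \<in> tuples C (Suc 0) \<Longrightarrow> a ! 0 = hd a" "a \<in> tuples C (Suc 0) \<Longrightarrow> a[0 := x] = [x]"
  "a \<in> tuples C (Suc 0) \<Longrightarrow> [hd a] = a" "a \<in> tuples C (Suc 0) \<Longrightarrow> hd a \<in> Obj (C 0)"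
  "[x] \<in> tuples C (Suc 0) \<longleftrightarrow> x \<in> Obj (C 0)"
  by (auto simp: tuples_single)

lemma base_single [simp]:
  "arr_at C (Suc 0) 0 f a \<Longrightarrow> ev1 (C 0) hd base1 (mpath 0 f a) = f"
  by (auto simp: mpath_def tuples_single)

sublocale B: model "C 0" M hd base1 base2
proof
  fix x
  assume "x \<in> P1 M"
  then show "base1 x \<in> Arr (C 0) \<and> src (C 0) (base1 x) = hd (esrc M x) \<and> tgt (C 0) (base1 x) = hd (etgt M x)"
    by (cases x) auto
next
  fix x
  assume "x \<in> P2 M"
  then show "base2 x \<in> Cell (C 0) \<and> dom2 (C 0) (base2 x) = ev1 (C 0) hd base1 (gdom M x)
      \<and> cod2 (C 0) (base2 x) = ev1 (C 0) hd base1 (gcod M x)"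
    by (cases x) auto
next
  fix p q
  assume "rel1 M p q"
  then show "ev1 (C 0) hd base1 p = ev1 (C 0) hd base1 q"
    unfolding multi_presentation_simps by cases (auto simp: mpath_def)
next
  fix s t
  assume "rel2 M s t"
  then show "ev2 (C 0) hd base1 base2 s = ev2 (C 0) hd base1 base2 t"
    unfolding multi_presentation_simps by cases auto
qed simp

text \<open>
  The relations merge consecutive edges and turn the empty path into an identity edge; so a path
  reduces to a single edge, which its value and its source determine.
\<close>

lemma path_normal_form:
  "is_path M p \<Longrightarrow> cong1 M p (mpath 0 (ev1 (C 0) hd base1 p) (psrc p))"
proof (induction p rule: is_path_induct)
  case (Nil a)
  then show ?case
    using multi_cong1(2)[of a 0 "hd a"] by (simp add: cong1.sym)
next
  case (Cons x es a)
  obtain i f b where x: "x = MArr i f b" by (cases x)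
  let ?h = "ev1 (C 0) hd base1 (es, a)"
  have x': "i = 0" "f \<in> Arr (C 0)" "b \<in> tuples C (Suc 0)" "hd b = src (C 0) f" "b = ptgt M (es, a)"
    "a \<in> tuples C (Suc 0)"
    using Cons x psrc_obj[of "(es, a)"] by auto
  have b: "ptgt M (es, a) = [src (C 0) f]"
    using x' single_simps(3)[of b] by simp
  have h: "?h \<in> Arr (C 0)" "src (C 0) ?h = hd a" "tgt (C 0) ?h = hd b"
    using Cons x' by simp_all
  have "cong1 M (mpath 0 f b \<cdot>\<^sub>p (es, a)) (mpath 0 f b \<cdot>\<^sub>p mpath 0 ?h a)"
    using Cons x' by (intro cong1.comp cong1.refl) simp_all
  also have "cong1 M \<dots> (mpath 0 (f \<star>\<^bsub>C 0\<^esub> ?h) a)"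
    using x' h b by (intro multi_cong1(1)) simp_all
  finally (cong1.trans) show ?case
    using x x' by (simp add: mpath_def)
qed

lemma tm_normal_form:
  "wf_tm M t \<Longrightarrow> cong2 M t (mcell 0 (ev2 (C 0) hd base1 base2 t) (psrc (tdom M t)))"
proof (induction t)
  case (Gen x)
  then show ?case by (cases x) (auto intro: cong2.refl)
next
  case (Idt p)
  let ?f = "ev1 (C 0) hd base1 p"
  have "cong2 M (Idt p) (mid 0 ?f (psrc p))"
    using Idt path_normal_form by (simp add: cong2.Idt)
  also have "cong2 M \<dots> (mcell 0 (id2 (C 0) ?f) (psrc p))"
    using Idt by (intro cong2.sym[OF cong2.rel]) (simp add: multi_rel2.id2)
  finally (cong2.trans) show ?case by simp
next
  case (VC s t)
  let ?s = "ev2 (C 0) hd base1 base2 s" and ?t = "ev2 (C 0) hd base1 base2 t"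
  let ?a = "psrc (tdom M t)"
  have st: "wf_tm M s" "wf_tm M t" "psrc (tdom M s) = ?a" "dom2 (C 0) ?s = cod2 (C 0) ?t"
    using VC.prems cong1_path[of "tdom M s" "tcod M t"] by (auto simp: B.ev1_cong)
  have "cong2 M (VC s t) (VC (mcell 0 ?s ?a) (mcell 0 ?t ?a))"
    using VC st by (intro cong2.VC) simp_all
  also have "cong2 M \<dots> (mcell 0 (?s \<bullet>\<^bsub>C 0\<^esub> ?t) ?a)"
    using st by (intro cong2.rel) (simp add: multi_rel2.vcomp)
  finally (cong2.trans) show ?case by simp
next
  case (HC s t)
  let ?s = "ev2 (C 0) hd base1 base2 s" and ?t = "ev2 (C 0) hd base1 base2 t"
  let ?a = "psrc (tdom M t)"
  have st: "wf_tm M s" "wf_tm M t" "psrc (tdom M s) = ptgt M (tdom M t)"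
    using HC.prems by auto
  then have a: "psrc (tdom M s) = ?a[0 := tgt0 (C 0) ?t]"
    by (intro hd_inj) simp_all
  have "cong2 M (HC s t) (HC (mcell 0 ?s (psrc (tdom M s))) (mcell 0 ?t ?a))"
    using HC st by (intro cong2.HC) simp_all
  also have "cong2 M \<dots> (mcell 0 (?s \<diamondop>\<^bsub>C 0\<^esub> ?t) ?a)"
  proof -
    have "multi_rel2 C (Suc 0) (HC (mcell 0 ?s (?a[0 := tgt0 (C 0) ?t])) (mcell 0 ?t ?a))
        (mcell 0 (?s \<diamondop>\<^bsub>C 0\<^esub> ?t) ?a)"
      by (rule multi_rel2.hcomp) (use st in simp_all)
    then show ?thesis
      unfolding a by (intro cong2.rel) simp
  qed
  finally (cong2.trans) show ?case by simp
qed

lemma single_presents: "presents (C 0) M hd base1 base2"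
proof
  show "bij_betw hd (P0 M) (Obj (C 0))"
    by (rule bij_betw_byWitness[where f' = "\<lambda>x. [x]"]) auto
  show "cong1 M p q" if pq: "is_path M p" "is_path M q"
    and eq: "ev1 (C 0) hd base1 p = ev1 (C 0) hd base1 q" for p q
  proof -
    have "psrc p = psrc q"
      using pq B.ev1_simps(2)[of p] B.ev1_simps(2)[of q] eq by (intro hd_inj) simp_all
    then show ?thesis
      using path_normal_form[OF pq(1)] path_normal_form[OF pq(2)] eq
      by (metis cong1.sym cong1.trans)
  qed
  show "cong2 M s t" if st: "wf_tm M s" "wf_tm M t"
    and eq: "ev2 (C 0) hd base1 base2 s = ev2 (C 0) hd base1 base2 t" for s t
  proof -
    have "ev1 (C 0) hd base1 (tdom M s) = ev1 (C 0) hd base1 (tdom M t)"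
      using st B.ev2_simps(2)[of s] B.ev2_simps(2)[of t] eq by simp
    then have "psrc (tdom M s) = psrc (tdom M t)"
      using st B.ev1_simps(2)[of "tdom M s"] B.ev1_simps(2)[of "tdom M t"] by (intro hd_inj) simp_all
    then show ?thesis
      using tm_normal_form[OF st(1)] tm_normal_form[OF st(2)] eq
      by (metis cong2.sym cong2.trans)
  qed
  show "\<exists>p. is_path M p \<and> ev1 (C 0) hd base1 p = f" if "f \<in> Arr (C 0)" for f
    using that by (intro exI[of _ "mpath 0 f [src (C 0) f]"]) simp
  show "\<exists>t. wf_tm M t \<and> ev2 (C 0) hd base1 base2 t = \<alpha>" if "\<alpha> \<in> Cell (C 0)" for \<alpha>
    using that by (intro exI[of _ "mcell 0 \<alpha> [src0 (C 0) \<alpha>]"]) simp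
qed

end


section \<open>The iterated product\<close>

primrec edge_cell where "edge_cell C n (MArr i f a) = iter_arr C n i f a"

primrec gen_cell where
  "gen_cell C n (MCell i \<phi> a) = iter_cell C n i \<phi> a"
| "gen_cell C n (MGam i j f g a) = iter_gam C n i j f g a"

lemma iter_gray_presents:
  assumes "\<And>i. i < Suc k \<Longrightarrow> strict_2category (C i)"
  shows "presents (iter_gray C (Suc k)) (multi_presentation C (Suc k)) (\<lambda>a. a)
    (edge_cell C (Suc k)) (gen_cell C (Suc k))"
  using assms
proof (induction k)
  case 0
  interpret single_factor C
    by (intro single_factor.intro family.intro) (rule 0)
  show ?case
  proof (rule presents_image[OF single_presents])
    show "strict_2isomorphism (C 0) (iter_gray C (Suc 0)) (\<lambda>a. [a]) Arr_base Cell_base"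
      unfolding iter_gray.simps by (rule relabel_isomorphism) (auto intro: inj_onI factor)
  next
    fix x
    assume "x \<in> P1 M"
    then show "edge_cell C (Suc 0) x = Arr_base (base1 x)" by (cases x) simp
  next
    fix x
    assume "x \<in> P2 M"
    then show "gen_cell C (Suc 0) x = Cell_base (base2 x)" by (cases x) auto
  qed simp
next
  case (Suc k)
  interpret family_Suc C "Suc k"
    by (intro family_Suc.intro family.intro) (rule Suc.prems)
  interpret gray_step C "Suc k" "iter_gray C (Suc k)" "edge_cell C (Suc k)" "gen_cell C (Suc k)"
    by (intro gray_step.intro Suc family_Suc_axioms) simp
  show ?case
  proof (rule presents_image[OF gray_presents])
    have "inj_on arr_in (Arr Z)" "inj_on cell_in (Cell Z)"
      using Q.rep_inj unfolding gray_def by (auto simp: inj_on_def arr_in_def cell_in_def)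
    then show "strict_2isomorphism Z (iter_gray C (Suc (Suc k))) obj_in arr_in cell_in"
      unfolding iter_gray.simps
      by (intro relabel_isomorphism Q.Z.strict_2category_axioms) (auto simp: inj_on_def obj_in_def)
  next
    fix a
    assume "a \<in> P0 P'"
    then show "a = obj_in (fwd0 a)" by (auto simp: obj_in_def elim: tuples_SucE)
  next
    fix x
    assume "x \<in> P1 P'"
    then show "edge_cell C (Suc (Suc k)) x = arr_in (fwd1 x)"
      by (cases x) (simp add: Let_def less_Suc_eq_le)
  next
    fix x
    assume "x \<in> P2 P'"
    then show "gen_cell C (Suc (Suc k)) x = cell_in (fwd2 x)"
      by (cases x) (simp_all add: Let_def less_Suc_eq_le)
  qed
qed

theorem theorem3p2:
  fixes C :: "nat \<Rightarrow> ('o, 'a, 't) two_cat" and n :: nat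
  assumes "n \<ge> 1"
    and "\<And>i. i < n \<Longrightarrow> strict_2category (C i)"
  shows "\<exists>F1 F2.
    strict_2isomorphism (multi_gray C n) (iter_gray C n) (\<lambda>a. a) F1 F2 \<and>
    (\<forall>i f a. arr_at C n i f a \<longrightarrow> F1 (multi_arr C n i f a) = iter_arr C n i f a) \<and>
    (\<forall>i \<phi> a. cell_at C n i \<phi> a \<longrightarrow> F2 (multi_cell C n i \<phi> a) = iter_cell C n i \<phi> a) \<and>
    (\<forall>i j f g a. i < j \<and> arr_at C n i f a \<and> arr_at C n j g a \<longrightarrow>
      F2 (multi_gam C n i j f g a) = iter_gam C n i j f g a)"
proof -
  obtain k where k: "n = Suc k"
    using assms(1) by (cases n) auto
  interpret family C n
    by (rule family.intro) (rule assms(2))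
  interpret presents "iter_gray C n" M "\<lambda>a. a" "edge_cell C n" "gen_cell C n"
    unfolding k by (rule iter_gray_presents) (use assms(2) k in simp)
  show ?thesis
  proof (intro exI conjI allI impI)
    show "strict_2isomorphism (multi_gray C n) (iter_gray C n) (\<lambda>a. a)
        (\<lambda>A. ev1 (iter_gray C n) (\<lambda>a. a) (edge_cell C n) (rep A))
        (\<lambda>S. ev2 (iter_gray C n) (\<lambda>a. a) (edge_cell C n) (gen_cell C n) (rep S))"
      unfolding multi_gray_def by (rule induced_isomorphism)
    show "ev1 (iter_gray C n) (\<lambda>a. a) (edge_cell C n) (rep (multi_arr C n i f a)) = iter_arr C n i f a"
      if "arr_at C n i f a" for i f a
      using that ev1_single[of "MArr i f a" a] by (simp add: multi_arr_def mpath_def del: ev1.simps)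
    show "ev2 (iter_gray C n) (\<lambda>a. a) (edge_cell C n) (gen_cell C n) (rep (multi_cell C n i \<phi> a))
        = iter_cell C n i \<phi> a" if "cell_at C n i \<phi> a" for i \<phi> a
      using that by (simp add: multi_cell_def)
    show "ev2 (iter_gray C n) (\<lambda>a. a) (edge_cell C n) (gen_cell C n) (rep (multi_gam C n i j f g a))
        = iter_gam C n i j f g a" if "i < j \<and> arr_at C n i f a \<and> arr_at C n j g a" for i j f g a
      using that by (simp add: multi_gam_def)
  qed
qed

end
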